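(* Let $n,k,t$ be positive integers with $k\ge t+1$ and $n\ge 4k+6$. Let $\mathcal F,\mathcal G\subseteq \genfrac{[}{]}{0pt}{}{V}{k}$ be cross $t$-intersecting families such that $\dim\big(\bigcap_{F\in\mathcal F}F\big)<t$ and $\dim\big(\bigcap_{G\in\mathcal G}G\big)<t$, and such that $|\mathcal F||\mathcal G|$ is maximum among all pairs of cross $t$-intersecting families $\mathcal F',\mathcal G'\subseteq\genfrac{[}{]}{0pt}{}{V}{k}$ satisfying $\dim\big(\bigcap_{F\in\mathcal F'}F\big)<t$ and $\dim\big(\bigcap_{G\in\mathcal G'}G\big)<t$. Then: (i) If $k>2t+1$, then $\mathcal F=\mathcal H_1(L,M,T)$ and $\mathcal G=\mathcal H_1(M,L,T)$ for some $M,L\in\genfrac{[}{]}{0pt}{}{V}{k+1}$ with $\dim(M\cap L)\ge t+2$ and some $T\in\genfrac{[}{]}{0pt}{}{M\cap L}{t}$. (ii) If $k\le 2t+1$, then either $\mathcal F=\mathcal G=\mathcal H_2(Z)$ for some $Z\in\genfrac{[}{]}{0pt}{}{V}{t+2}$, or $(k,t)=(3,1)$ and $\mathcal F=\mathcal H_1(L,M,T)$, $\mathcal G=\mathcal H_1(M,L,T)$ for some $M,L\in\genfrac{[}{]}{0pt}{}{V}{4}$ with $\dim(M\cap L)\ge 3$ and some $T\in\genfrac{[}{]}{0pt}{}{M\cap L}{1}$.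
   Context: Let $q$ be a prime power and $V$ an $n$-dimensional vector space over the finite field $\mathbb F_q$. For a subspace $W$ of $V$ and an integer $j$, $\genfrac{[}{]}{0pt}{}{W}{j}$ denotes the set of all $j$-dimensional subspaces of $W$. Two families $\mathcal F,\mathcal G\subseteq\genfrac{[}{]}{0pt}{}{V}{k}$ are cross $t$-intersecting if $\dim(F\cap G)\ge t$ for all $F\in\mathcal F$, $G\in\mathcal G$. For $M,L\in\genfrac{[}{]}{0pt}{}{V}{k+1}$ with $\dim(M\cap L)\ge t$ and $T\in\genfrac{[}{]}{0pt}{}{M\cap L}{t}$, define $\mathcal H_1(L,M,T)=\{F\in\genfrac{[}{]}{0pt}{}{V}{k}: T\subseteq F,\ \dim(F\cap L)\ge t+1\}\cup\{F\in\genfrac{[}{]}{0pt}{}{M}{k}: T\not\subseteq F\}$. For $Z\in\genfrac{[}{]}{0pt}{}{V}{t+2}$, define $\mathcal H_2(Z)=\{F\in\genfrac{[}{]}{0pt}{}{V}{k}: \dim(F\cap Z)\ge t+1\}$. *)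

theory Defs
  imports Complex_Main
begin

(* V is the whole type of vectors, with scalar multiplication s.  The library's dim is 0 for
   infinite-dimensional spaces; the notions below are meant for V of finite dimension,
   where this does not occur. *)

definition subspaces_of_dim ::
    "('a::field \<Rightarrow> 'v::ab_group_add \<Rightarrow> 'v) \<Rightarrow> 'v set \<Rightarrow> nat \<Rightarrow> 'v set set" where
  "subspaces_of_dim s W j = {U. module.subspace s U \<and> U \<subseteq> W \<and> vector_space.dim s U = j}"

definition cross_intersecting ::
    "('a::field \<Rightarrow> 'v::ab_group_add \<Rightarrow> 'v) \<Rightarrow> nat \<Rightarrow> 'v set set \<Rightarrow> 'v set set \<Rightarrow> bool" where
  "cross_intersecting s t \<F> \<G> \<longleftrightarrow> (\<forall>F\<in>\<F>. \<forall>G\<in>\<G>. vector_space.dim s (F \<inter> G) \<ge> t)"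

(* The intersection of the empty family is UNIV, i.e. all of V. *)
definition nontrivial_cross_pair ::
    "('a::field \<Rightarrow> 'v::ab_group_add \<Rightarrow> 'v) \<Rightarrow> nat \<Rightarrow> nat \<Rightarrow> 'v set set \<Rightarrow> 'v set set \<Rightarrow> bool" where
  "nontrivial_cross_pair s k t \<F> \<G> \<longleftrightarrow>
     \<F> \<subseteq> subspaces_of_dim s UNIV k \<and> \<G> \<subseteq> subspaces_of_dim s UNIV k \<and>
     cross_intersecting s t \<F> \<G> \<and>
     vector_space.dim s (\<Inter>\<F>) < t \<and> vector_space.dim s (\<Inter>\<G>) < t"

definition H1 ::
    "('a::field \<Rightarrow> 'v::ab_group_add \<Rightarrow> 'v) \<Rightarrow> nat \<Rightarrow> nat \<Rightarrow> 'v set \<Rightarrow> 'v set \<Rightarrow> 'v set \<Rightarrow> 'v set set" where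
  "H1 s k t L M T =
     {F \<in> subspaces_of_dim s UNIV k. T \<subseteq> F \<and> vector_space.dim s (F \<inter> L) \<ge> t + 1} \<union>
     {F \<in> subspaces_of_dim s M k. \<not> T \<subseteq> F}"

definition H2 ::
    "('a::field \<Rightarrow> 'v::ab_group_add \<Rightarrow> 'v) \<Rightarrow> nat \<Rightarrow> nat \<Rightarrow> 'v set \<Rightarrow> 'v set set" where
  "H2 s k t Z = {F \<in> subspaces_of_dim s UNIV k. vector_space.dim s (F \<inter> Z) \<ge> t + 1}"

end

theory Submission
  imports Defs
begin

text \<open>
  Call a subspace a cover of a family if it meets all members in dimension at least t; by
  nontriviality no cover has dimension t, and every member of one family covers the other.
  If S lies in a member G of the second family and does not cover the first, then for some F with
  dim (S \<inter> F) < t the member G contains one of few enlargements of S inside S + F.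
  Iterating this bounds each family in terms of the least dimensions of covers, and n \<ge> 4k + 6
  forces both families to have covers of dimension t + 1.  By maximality the covers of dimension t + 1
  of the two families are again cross t-intersecting, and up to an error that is negligible
  for n \<ge> 4k + 6 the product of the sizes is the product of the numbers of these covers.
  The latter is at most the square of the larger of the numbers of points of a (k + 1 - t)-space
  and of a (t + 2)-space, with equality only for two full pencils through a common t-space or for all
  hyperplanes of a (t + 2)-space; these are the families H1 and H2.  For k = 2t + 1 the two leading
  terms agree and the second-order terms decide.
\<close>

section \<open>Subspaces over a finite field\<close>

text \<open>The number of k-spaces through a subspace drops by a factor of at least q^(n - k) >=
  q^(3k + 6) with each further dimension, while a dimension gained in an enlargement costs at most
  q^(k - t + 1) choices. So every dimension of a cover in excess of t + 1 loses; as only the product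
  of the two sizes is known to be large, the excesses of both families are treated through their
  sum. The comparison of cover numbers rests on integrality: if their product is not the optimal
  M^2, it misses it by at least 1, and |F||G| misses M^2 X^2 by about X^2, where X is the number of
  k-spaces through a (t + 1)-space. Two errors must stay below that: the overlaps in the lower
  bound, of relative order M^3 / q^(n - k), and the members over no small cover. Either estimate
  uses up the exponent 3k + 6 exactly, whence 4k + 6. At k = 2t + 1 the case t = 1 is special
  because the number of k-spaces through a (t + 2)-space is then only 1, so that the second-order
  terms no longer dominate the rest.\<close>

text \<open>The Gaussian number (q^j - 1) / (q - 1), counting the points, and by duality the
  hyperplanes, of a j-dimensional space. The sum avoids division of natural numbers.\<close>

definition qnum :: "nat \<Rightarrow> nat \<Rightarrow> nat" where
  "qnum q j = (\<Sum>i<j. q ^ i)"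

lemma qnum_0 [simp]: "qnum q 0 = 0"
  by (simp add: qnum_def)

lemma qnum_Suc: "qnum q (Suc j) = q * qnum q j + 1"
  unfolding qnum_def by (subst sum.lessThan_Suc_shift) (simp add: sum_distrib_left)

lemma qnum_Suc_power: "qnum q (Suc j) = qnum q j + q ^ j"
  by (simp add: qnum_def)

lemma qnum_1 [simp]: "qnum q (Suc 0) = 1"
  by (simp add: qnum_def)

lemma qnum_pos: "0 < j \<Longrightarrow> 0 < qnum q j"
  by (cases j) (simp_all add: qnum_Suc)

lemma qnum_mono: "i \<le> j \<Longrightarrow> qnum q i \<le> qnum q j"
  unfolding qnum_def by (rule sum_mono2) auto

lemma qnum_less_iff:
  assumes "0 < q" shows "qnum q i < qnum q j \<longleftrightarrow> i < j"
proof -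
  have "strict_mono (qnum q)"
    unfolding strict_mono_Suc_iff using assms by (simp add: qnum_Suc_power)
  then show ?thesis by (rule strict_mono_less)
qed

lemma qnum_add: "qnum q (i + j) = qnum q i + q ^ i * qnum q j"
  by (induction j) (simp_all add: qnum_Suc_power power_add algebra_simps)

lemma qnum_eq: "qnum q j * (q - 1) = q ^ j - 1"
  by (cases q; induction j) (simp_all add: qnum_Suc_power algebra_simps)

lemma qnum_less_power: "2 \<le> q \<Longrightarrow> qnum q j < q ^ j"
proof (induction j)
  case (Suc j)
  have "2 * q ^ j \<le> q * q ^ j" using Suc.prems by (rule mult_le_mono1)
  with Suc.IH[OF Suc.prems] show ?case unfolding qnum_Suc_power power_Suc by linarith
qed simp

lemma power_le_qnum: "q ^ j \<le> qnum q (Suc j)"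
  by (simp add: qnum_Suc_power)

lemma qnum_ratio_ge:
  assumes "i \<le> j" "0 < q" shows "q ^ (j - i) * qnum q i \<le> qnum q j"
  using qnum_add[of q "j - i" i] assms by simp

lemma qnum_ratio_le:
  assumes "2 \<le> q" "0 < i" "i \<le> j" shows "qnum q j \<le> q ^ (j - i + 1) * qnum q i"
proof -
  have "qnum q j \<le> q ^ j" using qnum_less_power[OF assms(1)] less_imp_le by blast
  also have "\<dots> = q ^ (j - i + 1) * q ^ (i - 1)"
    using assms by (simp flip: power_add power_Suc add: Suc_diff_le)
  also have "\<dots> \<le> q ^ (j - i + 1) * qnum q i"
    using power_le_qnum[of q "i - 1"] assms by simp
  finally show ?thesis .
qed

lemma double_count:
  assumes "finite A" "finite B"
    and "\<And>a. a \<in> A \<Longrightarrow> card {b \<in> B. R a b} = m"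
    and "\<And>b. b \<in> B \<Longrightarrow> card {a \<in> A. R a b} = n"
  shows "card A * m = card B * n"
proof -
  have "(\<Sum>a\<in>A. card {b \<in> B. R a b}) = (\<Sum>b\<in>B. card {a \<in> A. R a b})"
    using assms(1,2) by (rule sum_multicount_gen) simp
  with assms(3,4) show ?thesis by simp
qed

locale finite_vector_space = finite_dimensional_vector_space scale Basis
  for scale :: "'a::{field,finite} \<Rightarrow> 'v::ab_group_add \<Rightarrow> 'v" (infixr \<open>*s\<close> 75) and Basis +
  fixes q n :: nat
  assumes q_eq: "q = card (UNIV :: 'a set)" and n_eq: "dim UNIV = n"
begin

lemma q_ge_2: "2 \<le> q"
proof -
  have "card {0::'a, 1} \<le> q" unfolding q_eq by (intro card_mono) auto
  then show ?thesis by simp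
qed

lemma q_pos: "0 < q" using q_ge_2 by simp

lemma card_Basis [simp]: "card Basis = n" using n_eq by simp

abbreviation ssum :: "'v set \<Rightarrow> 'v set \<Rightarrow> 'v set" (infixl \<open>\<squnion>\<close> 65) where
  "S \<squnion> T \<equiv> span (S \<union> T)"

lemma ssum_upper: "S \<subseteq> S \<squnion> T" "T \<subseteq> S \<squnion> T"
  using span_superset[of "S \<union> T"] by auto

lemma ssum_least: "S \<subseteq> W \<Longrightarrow> T \<subseteq> W \<Longrightarrow> subspace W \<Longrightarrow> S \<squnion> T \<subseteq> W"
  by (rule span_minimal) auto

lemma dim_ssum:
  assumes "subspace S" "subspace T"
  shows "dim (S \<squnion> T) + dim (S \<inter> T) = dim S + dim T"
proof -
  have "span S = S" "span T = T" using assms by simp_all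
  then show ?thesis using dim_sums_Int[OF assms] unfolding span_Un by (simp only:)
qed

lemma dim_less:
  assumes "subspace S" "subspace T" "S \<subset> T" shows "dim S < dim T"
proof -
  have "span S = S" "span T = T" using assms by simp_all
  then show ?thesis using dim_psubset[of S T] assms by (simp only:)
qed

lemma dim_insert_notin:
  assumes "subspace S" "x \<notin> S" shows "dim (span (insert x S)) = Suc (dim S)"
proof -
  have "span S = S" using assms by simp
  with assms show ?thesis unfolding dim_span by (simp only: dim_insert) simp
qed

lemma card_span_insert:
  assumes S: "subspace S" "finite S" and x: "x \<notin> S"
  shows "card (span (insert x S)) = q * card S" and "finite (span (insert x S))"
proof -
  have eq: "span (insert x S) = (\<lambda>(c, s). c *s x + s) ` (UNIV \<times> S)"
  proof (intro set_eqI iffI)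
    fix y assume "y \<in> span (insert x S)"
    then obtain c where "y - c *s x \<in> span S" by (auto simp: span_breakdown_eq)
    then have "y - c *s x \<in> S" using S(1) by (metis span_eq_iff)
    moreover have "y = c *s x + (y - c *s x)" by simp
    ultimately show "y \<in> (\<lambda>(c, s). c *s x + s) ` (UNIV \<times> S)" by (auto intro!: rev_image_eqI)
  next
    fix y assume "y \<in> (\<lambda>(c, s). c *s x + s) ` (UNIV \<times> S)"
    then obtain c s where "y = c *s x + s" "s \<in> S" by auto
    then show "y \<in> span (insert x S)"
      by (simp add: span_add span_scale span_base)
  qed
  have "inj_on (\<lambda>(c, s). c *s x + s) (UNIV \<times> S)"
  proof (rule inj_onI, clarify)
    fix c d s r assume sr: "s \<in> S" "r \<in> S" and e: "c *s x + s = d *s x + r"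
    have cd: "c = d"
    proof (rule ccontr)
      assume "c \<noteq> d"
      have "c *s x = d *s x + r - s" using e by (metis add_diff_cancel_right')
      then have "(c - d) *s x = r - s" by (simp add: scale_left_diff_distrib)
      then have "(c - d) *s x \<in> S" using sr S subspace_diff by simp
      then have "inverse (c - d) *s ((c - d) *s x) \<in> S" using S subspace_scale by blast
      with \<open>c \<noteq> d\<close> x show False by simp
    qed
    with e show "c = d \<and> s = r" by simp
  qed
  then show "card (span (insert x S)) = q * card S"
    unfolding eq by (simp add: card_image card_cartesian_product q_eq)
  show "finite (span (insert x S))" unfolding eq using S by simp
qed

lemma finite_card_span_finite:
  "finite B \<Longrightarrow> finite (span B) \<and> card (span B) = q ^ dim B"
proof (induction B rule: finite_induct)
  case (insert x B)
  show ?case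
  proof (cases "x \<in> span B")
    case True
    then show ?thesis using insert by (simp add: span_redundant dim_insert)
  next
    case False
    have "span (insert x (span B)) = span (insert x B)"
      by (simp only: span_insert span_span)
    with False card_span_insert[of "span B" x] insert show ?thesis by (simp add: dim_insert)
  qed
qed simp

lemma finite_UNIV_V: "finite (UNIV :: 'v set)"
  using finite_card_span_finite[OF finite_Basis] span_Basis by simp

lemma finite_V [simp]: "finite (S :: 'v set)"
  by (rule finite_subset[OF subset_UNIV finite_UNIV_V])

lemma finite_VV [simp]: "finite (\<F> :: 'v set set)"
  by (rule finite_subset[OF subset_UNIV]) (simp add: Finite_Set.finite_set finite_UNIV_V)

lemma card_subspace: "subspace S \<Longrightarrow> card S = q ^ dim S"
  using finite_card_span_finite[of S] by (metis finite_V span_eq_iff)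

text \<open>One rank of the interval [S, W] in the subspace lattice. With S = {0} it consists of the
  r-subspaces of W, with W = UNIV of the r-spaces through S, so that no quotient space has to be
  formed.\<close>

definition intv :: "'v set \<Rightarrow> 'v set \<Rightarrow> nat \<Rightarrow> 'v set set" where
  "intv S W r = {F. subspace F \<and> S \<subseteq> F \<and> F \<subseteq> W \<and> dim F = r}"

lemma intv_extensions_eq:
  assumes "subspace S" "subspace W" "S \<subseteq> W"
  shows "intv S W (Suc (dim S)) = (\<lambda>x. span (insert x S)) ` (W - S)"
proof (intro set_eqI iffI)
  fix F assume F: "F \<in> intv S W (Suc (dim S))"
  then have "\<not> F \<subseteq> S" using dim_subset[of F S] by (auto simp: intv_def)
  then obtain x where x: "x \<in> F" "x \<notin> S" by auto
  have "span (insert x S) \<subseteq> F" using F x by (intro span_minimal) (auto simp: intv_def)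
  moreover have "dim F \<le> dim (span (insert x S))"
    using F x dim_insert_notin[OF assms(1)] by (auto simp: intv_def)
  ultimately have "span (insert x S) = F"
    using F by (intro subspace_dim_equal) (auto simp: intv_def)
  with F x show "F \<in> (\<lambda>x. span (insert x S)) ` (W - S)" by (auto simp: intv_def)
next
  fix F assume "F \<in> (\<lambda>x. span (insert x S)) ` (W - S)"
  then obtain x where x: "x \<in> W" "x \<notin> S" "F = span (insert x S)" by auto
  have "F \<subseteq> W" unfolding x(3) using x assms by (intro span_minimal) auto
  moreover have "S \<subseteq> F" unfolding x(3) using span_superset[of "insert x S"] by auto
  ultimately show "F \<in> intv S W (Suc (dim S))"
    using x dim_insert_notin[OF assms(1) x(2)] by (simp add: intv_def)
qed

text \<open>These are the points of the quotient W / S: with S removed, the extensions partition W -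
  S into blocks of q^(dim S) (q - 1) vectors.\<close>

lemma card_extensions:
  assumes S: "subspace S" and W: "subspace W" and SW: "S \<subseteq> W"
  shows "card (intv S W (Suc (dim S))) = qnum q (dim W - dim S)"
proof -
  let ?E = "intv S W (Suc (dim S))"
  have un: "(\<Union>F\<in>?E. F - S) = W - S"
  proof (intro set_eqI iffI)
    fix x assume x: "x \<in> W - S"
    then have "span (insert x S) \<in> ?E" by (auto simp: intv_extensions_eq[OF assms])
    with x show "x \<in> (\<Union>F\<in>?E. F - S)" by (blast intro: span_base)
  qed (auto simp: intv_def)
  have dj: "(F - S) \<inter> (F' - S) = {}" if "F \<in> ?E" "F' \<in> ?E" "F \<noteq> F'" for F F'
  proof (rule ccontr)
    assume "(F - S) \<inter> (F' - S) \<noteq> {}"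
    then obtain x where x: "x \<in> F" "x \<in> F'" "x \<notin> S" by auto
    have "span (insert x S) = G" if "G \<in> ?E" "x \<in> G" for G
      using that x dim_insert_notin[OF S, of x]
      by (intro subspace_dim_equal span_minimal) (auto simp: intv_def)
    with that x show False by metis
  qed
  have "card (W - S) = (\<Sum>F\<in>?E. card (F - S))"
    unfolding un[symmetric] using dj by (intro card_UN_disjoint) auto
  also have "\<dots> = (\<Sum>F\<in>?E. q ^ dim S * (q - 1))"
    using S by (intro sum.cong) (auto simp: intv_def card_Diff_subset card_subspace algebra_simps)
  finally have "card ?E * (q ^ dim S * (q - 1)) = q ^ dim W - q ^ dim S"
    using S W SW by (simp add: card_Diff_subset card_subspace)
  also have "\<dots> = q ^ dim S * (q ^ (dim W - dim S) - 1)"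
    using dim_subset[OF SW] by (simp add: right_diff_distrib' flip: power_add)
  also have "\<dots> = qnum q (dim W - dim S) * (q ^ dim S * (q - 1))"
    using qnum_eq[of q "dim W - dim S"] by (simp add: mult_ac)
  finally show ?thesis using q_ge_2 by simp
qed

end

text \<open>
  The number of ways to enlarge S by i dimensions inside a space of dimension dim S + h without
  changing the intersection with a subspace U, where d = dim U - dim (S \<inter> U); the division is
  exact.  The Gaussian binomial coefficient is the case d = 0.
\<close>

fun avoid_count :: "nat \<Rightarrow> nat \<Rightarrow> nat \<Rightarrow> nat \<Rightarrow> nat" where
  "avoid_count q h d 0 = 1"
| "avoid_count q h d (Suc i) =
     (qnum q h - qnum q d) * avoid_count q (h - 1) d i div qnum q (Suc i)"

section \<open>Counting in intervals of the subspace lattice\<close>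

context finite_vector_space
begin

lemma intvD:
  assumes "F \<in> intv S W r"
  shows "subspace F" "S \<subseteq> F" "F \<subseteq> W" "dim F = r"
  using assms by (auto simp: intv_def)

lemma intv_self:
  assumes S: "subspace S" and "S \<subseteq> W" shows "intv S W (dim S) = {S}"
proof (intro equalityI subsetI)
  fix F assume "F \<in> intv S W (dim S)"
  with S have "S = F" by (intro subspace_dim_equal) (simp_all add: intv_def)
  then show "F \<in> {S}" by simp
qed (use assms in \<open>simp add: intv_def\<close>)

lemma intv_empty: "r < dim S \<Longrightarrow> intv S W r = {}"
  unfolding intv_def by (metis (mono_tags, lifting) Collect_empty_eq dim_subset not_le)

lemma intv_empty': "dim W < r \<Longrightarrow> intv S W r = {}"
  unfolding intv_def by (metis (mono_tags, lifting) Collect_empty_eq dim_subset not_le)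

text \<open>An extension by one dimension meets U in more than S does exactly when it is spanned by
  S and a vector of U. So the bad extensions are those inside \<open>S \<squnion> U\<close>, which
  can be counted.\<close>

lemma extension_avoids_iff:
  assumes S: "subspace S" and U: "subspace U" and S': "S' \<in> intv S W (Suc (dim S))"
  shows "S' \<inter> U = S \<inter> U \<longleftrightarrow> \<not> S' \<subseteq> S \<squnion> U"
proof
  assume eq: "S' \<inter> U = S \<inter> U"
  have "dim (S' \<squnion> U) > dim (S \<squnion> U)"
    using dim_ssum[OF S U] dim_ssum[OF intvD(1)[OF S'] U] eq intvD(4)[OF S'] by simp
  moreover have "dim (S' \<squnion> U) \<le> dim (S \<squnion> U)" if "S' \<subseteq> S \<squnion> U"
    using that by (intro dim_subset ssum_least ssum_upper subspace_span)
  ultimately show "\<not> S' \<subseteq> S \<squnion> U" by auto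
next
  assume not: "\<not> S' \<subseteq> S \<squnion> U"
  show "S' \<inter> U = S \<inter> U"
  proof (rule ccontr)
    assume "S' \<inter> U \<noteq> S \<inter> U"
    then obtain x where x: "x \<in> S'" "x \<in> U" "x \<notin> S" using intvD(2)[OF S'] by auto
    have "span (insert x S) = S'"
      using x S' dim_insert_notin[OF S x(3)]
      by (intro subspace_dim_equal span_minimal) (auto simp: intv_def)
    moreover have "span (insert x S) \<subseteq> S \<squnion> U" using x by (intro span_mono) auto
    ultimately show False using not by simp
  qed
qed

lemma card_extensions_avoiding:
  assumes S: "subspace S" and W: "subspace W" and U: "subspace U" and "S \<subseteq> W" "U \<subseteq> W"
  shows "card {S' \<in> intv S W (Suc (dim S)). S' \<inter> U = S \<inter> U} =
    qnum q (dim W - dim S) - qnum q (dim U - dim (S \<inter> U))"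
proof -
  have "{S' \<in> intv S W (Suc (dim S)). S' \<inter> U = S \<inter> U} =
      intv S W (Suc (dim S)) - intv S (S \<squnion> U) (Suc (dim S))"
    using extension_avoids_iff[OF S U] by (auto simp: intv_def)
  also have "card \<dots> = qnum q (dim W - dim S) - card (intv S (S \<squnion> U) (Suc (dim S)))"
    using card_extensions[OF S W] ssum_least[of S W U] assms
    by (subst card_Diff_subset) (auto simp: intv_def)
  also have "card (intv S (S \<squnion> U) (Suc (dim S))) = qnum q (dim (S \<squnion> U) - dim S)"
    using S by (intro card_extensions ssum_upper) auto
  also have "dim (S \<squnion> U) - dim S = dim U - dim (S \<inter> U)"
    using dim_ssum[OF S U] by simp
  finally show ?thesis .
qed

text \<open>Flags S < S' < F are counted in two ways. Every intermediate S' inherits the condition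
  on U, since S' \<inter> U lies between S \<inter> U and F \<inter> U. The value m of the next
  level is a hypothesis, to serve both avoidance and, with U = {0}, plain counting.\<close>

lemma card_avoiding_rec:
  assumes S: "subspace S" and W: "subspace W" and U: "subspace U" and SW: "S \<subseteq> W" and UW: "U \<subseteq> W"
    and r: "dim S < r"
    and m: "\<And>S'. S' \<in> intv S W (Suc (dim S)) \<Longrightarrow> S' \<inter> U = S \<inter> U \<Longrightarrow>
      card {F \<in> intv S' W r. F \<inter> U = S' \<inter> U} = m"
  shows "card {F \<in> intv S W r. F \<inter> U = S \<inter> U} * qnum q (r - dim S) =
    (qnum q (dim W - dim S) - qnum q (dim U - dim (S \<inter> U))) * m"
proof -
  let ?A = "{F \<in> intv S W r. F \<inter> U = S \<inter> U}"
  let ?B = "{S' \<in> intv S W (Suc (dim S)). S' \<inter> U = S \<inter> U}"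
  have "card ?A * qnum q (r - dim S) = card ?B * m"
  proof (rule double_count[where R = "\<lambda>F S'. S' \<subseteq> F"])
    fix F assume F: "F \<in> ?A"
    have "{S' \<in> ?B. S' \<subseteq> F} = intv S F (Suc (dim S))" using F by (auto simp: intv_def)
    then show "card {S' \<in> ?B. S' \<subseteq> F} = qnum q (r - dim S)"
      using F card_extensions[OF S, of F] by (simp add: intv_def)
  next
    fix S' assume S': "S' \<in> ?B"
    then have "{F \<in> ?A. S' \<subseteq> F} = {F \<in> intv S' W r. F \<inter> U = S' \<inter> U}"
      by (auto simp: intv_def)
    then show "card {F \<in> ?A. S' \<subseteq> F} = m" using m S' by simp
  qed auto
  then show ?thesis using card_extensions_avoiding[OF S W U SW UW] by simp
qed

text \<open>Along the induction dim U - dim (S \<inter> U) stays fixed and only the codimension of S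
  shrinks. The flag identity is multiplicative, so the division in \<open>avoid_count\<close> is
  exact.\<close>

lemma card_avoiding:
  assumes "subspace S" and W: "subspace W" and U: "subspace U" and "S \<subseteq> W" and UW: "U \<subseteq> W"
    and "dim S + i = r"
  shows "card {F \<in> intv S W r. F \<inter> U = S \<inter> U} =
    avoid_count q (dim W - dim S) (dim U - dim (S \<inter> U)) i"
  using assms(1,4,6)
proof (induction i arbitrary: S)
  case 0
  then have "{F \<in> intv S W r. F \<inter> U = S \<inter> U} = {S}" using intv_self by auto
  then show ?case by simp
next
  case (Suc i)
  let ?d = "dim U - dim (S \<inter> U)"
  have "card {F \<in> intv S W r. F \<inter> U = S \<inter> U} * qnum q (r - dim S) =
      (qnum q (dim W - dim S) - qnum q ?d) * avoid_count q (dim W - dim S - 1) ?d i"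
  proof (rule card_avoiding_rec[OF Suc.prems(1) W U Suc.prems(2) UW])
    fix S' assume "S' \<in> intv S W (Suc (dim S))" "S' \<inter> U = S \<inter> U"
    then show "card {F \<in> intv S' W r. F \<inter> U = S' \<inter> U} = avoid_count q (dim W - dim S - 1) ?d i"
      using Suc.IH[of S'] Suc.prems by (simp add: intv_def)
  qed (use Suc.prems in auto)
  moreover have "r - dim S = Suc i" using Suc.prems by simp
  ultimately have *: "card {F \<in> intv S W r. F \<inter> U = S \<inter> U} * qnum q (Suc i) =
      (qnum q (dim W - dim S) - qnum q ?d) * avoid_count q (dim W - dim S - 1) ?d i"
    by (simp only:)
  have "x = y div c" if "x * c = y" "0 < c" for x y c :: nat
    using that by auto
  from this[OF * qnum_pos] show ?case by (simp only: avoid_count.simps zero_less_Suc)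
qed

lemma avoiding_0: "subspace S \<Longrightarrow> {F \<in> intv S W r. F \<inter> {0} = S \<inter> {0}} = intv S W r"
  by (auto simp: intv_def subspace_0)

lemma card_intv:
  assumes "subspace S" "subspace W" "S \<subseteq> W" "dim S + i = r"
  shows "card (intv S W r) = avoid_count q (dim W - dim S) 0 i"
  using card_avoiding[of S W "{0}" i r] assms unfolding avoiding_0[OF assms(1)]
  by (simp add: subspace_0)

lemma card_intv_rec:
  assumes S: "subspace S" and W: "subspace W" and r: "dim S < r" and S': "S' \<in> intv S W (Suc (dim S))"
  shows "card (intv S W r) * qnum q (r - dim S) = qnum q (dim W - dim S) * card (intv S' W r)"
proof -
  have SW: "S \<subseteq> W" using S' by (auto simp: intv_def)
  have "card {F \<in> intv S W r. F \<inter> {0} = S \<inter> {0}} * qnum q (r - dim S) =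
    (qnum q (dim W - dim S) - qnum q (dim {0} - dim (S \<inter> {0}))) * card (intv S' W r)"
  proof (rule card_avoiding_rec[OF S W _ SW])
    fix S'' assume "S'' \<in> intv S W (Suc (dim S))"
    then show "card {F \<in> intv S'' W r. F \<inter> {0} = S'' \<inter> {0}} = card (intv S' W r)"
      using S' r card_intv[of S'' W "r - Suc (dim S)" r] card_intv[of S' W "r - Suc (dim S)" r] W
      by (auto simp: intv_def[of S] avoiding_0)
  qed (use SW W r in \<open>auto simp: subspace_0\<close>)
  then show ?thesis by (simp add: avoiding_0 S)
qed

lemma extension_exists:
  assumes S: "subspace S" and W: "subspace W" and "S \<subseteq> W" "dim S < dim W"
  obtains S' where "S' \<in> intv S W (Suc (dim S))"
proof -
  have "card (intv S W (Suc (dim S))) > 0"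
    using card_extensions[OF assms(1-3)] qnum_pos[of "dim W - dim S" q] assms(4) by simp
  then show ?thesis using that by (metis card_gt_0_iff ex_in_conv)
qed

text \<open>Each step extends S outside \<open>S \<squnion> U\<close> and raises the dimension of
  this sum by exactly one; there is room for i steps as long as the sum has not filled W.\<close>

lemma avoiding_exists:
  assumes "subspace S" and W: "subspace W" and U: "subspace U" and "S \<subseteq> W" and UW: "U \<subseteq> W"
    and "i + dim (S \<squnion> U) \<le> dim W" "r = dim S + i"
  obtains F where "F \<in> intv S W r" "F \<inter> U = S \<inter> U"
proof -
  have "\<exists>F. F \<in> intv S W r \<and> F \<inter> U = S \<inter> U"
    using assms(1,4,6,7)
  proof (induction i arbitrary: S)
    case 0
    then show ?case by (intro exI[of _ S]) (auto simp: intv_def)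
  next
    case (Suc i)
    have "qnum q (dim U - dim (S \<inter> U)) < qnum q (dim W - dim S)"
      using dim_ssum[OF Suc.prems(1) U] Suc.prems q_pos dim_subset[of "S \<inter> U" U]
      by (simp add: qnum_less_iff)
    then have "card {S' \<in> intv S W (Suc (dim S)). S' \<inter> U = S \<inter> U} > 0"
      using card_extensions_avoiding[OF Suc.prems(1) W U Suc.prems(2) UW] by simp
    then obtain S' where S': "S' \<in> intv S W (Suc (dim S))" "S' \<inter> U = S \<inter> U"
      by (auto simp: card_gt_0_iff)
    have "i + dim (S' \<squnion> U) \<le> dim W"
      using dim_ssum[OF Suc.prems(1) U] dim_ssum[OF intvD(1)[OF S'(1)] U] intvD(4)[OF S'(1)] S'(2)
        Suc.prems(3) by simp
    then obtain F where "F \<in> intv S' W r" "F \<inter> U = S' \<inter> U"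
      using Suc.IH[of S'] S'(1) Suc.prems(4) by (auto simp: intv_def)
    with S' show ?case by (intro exI[of _ F]) (auto simp: intv_def)
  qed
  with that show ?thesis by blast
qed

lemma intv_nonempty:
  assumes S: "subspace S" and W: "subspace W" and "S \<subseteq> W" "dim S \<le> r" "r \<le> dim W"
  obtains F where "F \<in> intv S W r"
proof -
  have "S \<squnion> {0} = S"
    using S by (metis span_eq_iff insert_absorb subspace_0 Un_insert_right sup_bot.right_neutral)
  then show ?thesis
    using avoiding_exists[OF S W _ assms(3), of "{0}" "r - dim S" r] that assms by (auto simp: subspace_0)
qed

text \<open>A crude bound for the Gaussian binomial. Each flag step contributes a quotient of
  Gaussian numbers whose indices always differ by dim W - r, so all i steps cost the same
  factor.\<close>

lemma card_intv_le:
  assumes "subspace S" and W: "subspace W" and "S \<subseteq> W" and "dim S + i = r"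
  shows "card (intv S W r) \<le> (q ^ (dim W - r + 1)) ^ i"
  using assms(1,3,4)
proof (induction i arbitrary: S)
  case 0
  then show ?case using intv_self by auto
next
  case (Suc i)
  show ?case
  proof (cases "r \<le> dim W")
    case False
    then show ?thesis by (simp add: intv_empty')
  next
    case True
    then obtain S' where S': "S' \<in> intv S W (Suc (dim S))"
      using extension_exists[of S W] Suc.prems W by auto
    have "r - dim S = Suc i" using Suc.prems by simp
    have "card (intv S W r) * qnum q (Suc i) = qnum q (dim W - dim S) * card (intv S' W r)"
      using card_intv_rec[of S W r S'] Suc.prems(1) W S' \<open>r - dim S = Suc i\<close> by simp
    also have "\<dots> \<le> (q ^ (dim W - r + 1) * qnum q (Suc i)) * (q ^ (dim W - r + 1)) ^ i"
    proof (rule mult_le_mono)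
      have "dim W - dim S - Suc i = dim W - r" using Suc.prems by simp
      then show "qnum q (dim W - dim S) \<le> q ^ (dim W - r + 1) * qnum q (Suc i)"
        using qnum_ratio_le[OF q_ge_2, of "Suc i" "dim W - dim S"] Suc.prems True by simp
      show "card (intv S' W r) \<le> (q ^ (dim W - r + 1)) ^ i"
        using Suc.IH[of S'] S' Suc.prems by (auto simp: intv_def)
    qed
    finally have "card (intv S W r) * qnum q (Suc i) \<le> (q ^ (dim W - r + 1)) ^ Suc i * qnum q (Suc i)"
      by (simp add: mult_ac)
    then show ?thesis using qnum_pos[of "Suc i" q] by simp
  qed
qed

text \<open>By duality there are as many as points of W / S; instead of a dual space, the flag
  recursion is used, which telescopes to this number.\<close>

lemma card_hyperplanes_over:
  assumes "subspace S" and W: "subspace W" and "S \<subseteq> W" and "dim W = Suc (dim S + i)"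
  shows "card (intv S W (dim S + i)) = qnum q (Suc i)"
  using assms(1,3,4)
proof (induction i arbitrary: S)
  case 0
  then show ?case using intv_self by auto
next
  case (Suc i)
  then obtain S' where S': "S' \<in> intv S W (Suc (dim S))"
    using extension_exists[of S W] W by auto
  have "card (intv S W (dim S + Suc i)) * qnum q (Suc i) =
      qnum q (Suc (Suc i)) * card (intv S' W (dim S + Suc i))"
    using card_intv_rec[of S W "dim S + Suc i" S'] Suc.prems W S' by simp
  also have "card (intv S' W (dim S + Suc i)) = qnum q (Suc i)"
    using Suc.IH[of S'] S' Suc.prems by (auto simp: intv_def)
  finally show ?case using qnum_pos[of "Suc i" q] by simp
qed

lemma card_hyperplanes:
  assumes "subspace W" "dim W = Suc m"
  shows "card (intv {0} W m) = qnum q (Suc m)"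
  using card_hyperplanes_over[of "{0}" W m] assms by (simp add: subspace_0)

end

section \<open>Counting members through a subspace\<close>

context finite_vector_space
begin

text \<open>For j > k the truncated difference k - j would give the value 1 of
  \<open>avoid_count\<close>, hence the case distinction.\<close>

definition over_count :: "nat \<Rightarrow> nat \<Rightarrow> nat" where
  "over_count k j = (if j \<le> k then avoid_count q (n - j) 0 (k - j) else 0)"

lemma card_over: "subspace S \<Longrightarrow> card (intv S UNIV k) = over_count k (dim S)"
  using card_intv[of S UNIV "k - dim S" k] intv_empty[of k S UNIV]
  by (auto simp: over_count_def)

lemma over_count_self [simp]: "over_count k k = 1"
  by (simp add: over_count_def)

text \<open>The exact ratio is qnum q (n - j) / qnum q (k - j), which is at least q^(n - k). This
  factor is how a large n enters the estimates.\<close>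

lemma over_count_Suc_le:
  assumes "k \<le> n" shows "over_count k (Suc j) * q ^ (n - k) \<le> over_count k j"
proof (cases "Suc j \<le> k")
  case True
  obtain S where S: "S \<in> intv {0} UNIV j"
    using intv_nonempty[of "{0}" UNIV j] True assms by auto
  then obtain S' where S': "S' \<in> intv S UNIV (Suc (dim S))"
    using extension_exists[of S UNIV] True assms by (auto simp: intv_def)
  have "over_count k j * qnum q (k - j) = qnum q (n - j) * over_count k (Suc j)"
    using card_intv_rec[of S UNIV k S'] S S' True
    by (simp add: card_over intvD[of S' S UNIV "Suc (dim S)"] intvD[OF S])
  moreover have "q ^ (n - k) * qnum q (k - j) \<le> qnum q (n - j)"
    using qnum_ratio_ge[of "k - j" "n - j" q] assms True q_pos by simp
  ultimately have "(q ^ (n - k) * qnum q (k - j)) * over_count k (Suc j) \<le> over_count k j * qnum q (k - j)"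
    by simp
  then show ?thesis using qnum_pos[of "k - j" q] True by (simp add: mult_ac)
qed (simp add: over_count_def)

lemma over_count_add_le:
  assumes "k \<le> n" shows "over_count k (j + e) * (q ^ (n - k)) ^ e \<le> over_count k j"
proof (induction e)
  case (Suc e)
  have "over_count k (j + Suc e) * (q ^ (n - k)) ^ Suc e
      = over_count k (Suc (j + e)) * q ^ (n - k) * (q ^ (n - k)) ^ e" by simp
  also have "\<dots> \<le> over_count k (j + e) * (q ^ (n - k)) ^ e"
    using over_count_Suc_le[OF assms] by (intro mult_le_mono1)
  finally show ?case using Suc by (rule order_trans)
qed simp

lemma over_count_antimono:
  assumes "k \<le> n" "i \<le> j" shows "over_count k j \<le> over_count k i"
proof -
  have "over_count k j * 1 \<le> over_count k (i + (j - i)) * (q ^ (n - k)) ^ (j - i)"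
    using assms q_pos by (intro mult_le_mono) auto
  then show ?thesis using over_count_add_le[OF assms(1), of i "j - i"] by linarith
qed

text \<open>Bonferroni's inequality: two distinct s-spaces span at least s + 1 dimensions, so each
  overlap has at most \<open>over_count k (Suc s)\<close> elements. Doubling, and a square in place
  of m (m - 1), keep the statement free of division and subtraction.\<close>

lemma card_Union_over_ge:
  assumes "k \<le> n" "\<And>S. S \<in> \<S> \<Longrightarrow> subspace S \<and> dim S = s"
  shows "2 * card \<S> * over_count k s \<le>
    2 * card (\<Union>S\<in>\<S>. intv S UNIV k) + card \<S> * card \<S> * over_count k (Suc s)"
proof -
  have "finite \<S>" by simp
  then show ?thesis using assms(2)
  proof (induction \<S> rule: finite_induct)
    case (insert S \<S>)
    let ?U = "\<Union>S\<in>\<S>. intv S UNIV k"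
    have "card (intv S UNIV k \<inter> ?U) \<le> card (\<Union>S'\<in>\<S>. intv S UNIV k \<inter> intv S' UNIV k)"
      by (intro card_mono) auto
    also have "\<dots> \<le> (\<Sum>S'\<in>\<S>. card (intv S UNIV k \<inter> intv S' UNIV k))"
      using insert.hyps(1) by (rule card_UN_le)
    also have "\<dots> \<le> (\<Sum>S'\<in>\<S>. over_count k (Suc s))"
    proof (rule sum_mono)
      fix S' assume S': "S' \<in> \<S>"
      have "intv S UNIV k \<inter> intv S' UNIV k \<subseteq> intv (S \<squnion> S') UNIV k"
        using ssum_least[of S _ S'] by (auto simp: intv_def)
      then have "card (intv S UNIV k \<inter> intv S' UNIV k) \<le> over_count k (dim (S \<squnion> S'))"
        using card_mono[of "intv (S \<squnion> S') UNIV k"] card_over[of "S \<squnion> S'" k] by simp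
      moreover have "Suc s \<le> dim (S \<squnion> S')"
      proof (rule ccontr)
        assume "\<not> ?thesis"
        then have "dim (S \<squnion> S') \<le> s" by simp
        moreover have "subspace S" "dim S = s" "subspace S'" "dim S' = s"
          using insert.prems S' by auto
        ultimately have "S = S \<squnion> S'" "S' = S \<squnion> S'"
          using subspace_dim_equal[OF _ _ ssum_upper(1)] subspace_dim_equal[OF _ _ ssum_upper(2)]
          by (metis subspace_span)+
        then have "S = S'" by simp
        with insert.hyps S' show False by simp
      qed
      ultimately show "card (intv S UNIV k \<inter> intv S' UNIV k) \<le> over_count k (Suc s)"
        using over_count_antimono[OF assms(1)] le_trans by blast
    qed
    finally have "card (intv S UNIV k \<inter> ?U) \<le> card \<S> * over_count k (Suc s)" by simp
    moreover have "card (intv S UNIV k) + card ?U =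
        card (intv S UNIV k \<union> ?U) + card (intv S UNIV k \<inter> ?U)"
      by (rule card_Un_Int) simp_all
    moreover have "card (intv S UNIV k) = over_count k s" using insert.prems card_over by simp
    ultimately show ?case using insert.IH insert.prems insert.hyps by (simp add: algebra_simps)
  qed simp
qed

text \<open>Every member contains a t-subspace of T, chosen inside its intersection with T. This is
  how a single cover bounds a whole family.\<close>

lemma card_by_meeting:
  assumes T: "subspace T" and meet: "\<And>G. G \<in> \<G> \<Longrightarrow> subspace G \<and> t \<le> dim (T \<inter> G)"
    and B: "\<And>A. A \<in> intv {0} T t \<Longrightarrow> card {G \<in> \<G>. A \<subseteq> G} \<le> B"
  shows "card \<G> \<le> card (intv {0} T t) * B"
proof -
  have "\<G> \<subseteq> (\<Union>A\<in>intv {0} T t. {G \<in> \<G>. A \<subseteq> G})"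
  proof
    fix G assume G: "G \<in> \<G>"
    then obtain A where "A \<in> intv {0} (T \<inter> G) t"
      using intv_nonempty[of "{0}" "T \<inter> G" t] meet T by (auto simp: subspace_inter subspace_0)
    with G show "G \<in> (\<Union>A\<in>intv {0} T t. {G \<in> \<G>. A \<subseteq> G})" by (auto simp: intv_def)
  qed
  then have "card \<G> \<le> card (\<Union>A\<in>intv {0} T t. {G \<in> \<G>. A \<subseteq> G})" by (intro card_mono) auto
  also have "\<dots> \<le> (\<Sum>A\<in>intv {0} T t. card {G \<in> \<G>. A \<subseteq> G})" by (rule card_UN_le) simp
  also have "\<dots> \<le> (\<Sum>A\<in>intv {0} T t. B)" by (rule sum_mono[OF B])
  finally show ?thesis by simp
qed

text \<open>The enlargement argument as an induction on the missing dimension i. A step may gain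
  several dimensions, but with at most \<open>q ^ (k - t + 1)\<close> choices for each. The
  assumption k + k + 1 \<le> n + t says k - t + 1 \<le> n - k: dimensions gained beyond m pay for
  their own choices.\<close>

lemma card_members_over_le:
  assumes F: "\<F> \<subseteq> intv {0} UNIV k" and G: "\<G> \<subseteq> intv {0} UNIV k"
    and cross: "\<And>F G. F \<in> \<F> \<Longrightarrow> G \<in> \<G> \<Longrightarrow> t \<le> dim (F \<inter> G)"
    and nc: "\<And>S G. G \<in> \<G> \<Longrightarrow> subspace S \<Longrightarrow> S \<subseteq> G \<Longrightarrow> dim S < m \<Longrightarrow> \<exists>F\<in>\<F>. dim (S \<inter> F) < t"
    and tk: "t \<le> k" and kn: "k + k + 1 \<le> n + t"
    and "subspace S" "dim S + i = m"
  shows "card {G \<in> \<G>. S \<subseteq> G} \<le> (q ^ (k - t + 1)) ^ i * over_count k m"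
  using assms(7,8)
proof (induction i arbitrary: S rule: less_induct)
  case (less i)
  let ?\<beta> = "q ^ (k - t + 1)"
  have le_over: "card {G \<in> \<G>. R \<subseteq> G} \<le> over_count k (dim R)" if "subspace R" for R
  proof -
    have "{G \<in> \<G>. R \<subseteq> G} \<subseteq> intv R UNIV k" using G by (auto simp: intv_def)
    then show ?thesis using card_over[OF that, of k] card_mono[of "intv R UNIV k"] by simp
  qed
  show ?case
  proof (cases "i = 0 \<or> {G \<in> \<G>. S \<subseteq> G} = {}")
    case True
    then show ?thesis
    proof
      assume "i = 0" then show ?thesis using le_over[of S] less.prems by simp
    qed (simp only: card.empty zero_le)
  next
    case False
    then obtain G0 where "G0 \<in> \<G>" "S \<subseteq> G0" "0 < i" by auto
    then obtain F0 where F0: "F0 \<in> \<F>" "dim (S \<inter> F0) < t"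
      using nc[of G0 S] less.prems by auto
    define d where "d = dim (S \<inter> F0)"
    \<comment> \<open>A member G through S contains S + (F0 \<inter> G). As F0 \<inter> G meets S in
      S \<inter> F0 only, of dimension d, this sum has at least t - d dimensions more than
      S.\<close>
    define r where "r = t - d"
    let ?W = "S \<squnion> F0"
    have sF: "subspace F0" "dim F0 = k" using F0 F by (auto simp: intv_def)
    have dW: "dim ?W + d = dim S + k" using dim_ssum[OF less.prems(1) sF(1)] sF by (simp add: d_def)
    have dS: "d \<le> dim S" by (simp add: d_def dim_subset)
    let ?I = "intv S ?W (dim S + r)"
    have "{G \<in> \<G>. S \<subseteq> G} \<subseteq> (\<Union>R\<in>?I. {G \<in> \<G>. R \<subseteq> G})"
    proof
      fix G1 assume "G1 \<in> {G \<in> \<G>. S \<subseteq> G}"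
      then have G1: "G1 \<in> \<G>" "S \<subseteq> G1" "subspace G1" using G by (auto simp: intv_def)
      have "dim (S \<squnion> (F0 \<inter> G1)) + dim (S \<inter> (F0 \<inter> G1)) = dim S + dim (F0 \<inter> G1)"
        using G1 sF less.prems by (intro dim_ssum subspace_inter) auto
      moreover have "S \<inter> (F0 \<inter> G1) = S \<inter> F0" using G1 by auto
      ultimately have "dim S + r \<le> dim (S \<squnion> (F0 \<inter> G1))"
        using cross[OF F0(1) G1(1)] F0(2) by (simp add: r_def d_def)
      then obtain R where R: "R \<in> intv S (S \<squnion> (F0 \<inter> G1)) (dim S + r)"
        using intv_nonempty[of S "S \<squnion> (F0 \<inter> G1)" "dim S + r"] less.prems ssum_upper by auto
      have "S \<squnion> (F0 \<inter> G1) \<subseteq> G1" using G1 by (intro ssum_least) auto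
      moreover have "S \<squnion> (F0 \<inter> G1) \<subseteq> ?W" by (intro span_mono) auto
      ultimately show "G1 \<in> (\<Union>R\<in>?I. {G \<in> \<G>. R \<subseteq> G})" using R G1
        by (intro UN_I[of R]) (auto simp: intv_def)
    qed
    then have "card {G \<in> \<G>. S \<subseteq> G} \<le> card (\<Union>R\<in>?I. {G \<in> \<G>. R \<subseteq> G})"
      by (intro card_mono) auto
    also have "\<dots> \<le> (\<Sum>R\<in>?I. card {G \<in> \<G>. R \<subseteq> G})" by (rule card_UN_le) simp
    \<comment> \<open>The cost of the step is multiplied onto the left side and cancelled at the
      end, instead of being divided out.\<close>
    also have "?\<beta> ^ r * \<dots> \<le> (\<Sum>R\<in>?I. ?\<beta> ^ i * over_count k m)" unfolding sum_distrib_left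
    proof (rule sum_mono)
      fix R assume R: "R \<in> ?I"
      then have sR: "subspace R" "dim R = dim S + r" by (auto simp: intv_def)
      show "?\<beta> ^ r * card {G \<in> \<G>. R \<subseteq> G} \<le> ?\<beta> ^ i * over_count k m"
      proof (cases "r \<le> i")
        case True
        have "card {G \<in> \<G>. R \<subseteq> G} \<le> ?\<beta> ^ (i - r) * over_count k m"
          using True sR less.prems F0 \<open>0 < i\<close> by (intro less.IH) (auto simp: r_def d_def)
        then have "?\<beta> ^ r * card {G \<in> \<G>. R \<subseteq> G} \<le> ?\<beta> ^ r * (?\<beta> ^ (i - r) * over_count k m)"
          by (rule mult_le_mono2)
        also have "\<dots> = ?\<beta> ^ i * over_count k m" using True
          by (simp only: mult.assoc[symmetric] power_add[symmetric] le_add_diff_inverse)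
        finally show ?thesis .
      next
        \<comment> \<open>The enlargement overshoots m by r - i dimensions; the surplus choices are
          absorbed by the drop of \<open>over_count\<close>.\<close>
        case False
        have "?\<beta> ^ r * card {G \<in> \<G>. R \<subseteq> G} \<le> ?\<beta> ^ r * over_count k (m + (r - i))"
          using le_over[OF sR(1)] sR less.prems False by (intro mult_le_mono2) auto
        also have "\<dots> = ?\<beta> ^ i * (over_count k (m + (r - i)) * ?\<beta> ^ (r - i))"
          using False by (simp flip: power_add add: mult_ac)
        also have "\<dots> \<le> ?\<beta> ^ i * (over_count k (m + (r - i)) * (q ^ (n - k)) ^ (r - i))"
          using tk kn q_pos by (intro mult_le_mono2 power_mono power_increasing) auto
        also have "\<dots> \<le> ?\<beta> ^ i * over_count k m"
          using over_count_add_le[of k m "r - i"] tk kn by (intro mult_le_mono2) auto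
        finally show ?thesis .
      qed
    qed
    also have "\<dots> = card ?I * (?\<beta> ^ i * over_count k m)" by simp
    also have "\<dots> \<le> ?\<beta> ^ r * (?\<beta> ^ i * over_count k m)"
    proof (rule mult_le_mono1)
      \<comment> \<open>The exponent is independent of d: a smaller trace on F0 raises the dimension
        of the ambient sum and the target dimension alike.\<close>
      have "dim ?W - (dim S + r) + 1 = k - t + 1" using dW F0(2) tk by (simp add: r_def d_def)
      then show "card ?I \<le> ?\<beta> ^ r"
        using card_intv_le[of S ?W r "dim S + r"] less.prems ssum_upper by simp
    qed
    finally show ?thesis using q_pos by simp
  qed
qed

end

section \<open>Cross t-intersecting families of (t+1)-spaces\<close>

lemma card_ge_3_third:
  assumes "finite A" "3 \<le> card A" obtains z where "z \<in> A" "z \<noteq> x" "z \<noteq> y"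
proof -
  have "card {x, y} \<le> 2" by (simp add: card_insert_if)
  then have "card (A - {x, y}) > 0" using assms diff_card_le_card_Diff[of "{x, y}" A] by simp
  then have "A - {x, y} \<noteq> {}" by force
  then obtain z where "z \<in> A - {x, y}" by blast
  then show ?thesis using that[of z] by blast
qed

lemma full_product:
  assumes "card X \<le> m" "card Y \<le> m" "m \<le> N" "N * N \<le> card X * card Y" "0 < N"
  shows "card X = m \<and> card Y = m \<and> m = N"
proof -
  have "N \<le> card X"
  proof (rule ccontr)
    assume "\<not> N \<le> card X"
    have "card X * card Y \<le> card X * N" using assms by simp
    also have "\<dots> < N * N" using \<open>\<not> N \<le> card X\<close> assms by simp
    finally have "card X * card Y < N * N" .
    with assms(4) show False by simp
  qed
  moreover have "N \<le> card Y"
  proof (rule ccontr)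
    assume "\<not> N \<le> card Y"
    have "card X * card Y \<le> N * card Y" using assms by simp
    also have "\<dots> < N * N" using \<open>\<not> N \<le> card Y\<close> assms by simp
    finally have "card X * card Y < N * N" .
    with assms(4) show False by simp
  qed
  ultimately show ?thesis using assms by linarith
qed

text \<open>If x and y differ under f, they agree under g. A pair u, v differing under g shares its
  f-value, which differs from that of x or of y; that element would agree with both u and v under
  g.\<close>

lemma agreeing_pairs:
  assumes "\<And>x y. x \<in> P \<Longrightarrow> y \<in> P \<Longrightarrow> f x = f y \<or> g x = g y"
  shows "(\<forall>x\<in>P. \<forall>y\<in>P. f x = f y) \<or> (\<forall>x\<in>P. \<forall>y\<in>P. g x = g y)"
  by (smt (verit) assms)

context finite_vector_space
begin

lemma dim_Int_le_of_neq:
  assumes "subspace S" "subspace T" "S \<noteq> T" "dim S = Suc d" "dim T = Suc d"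
  shows "dim (S \<inter> T) \<le> d"
proof (rule ccontr)
  assume "\<not> ?thesis"
  then have "S \<inter> T = S" "S \<inter> T = T"
    using subspace_dim_equal[of "S \<inter> T" S] subspace_dim_equal[of "S \<inter> T" T] assms
    by (auto simp: subspace_inter)
  with assms(3) show False by simp
qed

lemma dim_ssum_gt_of_neq:
  assumes "subspace X" "subspace Y" "X \<noteq> Y" "d \<le> dim X" "d \<le> dim Y"
  shows "Suc d \<le> dim (X \<squnion> Y)"
proof (rule ccontr)
  assume "\<not> ?thesis"
  then have d: "dim (X \<squnion> Y) \<le> d" by simp
  have "X = X \<squnion> Y" using assms d by (intro subspace_dim_equal ssum_upper subspace_span) linarith+
  moreover have "Y = X \<squnion> Y" using assms d by (intro subspace_dim_equal ssum_upper subspace_span) linarith+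
  ultimately show False using assms(3) by simp
qed

lemma ssum_eq_of_hyperplanes:
  assumes "subspace X" "subspace Y" "X \<noteq> Y" "d \<le> dim X" "d \<le> dim Y"
    and "subspace S" "X \<subseteq> S" "Y \<subseteq> S" "dim S = Suc d"
  shows "X \<squnion> Y = S"
  using assms dim_ssum_gt_of_neq[OF assms(1-5)]
  by (intro subspace_dim_equal ssum_least subspace_span) simp_all

text \<open>If the traces of S on T1 and T2 differ, they span S. A common trace has dimension at
  least t and lies in T1 \<inter> T2, which has dimension at most t, hence is all of it.\<close>

lemma near_dichotomy:
  assumes T1: "subspace T1" "dim T1 = Suc t" and T2: "subspace T2" "dim T2 = Suc t"
    and S: "subspace S" "dim S = Suc t"
    and ne: "T1 \<noteq> T2" and m: "t \<le> dim (S \<inter> T1)" "t \<le> dim (S \<inter> T2)"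
  shows "T1 \<inter> T2 \<subseteq> S \<or> S \<subseteq> T1 \<squnion> T2"
proof (cases "S \<inter> T1 = S \<inter> T2")
  case True
  then have "S \<inter> T1 \<subseteq> T1 \<inter> T2" by auto
  then have "S \<inter> T1 = T1 \<inter> T2"
    using m dim_Int_le_of_neq[OF T1(1) T2(1) ne T1(2) T2(2)] S T1 T2
    by (intro subspace_dim_equal subspace_inter) auto
  then show ?thesis by auto
next
  case False
  have "(S \<inter> T1) \<squnion> (S \<inter> T2) = S"
    using S T1 T2 m False by (intro ssum_eq_of_hyperplanes[where d = t] subspace_inter) auto
  moreover have "(S \<inter> T1) \<squnion> (S \<inter> T2) \<subseteq> T1 \<squnion> T2" by (intro span_mono) auto
  ultimately show ?thesis by simp
qed

end

text \<open>Separates the problem on covers of dimension t + 1 from the k-spaces. What remains of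
  those are the pencil assumptions: the covers through a t-space A lie in one (k + 1)-space, which
  for the original families is A + F with F a member that A does not cover.\<close>

locale cross_covers = finite_vector_space +
  fixes k t :: nat and \<S> \<T> :: "'b set set"
  assumes S: "\<And>S. S \<in> \<S> \<Longrightarrow> subspace S" "\<And>S. S \<in> \<S> \<Longrightarrow> dim S = Suc t"
    and T: "\<And>T. T \<in> \<T> \<Longrightarrow> subspace T" "\<And>T. T \<in> \<T> \<Longrightarrow> dim T = Suc t"
    and cross: "\<And>S T. S \<in> \<S> \<Longrightarrow> T \<in> \<T> \<Longrightarrow> t \<le> dim (S \<inter> T)"
    and nonempty: "\<S> \<noteq> {}" "\<T> \<noteq> {}"
    and pencil_S: "\<And>A S. subspace A \<Longrightarrow> dim A = t \<Longrightarrow> S \<in> \<S> \<Longrightarrow> A \<subseteq> S \<Longrightarrow>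
      \<exists>L. subspace L \<and> A \<subseteq> L \<and> dim L = Suc k \<and> (\<forall>S\<in>\<S>. A \<subseteq> S \<longrightarrow> S \<subseteq> L)"
    and pencil_T: "\<And>A T. subspace A \<Longrightarrow> dim A = t \<Longrightarrow> T \<in> \<T> \<Longrightarrow> A \<subseteq> T \<Longrightarrow>
      \<exists>L. subspace L \<and> A \<subseteq> L \<and> dim L = Suc k \<and> (\<forall>T\<in>\<T>. A \<subseteq> T \<longrightarrow> T \<subseteq> L)"
    and t_pos: "0 < t" and tk: "t < k"
begin

lemma swap: "cross_covers scale Basis q n k t \<T> \<S>"
proof
  fix T S assume "T \<in> \<T>" "S \<in> \<S>"
  then show "t \<le> dim (T \<inter> S)" using cross by (simp add: Int_commute)
qed (rule S T nonempty pencil_S pencil_T t_pos tk; assumption)+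

abbreviation b :: nat where "b \<equiv> qnum q (Suc k - t)"
abbreviation c :: nat where "c \<equiv> qnum q (t + 2)"
abbreviation M :: nat where "M \<equiv> max b c"

text \<open>The bounds below for far pairs are in terms of 2 q + 2 and have to be beaten by M. Since
  t \<ge> 1, c is at least q^2 + q + 1; for q = 2 this is 7 against 6.\<close>

lemma M_gt: "2 * q + 2 < M"
proof -
  have "qnum q 3 \<le> c" using t_pos by (intro qnum_mono) simp
  moreover have "qnum q 3 = q * q + q + 1" by (simp add: eval_nat_numeral qnum_Suc)
  moreover have "2 * q \<le> q * q" using q_ge_2 by simp
  moreover have "2 * q + 2 \<le> q * q + q" using q_ge_2 \<open>2 * q \<le> q * q\<close> by linarith
  ultimately show ?thesis by linarith
qed

lemma card_pencil_le:
  assumes "subspace A" "dim A = t"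
  shows "card {S \<in> \<S>. A \<subseteq> S} \<le> b"
proof (cases "{S \<in> \<S>. A \<subseteq> S} = {}")
  case False
  then obtain S0 where "S0 \<in> \<S>" "A \<subseteq> S0" by blast
  from pencil_S[OF assms this]
  obtain L where L: "subspace L" "A \<subseteq> L" "dim L = Suc k" "\<forall>S\<in>\<S>. A \<subseteq> S \<longrightarrow> S \<subseteq> L"
    by (elim exE conjE)
  have "{S \<in> \<S>. A \<subseteq> S} \<subseteq> intv A L (Suc t)" using L S by (auto simp: intv_def)
  then show ?thesis
    using card_extensions[OF assms(1) L(1,2)] assms L card_mono[of "intv A L (Suc t)"] by simp
qed (simp only: card.empty zero_le)

text \<open>Each S passes through one of the \<open>qnum q (Suc t)\<close> hyperplanes of a fixed
  T0, and each of these carries a pencil of at most b members.\<close>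

lemma card_S_le: "card \<S> \<le> qnum q (Suc t) * b"
proof -
  obtain T0 where T0: "T0 \<in> \<T>" using nonempty by auto
  have "card \<S> \<le> card (intv {0} T0 t) * b"
    using S T T0 cross card_pencil_le
    by (intro card_by_meeting) (auto simp: intv_def Int_commute)
  then show ?thesis using card_hyperplanes[of T0 t] T T0 by simp
qed

lemma card_S_lt_if_single:
  assumes "card \<T> = 1" shows "card \<S> * card \<T> < M * M"
proof -
  have "qnum q (Suc t) < M" using q_pos qnum_less_iff[of q "Suc t" "t + 2"] by simp
  moreover have "b \<le> M" "0 < b" using tk by (auto simp: qnum_pos)
  ultimately have "qnum q (Suc t) * b < M * M" by (intro mult_less_le_imp_less) auto
  then show ?thesis using card_S_le assms by simp
qed

text \<open>By \<open>near_dichotomy\<close> a member of \<open>\<S>\<close> belongs to the pencil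
  through T1 \<inter> T2 or is a hyperplane of T1 + T2.\<close>

lemma card_S_le_if_near_pair:
  assumes T1: "T1 \<in> \<T>" and T2: "T2 \<in> \<T>" and ne: "T1 \<noteq> T2" and near: "t \<le> dim (T1 \<inter> T2)"
  shows "card \<S> \<le> b + c"
proof -
  have d: "dim (T1 \<inter> T2) = t"
    using dim_Int_le_of_neq[of T1 T2 t] T T1 T2 ne near by simp
  have "dim (T1 \<squnion> T2) = t + 2" using dim_ssum[of T1 T2] d T T1 T2 by simp
  then have c: "card (intv {0} (T1 \<squnion> T2) (Suc t)) = c"
    using card_hyperplanes[of "T1 \<squnion> T2" "Suc t"] by simp
  have "\<S> \<subseteq> {S \<in> \<S>. T1 \<inter> T2 \<subseteq> S} \<union> intv {0} (T1 \<squnion> T2) (Suc t)"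
  proof
    fix S0 assume "S0 \<in> \<S>"
    then show "S0 \<in> {S \<in> \<S>. T1 \<inter> T2 \<subseteq> S} \<union> intv {0} (T1 \<squnion> T2) (Suc t)"
      using near_dichotomy[of T1 t T2 S0] ne S T T1 T2 cross[of S0]
      by (auto simp: intv_def subspace_0)
  qed
  then have "card \<S> \<le> card {S \<in> \<S>. T1 \<inter> T2 \<subseteq> S} + card (intv {0} (T1 \<squnion> T2) (Suc t))"
    by (intro order_trans[OF card_mono card_Un_le]) auto
  with c card_pencil_le[of "T1 \<inter> T2"] d T T1 T2 show ?thesis by (simp add: subspace_inter)
qed

text \<open>
  A pair in \<open>\<S>\<close> is far if it meets in dimension less than t.  Modulo their intersection a far pair is
  two skew lines, and every member of \<open>\<T>\<close> is a transversal, given by its points on the two lines.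
\<close>

lemma far_pair:
  assumes S1: "S1 \<in> \<S>" and S2: "S2 \<in> \<S>" and far: "dim (S1 \<inter> S2) < t" and T0: "T0 \<in> \<T>"
  shows "dim (T0 \<inter> S1) = t" "dim (T0 \<inter> S2) = t" "S1 \<inter> S2 \<subseteq> T0"
    "(T0 \<inter> S1) \<squnion> (T0 \<inter> S2) = T0" "dim (S1 \<inter> S2) + 1 = t"
proof -
  have m: "t \<le> dim (T0 \<inter> S1)" "t \<le> dim (T0 \<inter> S2)"
    using cross[OF S1 T0] cross[OF S2 T0] by (simp_all add: Int_commute)
  have ne: "T0 \<noteq> S1" "T0 \<noteq> S2" using m far by (auto simp: Int_commute)
  show d1: "dim (T0 \<inter> S1) = t"
    using dim_Int_le_of_neq[OF T(1)[OF T0] S(1)[OF S1] ne(1) T(2)[OF T0] S(2)[OF S1]] m by simp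
  show d2: "dim (T0 \<inter> S2) = t"
    using dim_Int_le_of_neq[OF T(1)[OF T0] S(1)[OF S2] ne(2) T(2)[OF T0] S(2)[OF S2]] m by simp
  have sub: "subspace (T0 \<inter> S1)" "subspace (T0 \<inter> S2)"
    using T(1)[OF T0] S(1)[OF S1] S(1)[OF S2] by (simp_all add: subspace_inter)
  have "(T0 \<inter> S1) \<inter> (T0 \<inter> S2) \<subseteq> S1 \<inter> S2" by auto
  from dim_subset[OF this] have le: "dim ((T0 \<inter> S1) \<inter> (T0 \<inter> S2)) \<le> dim (S1 \<inter> S2)" .
  then have neq: "T0 \<inter> S1 \<noteq> T0 \<inter> S2" using d1 far by auto
  show eq: "(T0 \<inter> S1) \<squnion> (T0 \<inter> S2) = T0"
    using d1 d2 T[OF T0] by (intro ssum_eq_of_hyperplanes[OF sub neq, of t]) auto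
  \<comment> \<open>Two t-spaces spanning the (t + 1)-space T0 meet in dimension t - 1. Their
    intersection lies in S1 \<inter> S2, which has dimension below t, so the two coincide.\<close>
  have dd: "dim ((T0 \<inter> S1) \<inter> (T0 \<inter> S2)) + 1 = t"
    using dim_ssum[OF sub] unfolding eq using d1 d2 T(2)[OF T0] by simp
  then show "dim (S1 \<inter> S2) + 1 = t" using le far by simp
  have "(T0 \<inter> S1) \<inter> (T0 \<inter> S2) = S1 \<inter> S2"
    using dd far subspace_inter[OF sub] subspace_inter[OF S(1)[OF S1] S(1)[OF S2]]
    by (intro subspace_dim_equal) auto
  then show "S1 \<inter> S2 \<subseteq> T0" by auto
qed

text \<open>Modulo S1 \<inter> S2, S1 is a line with q + 1 points, and these are the possible traces
  of members of \<open>\<T>\<close>.\<close>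

lemma far_pair_lines:
  assumes S1: "S1 \<in> \<S>" and S2: "S2 \<in> \<S>" and far: "dim (S1 \<inter> S2) < t"
  shows "(\<lambda>T. T \<inter> S1) ` \<T> \<subseteq> intv (S1 \<inter> S2) S1 t" "card (intv (S1 \<inter> S2) S1 t) = q + 1"
proof -
  obtain T0 where "T0 \<in> \<T>" using nonempty by auto
  note d = far_pair(5)[OF assms this]
  show "(\<lambda>T. T \<inter> S1) ` \<T> \<subseteq> intv (S1 \<inter> S2) S1 t"
  proof (rule image_subsetI)
    fix T0 assume T0: "T0 \<in> \<T>"
    show "T0 \<inter> S1 \<in> intv (S1 \<inter> S2) S1 t"
      using far_pair(1,3)[OF assms T0] T(1)[OF T0] S(1)[OF S1]
      by (simp add: intv_def subspace_inter)
  qed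
  have "card (intv (S1 \<inter> S2) S1 (Suc (dim (S1 \<inter> S2)))) = qnum q (dim S1 - dim (S1 \<inter> S2))"
    using S(1)[OF S1] S(1)[OF S2] by (intro card_extensions subspace_inter) auto
  moreover have "Suc (dim (S1 \<inter> S2)) = t" "dim S1 - dim (S1 \<inter> S2) = Suc (Suc 0)"
    using d S(2)[OF S1] by auto
  ultimately show "card (intv (S1 \<inter> S2) S1 t) = q + 1" by (simp add: qnum_Suc)
qed

lemma far_pair_inj:
  assumes S1: "S1 \<in> \<S>" and S2: "S2 \<in> \<S>" and far: "dim (S1 \<inter> S2) < t"
    and "T1 \<in> \<T>" "T2 \<in> \<T>" "T1 \<inter> S1 = T2 \<inter> S1" "T1 \<inter> S2 = T2 \<inter> S2"
  shows "T1 = T2"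
proof -
  have "T1 = (T2 \<inter> S1) \<squnion> (T2 \<inter> S2)"
    unfolding assms(6,7)[symmetric] by (rule far_pair(4)[OF S1 S2 far assms(4), symmetric])
  also have "\<dots> = T2" by (rule far_pair(4)[OF S1 S2 far assms(5)])
  finally show ?thesis .
qed

text \<open>Transversals through a fixed point of the line S2 are determined by their point on the
  line S1.\<close>

lemma card_T_le_if_constant:
  assumes S1: "S1 \<in> \<S>" and S2: "S2 \<in> \<S>" and far: "dim (S1 \<inter> S2) < t"
    and U: "\<U> \<subseteq> \<T>" and const: "\<And>T1 T2. T1 \<in> \<U> \<Longrightarrow> T2 \<in> \<U> \<Longrightarrow> T1 \<inter> S2 = T2 \<inter> S2"
  shows "card \<U> \<le> q + 1"
proof -
  have inj: "inj_on (\<lambda>T. T \<inter> S1) \<U>"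
  proof (rule inj_onI)
    fix T1 T2 assume a: "T1 \<in> \<U>" "T2 \<in> \<U>" "T1 \<inter> S1 = T2 \<inter> S1"
    show "T1 = T2"
      by (rule far_pair_inj[OF S1 S2 far _ _ a(3) const[OF a(1,2)]]) (use a U in auto)
  qed
  have "(\<lambda>T. T \<inter> S1) ` \<U> \<subseteq> intv (S1 \<inter> S2) S1 t"
    using far_pair_lines(1)[OF S1 S2 far] U by auto
  from card_inj_on_le[OF inj this] show ?thesis
    using far_pair_lines(2)[OF S1 S2 far] by simp
qed

lemma card_T_le_if_far:
  assumes S1: "S1 \<in> \<S>" and S2: "S2 \<in> \<S>" and far: "dim (S1 \<inter> S2) < t"
  shows "card \<T> \<le> (q + 1) * (q + 1)"
proof -
  have far': "dim (S2 \<inter> S1) < t" using far by (simp add: Int_commute)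
  have inj: "inj_on (\<lambda>T. (T \<inter> S1, T \<inter> S2)) \<T>"
    using far_pair_inj[OF S1 S2 far] by (intro inj_onI) simp
  have "(\<lambda>T. (T \<inter> S1, T \<inter> S2)) ` \<T> \<subseteq> intv (S1 \<inter> S2) S1 t \<times> intv (S2 \<inter> S1) S2 t"
    using far_pair_lines(1)[OF S1 S2 far] far_pair_lines(1)[OF S2 S1 far'] by auto
  from card_inj_on_le[OF inj this]
  have "card \<T> \<le> card (intv (S1 \<inter> S2) S1 t \<times> intv (S2 \<inter> S1) S2 t)"
    by simp
  then show ?thesis
    using far_pair_lines(2)[OF S1 S2 far] far_pair_lines(2)[OF S2 S1 far']
    by (simp add: card_cartesian_product)
qed

text \<open>If both traces differed, T1 + T2 would contain S1 and S2 and so have dimension at least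
  t + 3, whereas near members span at most t + 2.\<close>

lemma near_agree:
  assumes S1: "S1 \<in> \<S>" and S2: "S2 \<in> \<S>" and far: "dim (S1 \<inter> S2) < t"
    and T1: "T1 \<in> \<T>" and T2: "T2 \<in> \<T>" and near: "t \<le> dim (T1 \<inter> T2)"
  shows "T1 \<inter> S1 = T2 \<inter> S1 \<or> T1 \<inter> S2 = T2 \<inter> S2"
proof (rule ccontr)
  assume "\<not> ?thesis"
  then have ne: "T1 \<inter> S1 \<noteq> T2 \<inter> S1" "T1 \<inter> S2 \<noteq> T2 \<inter> S2" by auto
  have "(T1 \<inter> S1) \<squnion> (T2 \<inter> S1) = S1"
    using S[OF S1] T[OF T1] T[OF T2] far_pair(1)[OF S1 S2 far T1] far_pair(1)[OF S1 S2 far T2]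
    by (intro ssum_eq_of_hyperplanes[OF _ _ ne(1), of t] subspace_inter) auto
  moreover have "(T1 \<inter> S1) \<squnion> (T2 \<inter> S1) \<subseteq> T1 \<squnion> T2" by (intro span_mono) auto
  moreover have "(T1 \<inter> S2) \<squnion> (T2 \<inter> S2) = S2"
    using S[OF S2] T[OF T1] T[OF T2] far_pair(2)[OF S1 S2 far T1] far_pair(2)[OF S1 S2 far T2]
    by (intro ssum_eq_of_hyperplanes[OF _ _ ne(2), of t] subspace_inter) auto
  moreover have "(T1 \<inter> S2) \<squnion> (T2 \<inter> S2) \<subseteq> T1 \<squnion> T2" by (intro span_mono) auto
  ultimately have "S1 \<squnion> S2 \<subseteq> T1 \<squnion> T2" by (intro ssum_least) auto
  then have "dim (S1 \<squnion> S2) \<le> dim (T1 \<squnion> T2)" by (rule dim_subset)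
  then show False
    using dim_ssum[OF S(1)[OF S1] S(1)[OF S2]] dim_ssum[OF T(1)[OF T1] T(1)[OF T2]]
      S(2)[OF S1] S(2)[OF S2] T(2)[OF T1] T(2)[OF T2] far near by linarith
qed

text \<open>Pairwise near transversals agree pairwise in one of two coordinates, so by
  \<open>agreeing_pairs\<close> all of them pass through a common point of one of the lines.\<close>

lemma card_T_le_if_far_near:
  assumes S1: "S1 \<in> \<S>" and S2: "S2 \<in> \<S>" and far: "dim (S1 \<inter> S2) < t"
    and near: "\<And>T1 T2. T1 \<in> \<T> \<Longrightarrow> T2 \<in> \<T> \<Longrightarrow> t \<le> dim (T1 \<inter> T2)"
  shows "card \<T> \<le> q + 1"
proof -
  have far': "dim (S2 \<inter> S1) < t" using far by (simp add: Int_commute)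
  have "(\<forall>T1\<in>\<T>. \<forall>T2\<in>\<T>. T1 \<inter> S1 = T2 \<inter> S1) \<or> (\<forall>T1\<in>\<T>. \<forall>T2\<in>\<T>. T1 \<inter> S2 = T2 \<inter> S2)"
    using near_agree[OF S1 S2 far] near by (intro agreeing_pairs) simp
  then show ?thesis
  proof
    assume c: "\<forall>T1\<in>\<T>. \<forall>T2\<in>\<T>. T1 \<inter> S1 = T2 \<inter> S1"
    show ?thesis by (rule card_T_le_if_constant[OF S2 S1 far' order_refl]) (rule c[rule_format])
  next
    assume c: "\<forall>T1\<in>\<T>. \<forall>T2\<in>\<T>. T1 \<inter> S2 = T2 \<inter> S2"
    show ?thesis by (rule card_T_le_if_constant[OF S1 S2 far order_refl]) (rule c[rule_format])
  qed
qed

text \<open>Nearness of S1 and S3 splits \<open>\<T>\<close> by \<open>near_dichotomy\<close>: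
  members through S1 \<inter> S3 have this as their trace on S1, and members inside Z = S1 + S3 have
  the trace Z \<inter> S2 on S2. In either class one coordinate is fixed.\<close>

lemma card_T_le_if_far_third_near:
  assumes S1: "S1 \<in> \<S>" and S2: "S2 \<in> \<S>" and far: "dim (S1 \<inter> S2) < t"
    and S3: "S3 \<in> \<S>" "S3 \<noteq> S1" "t \<le> dim (S1 \<inter> S3)"
  shows "card \<T> \<le> 2 * q + 2"
proof -
  have far': "dim (S2 \<inter> S1) < t" using far by (simp add: Int_commute)
  let ?A = "S1 \<inter> S3" and ?Z = "S1 \<squnion> S3"
  have sA: "subspace ?A" using S(1)[OF S1] S(1)[OF S3(1)] by (rule subspace_inter)
  have dA: "dim ?A = t"
    using dim_Int_le_of_neq[OF S(1)[OF S1] S(1)[OF S3(1)] _ S(2)[OF S1] S(2)[OF S3(1)]] S3 by auto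
  have dZ: "dim ?Z = t + 2"
    using dim_ssum[OF S(1)[OF S1] S(1)[OF S3(1)]] dA S(2)[OF S1] S(2)[OF S3(1)] by simp
  have "\<T> \<subseteq> {T \<in> \<T>. ?A \<subseteq> T} \<union> {T \<in> \<T>. T \<subseteq> ?Z}"
  proof
    fix T0 assume T0: "T0 \<in> \<T>"
    have "?A \<subseteq> T0 \<or> T0 \<subseteq> ?Z"
      using S3(2) cross[OF S1 T0] cross[OF S3(1) T0]
      by (intro near_dichotomy[where t = t] S T S1 S3(1) T0) (auto simp: Int_commute)
    with T0 show "T0 \<in> {T \<in> \<T>. ?A \<subseteq> T} \<union> {T \<in> \<T>. T \<subseteq> ?Z}" by simp
  qed
  then have "card \<T> \<le> card {T \<in> \<T>. ?A \<subseteq> T} + card {T \<in> \<T>. T \<subseteq> ?Z}"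
    by (intro order_trans[OF card_mono card_Un_le]) auto
  moreover have "card {T \<in> \<T>. ?A \<subseteq> T} \<le> q + 1"
  proof (rule card_T_le_if_constant[OF S2 S1 far'])
    have *: "T1 \<inter> S1 = ?A" if "T1 \<in> {T \<in> \<T>. ?A \<subseteq> T}" for T1
      using that far_pair(1)[OF S1 S2 far, of T1] dA sA subspace_inter[OF T(1)[of T1] S(1)[OF S1]]
      by (intro subspace_dim_equal[symmetric]) auto
    fix T1 T2 assume "T1 \<in> {T \<in> \<T>. ?A \<subseteq> T}" "T2 \<in> {T \<in> \<T>. ?A \<subseteq> T}"
    from *[OF this(1)] *[OF this(2)] show "T1 \<inter> S1 = T2 \<inter> S1" by simp
  qed auto
  moreover have "card {T \<in> \<T>. T \<subseteq> ?Z} \<le> q + 1"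
  proof (rule card_T_le_if_constant[OF S1 S2 far])
    have ZS2: "dim (?Z \<inter> S2) \<le> t"
    proof (rule ccontr)
      assume "\<not> ?thesis"
      then have "?Z \<inter> S2 = S2"
        using S(1)[OF S2] S(2)[OF S2] by (intro subspace_dim_equal subspace_inter) auto
      then have "S1 \<squnion> S2 \<subseteq> ?Z" using ssum_upper by (intro ssum_least) auto
      from dim_subset[OF this] show False
        using dim_ssum[OF S(1)[OF S1] S(1)[OF S2]] dZ S(2)[OF S1] S(2)[OF S2] far by linarith
    qed
    have *: "T1 \<inter> S2 = ?Z \<inter> S2" if "T1 \<in> {T \<in> \<T>. T \<subseteq> ?Z}" for T1
      using that far_pair(2)[OF S1 S2 far, of T1] ZS2 S(1)[OF S2] T(1)[of T1]
      by (intro subspace_dim_equal subspace_inter) auto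
    fix T1 T2 assume "T1 \<in> {T \<in> \<T>. T \<subseteq> ?Z}" "T2 \<in> {T \<in> \<T>. T \<subseteq> ?Z}"
    from *[OF this(1)] *[OF this(2)] show "T1 \<inter> S2 = T2 \<inter> S2" by simp
  qed auto
  ultimately show ?thesis by simp
qed

text \<open>A third member removes one of the two coordinates, up to a factor 2. If it is far from
  both others, the picture is that of three skew lines: at most one common transversal passes
  through a given point of S1.\<close>

lemma card_T_le_if_far_third:
  assumes S1: "S1 \<in> \<S>" and S2: "S2 \<in> \<S>" and far: "dim (S1 \<inter> S2) < t"
    and S3: "S3 \<in> \<S>" "S3 \<noteq> S1" "S3 \<noteq> S2"
  shows "card \<T> \<le> 2 * q + 2"
proof -
  have far': "dim (S2 \<inter> S1) < t" using far by (simp add: Int_commute)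
  consider "t \<le> dim (S1 \<inter> S3)" | "t \<le> dim (S2 \<inter> S3)"
    | "dim (S1 \<inter> S3) < t" "dim (S2 \<inter> S3) < t" by linarith
  then show ?thesis
  proof cases
    case 1
    then show ?thesis using card_T_le_if_far_third_near[OF S1 S2 far] S3 by simp
  next
    case 2
    then show ?thesis using card_T_le_if_far_third_near[OF S2 S1 far'] S3 by simp
  next
    case 3
    have inj: "inj_on (\<lambda>T. T \<inter> S1) \<T>"
    proof (rule inj_onI, rule ccontr)
      fix T1 T2 assume T1: "T1 \<in> \<T>" and T2: "T2 \<in> \<T>" and eq: "T1 \<inter> S1 = T2 \<inter> S1" and ne: "T1 \<noteq> T2"
      let ?C = "T1 \<inter> S1"
      \<comment> \<open>Two members with the same trace C on S1 would span C + S2 and likewise C +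
        S3, so a space of dimension t + 2 would contain S2 + S3, of dimension at least t +
        3.\<close>
      have sub: "T1 \<squnion> T2 = ?C \<squnion> S'" if S': "S' \<in> \<S>" "dim (S1 \<inter> S') < t" for S'
      proof -
        have sC: "subspace ?C" using T(1)[OF T1] S(1)[OF S1] by (rule subspace_inter)
        have "dim (?C \<squnion> S') \<le> t + 2"
        proof -
          have "S1 \<inter> S' \<subseteq> ?C \<inter> S'" using far_pair(3)[OF S1 S' T1] by auto
          from dim_subset[OF this] have "t \<le> dim (?C \<inter> S') + 1"
            using far_pair(5)[OF S1 S' T1] by simp
          then show ?thesis
            using dim_ssum[OF sC S(1)[OF S'(1)]] far_pair(1)[OF S1 S' T1] S(2)[OF S'(1)] by linarith
        qed
        moreover have "Suc (Suc t) \<le> dim (T1 \<squnion> T2)"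
          using T[OF T1] T[OF T2] ne by (intro dim_ssum_gt_of_neq) auto
        moreover have "T1 \<squnion> T2 \<subseteq> ?C \<squnion> S'"
        proof -
          have "T1 \<inter> S1 \<squnion> (T1 \<inter> S') \<subseteq> ?C \<squnion> S'" by (intro span_mono) auto
          moreover have "T2 \<inter> S1 \<squnion> (T2 \<inter> S') \<subseteq> ?C \<squnion> S'" unfolding eq by (intro span_mono) auto
          ultimately show ?thesis
            unfolding far_pair(4)[OF S1 S' T1] far_pair(4)[OF S1 S' T2] by (intro ssum_least) auto
        qed
        ultimately show ?thesis by (intro subspace_dim_equal) auto
      qed
      have "S2 \<subseteq> T1 \<squnion> T2" using sub[OF S2 far] ssum_upper by simp
      moreover have "S3 \<subseteq> T1 \<squnion> T2" using sub[OF S3(1) 3(1)] ssum_upper by simp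
      ultimately have "dim (S2 \<squnion> S3) \<le> dim (T1 \<squnion> T2)" by (intro dim_subset ssum_least) auto
      moreover have "dim (T1 \<inter> S1) \<le> dim (T1 \<inter> T2)" using eq by (intro dim_subset) auto
      ultimately show False
        using dim_ssum[OF S(1)[OF S2] S(1)[OF S3(1)]] S(2)[OF S2] S(2)[OF S3(1)] 3
          dim_ssum[OF T(1)[OF T1] T(1)[OF T2]] T(2)[OF T1] T(2)[OF T2]
          far_pair(1)[OF S1 S2 far T1] by linarith
    qed
    have "card \<T> \<le> q + 1"
      using card_inj_on_le[OF inj far_pair_lines(1)[OF S1 S2 far]] far_pair_lines(2)[OF S1 S2 far]
      by simp
    then show ?thesis by simp
  qed
qed

text \<open>The bound (q + 1)^2 for both families can be too weak against M^2, so a third member of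
  each is used; if one family has at most two members, 2 (q + 1)^2 is small enough.\<close>

lemma card_prod_le_if_far_far:
  assumes "S1 \<in> \<S>" "S2 \<in> \<S>" "dim (S1 \<inter> S2) < t" "T1 \<in> \<T>" "T2 \<in> \<T>" "dim (T1 \<inter> T2) < t"
  shows "card \<S> * card \<T> \<le> (2 * q + 2) * (2 * q + 2)"
proof -
  interpret sw: cross_covers scale Basis q n k t \<T> \<S> by (rule swap)
  have two: "card \<S> \<le> 2" if "\<not> 3 \<le> card \<S>" using that by simp
  have T_le: "card \<T> \<le> (q + 1) * (q + 1)" by (rule card_T_le_if_far[OF assms(1-3)])
  have S_le: "card \<S> \<le> (q + 1) * (q + 1)" by (rule sw.card_T_le_if_far[OF assms(4-6)])
  have small: "2 * ((q + 1) * (q + 1)) \<le> (2 * q + 2) * (2 * q + 2)" by (simp add: algebra_simps)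
  show ?thesis
  proof (cases "3 \<le> card \<S> \<and> 3 \<le> card \<T>")
    case True
    from True have "3 \<le> card \<S>" by simp
    then obtain S3 where S3: "S3 \<in> \<S>" "S3 \<noteq> S1" "S3 \<noteq> S2"
      by (rule card_ge_3_third[OF finite_VV, of _ S1 S2])
    from True have "3 \<le> card \<T>" by simp
    then obtain T3 where T3: "T3 \<in> \<T>" "T3 \<noteq> T1" "T3 \<noteq> T2"
      by (rule card_ge_3_third[OF finite_VV, of _ T1 T2])
    show ?thesis
      by (rule mult_le_mono[OF sw.card_T_le_if_far_third[OF assms(4-6) T3]
          card_T_le_if_far_third[OF assms(1-3) S3]])
  next
    case False
    then consider "card \<S> \<le> 2" | "card \<T> \<le> 2" by linarith
    then show ?thesis
    proof cases
      case 1
      from mult_le_mono[OF 1 T_le] small show ?thesis by (rule order_trans)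
    next
      case 2
      from mult_le_mono[OF 2 S_le] small show ?thesis by (simp add: mult.commute)
    qed
  qed
qed

text \<open>If \<open>\<T>\<close> has no far pair and at least two members, it has at most q + 1
  and \<open>\<S>\<close> at most b + c \<le> 2 M; the product (2 q + 2) M is below M^2 by
  \<open>M_gt\<close>.\<close>

lemma card_prod_lt_if_far:
  assumes "S1 \<in> \<S>" "S2 \<in> \<S>" "dim (S1 \<inter> S2) < t"
  shows "card \<S> * card \<T> < M * M"
proof (cases "\<exists>T1\<in>\<T>. \<exists>T2\<in>\<T>. dim (T1 \<inter> T2) < t")
  case True
  then obtain T1 T2 where "T1 \<in> \<T>" "T2 \<in> \<T>" "dim (T1 \<inter> T2) < t" by blast
  note card_prod_le_if_far_far[OF assms this]
  also have "(2 * q + 2) * (2 * q + 2) < M * M"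
    using M_gt by (intro mult_strict_mono) auto
  finally show ?thesis .
next
  case False
  then have near: "t \<le> dim (T1 \<inter> T2)" if "T1 \<in> \<T>" "T2 \<in> \<T>" for T1 T2
    using that by (simp add: not_less)
  show ?thesis
  proof (cases "card \<T> = 1")
    case True
    then show ?thesis by (rule card_S_lt_if_single)
  next
    case False
    obtain T1 where T1: "T1 \<in> \<T>" using nonempty by auto
    have "\<T> \<noteq> {T1}" using False by auto
    then obtain T2 where T2: "T2 \<in> \<T>" "T1 \<noteq> T2" using T1 by auto
    have "card \<S> \<le> b + c"
      using card_S_le_if_near_pair[OF T1 T2 near[OF T1 T2(1)]] .
    then have "card \<S> \<le> 2 * M" by simp
    then have "card \<S> * card \<T> \<le> (2 * M) * (q + 1)"
      by (rule mult_le_mono[OF _ card_T_le_if_far_near[OF assms near]])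
    also have "\<dots> = (2 * q + 2) * M" by (simp add: algebra_simps)
    also have "\<dots> < M * M" using M_gt by (intro mult_strict_right_mono) auto
    finally show ?thesis .
  qed
qed

text \<open>Pairwise intersecting lines share a point or lie in a plane; this is the same
  alternative. A member S3 not through S1 \<inter> S2 lies in Z = S1 + S2, and these three force all
  the others, on both sides, into Z.\<close>

lemma near_no_pencil:
  assumes near: "\<And>S1 S2. S1 \<in> \<S> \<Longrightarrow> S2 \<in> \<S> \<Longrightarrow> t \<le> dim (S1 \<inter> S2)"
    and two: "card \<S> \<noteq> 1"
    and np: "\<And>A. subspace A \<Longrightarrow> dim A = t \<Longrightarrow> \<exists>S\<in>\<S>. \<not> A \<subseteq> S"
  obtains Z where "subspace Z" "dim Z = t + 2" "\<S> \<subseteq> intv {0} Z (Suc t)" "\<T> \<subseteq> intv {0} Z (Suc t)"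
proof -
  obtain S1 where S1: "S1 \<in> \<S>" using nonempty by auto
  have "\<S> \<noteq> {S1}" using two by auto
  then obtain S2 where S2: "S2 \<in> \<S>" "S1 \<noteq> S2" using S1 by auto
  let ?A = "S1 \<inter> S2" and ?Z = "S1 \<squnion> S2"
  have sA: "subspace ?A" using S(1)[OF S1] S(1)[OF S2(1)] by (rule subspace_inter)
  have dA: "dim ?A = t"
    using dim_Int_le_of_neq[OF S(1)[OF S1] S(1)[OF S2(1)] S2(2) S(2)[OF S1] S(2)[OF S2(1)]]
      near[OF S1 S2(1)] by simp
  have dZ: "dim ?Z = t + 2"
    using dim_ssum[OF S(1)[OF S1] S(1)[OF S2(1)]] dA S(2)[OF S1] S(2)[OF S2(1)] by simp
  obtain S3 where S3: "S3 \<in> \<S>" "\<not> ?A \<subseteq> S3" using np[OF sA dA] by auto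
  have S3Z: "S3 \<subseteq> ?Z"
    using near_dichotomy[OF S[OF S1] S[OF S2(1)] S[OF S3(1)] S2(2) near[OF S3(1) S1] near[OF S3(1) S2(1)]]
      S3(2) by simp
  \<comment> \<open>A space R outside Z meets Z in dimension at most t, so its traces on S1, S2 and
    S3 all equal R \<inter> Z. Hence R \<inter> Z = S1 \<inter> S2 would lie in S3.\<close>
  have key: "R \<subseteq> ?Z" if R: "subspace R" "dim R = Suc t" "\<And>S. S \<in> \<S> \<Longrightarrow> t \<le> dim (R \<inter> S)" for R
  proof (rule ccontr)
    assume not: "\<not> R \<subseteq> ?Z"
    have sRZ: "subspace (R \<inter> ?Z)" using R(1) by (intro subspace_inter) auto
    have "dim (R \<inter> ?Z) < dim R" using not by (intro dim_less sRZ R(1)) auto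
    then have dRZ: "dim (R \<inter> ?Z) \<le> t" using R(2) by simp
    have eq: "R \<inter> S' = R \<inter> ?Z" if "S' \<in> \<S>" "S' \<subseteq> ?Z" for S'
      using dRZ R(3)[OF that(1)] that(2)
      by (intro subspace_dim_equal[OF subspace_inter[OF R(1) S(1)[OF that(1)]] sRZ]) auto
    have "R \<inter> S1 = R \<inter> ?Z" "R \<inter> S2 = R \<inter> ?Z" "R \<inter> S3 = R \<inter> ?Z"
      using eq[OF S1] eq[OF S2(1)] eq[OF S3(1) S3Z] ssum_upper by auto
    then have sub: "R \<inter> ?Z \<subseteq> ?A" "R \<inter> ?Z \<subseteq> S3" by blast+
    have "dim (R \<inter> S1) \<ge> t" by (rule R(3)[OF S1])
    then have "R \<inter> ?Z = ?A"
      using \<open>R \<inter> S1 = R \<inter> ?Z\<close> dA by (intro subspace_dim_equal[OF sRZ sA sub(1)]) simp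
    with sub(2) S3(2) show False by simp
  qed
  show ?thesis
  proof
    show "subspace ?Z" "dim ?Z = t + 2" by (simp_all only: subspace_span dZ)
    show "\<S> \<subseteq> intv {0} ?Z (Suc t)"
    proof
      fix S0 assume "S0 \<in> \<S>"
      with key[of S0] S[of S0] near[of S0] show "S0 \<in> intv {0} ?Z (Suc t)"
        by (simp add: intv_def subspace_0)
    qed
    show "\<T> \<subseteq> intv {0} ?Z (Suc t)"
    proof
      fix T0 assume "T0 \<in> \<T>"
      with key[of T0] T[of T0] cross[of _ T0] show "T0 \<in> intv {0} ?Z (Suc t)"
        by (simp add: intv_def subspace_0 Int_commute)
    qed
  qed
qed

lemma pencil_subset:
  assumes A: "subspace A" "dim A = t" and sub: "\<forall>S\<in>\<S>. A \<subseteq> S"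
  obtains L where "subspace L" "dim L = Suc k" "A \<subseteq> L" "\<S> \<subseteq> intv A L (Suc t)"
    "card (intv A L (Suc t)) = b"
proof -
  obtain S0 where S0: "S0 \<in> \<S>" using nonempty by auto
  with sub have "A \<subseteq> S0" by blast
  from pencil_S[OF A S0 this]
  obtain L where L: "subspace L" "A \<subseteq> L" "dim L = Suc k" "\<forall>S\<in>\<S>. A \<subseteq> S \<longrightarrow> S \<subseteq> L"
    by (elim exE conjE)
  have "\<S> \<subseteq> intv A L (Suc t)"
  proof
    fix S' assume "S' \<in> \<S>"
    with L(4) sub S[of S'] show "S' \<in> intv A L (Suc t)" by (simp add: intv_def)
  qed
  with L that show ?thesis using card_extensions[OF A(1) L(1,2)] A(2) by simp
qed

text \<open>If T0 does not contain A, each S is A + (S \<inter> T0) and lies in A + T0, of dimension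
  t + 2; only q + 1 spaces of dimension t + 1 lie between A and this sum.\<close>

lemma full_pencil_contained:
  assumes A: "subspace A" "dim A = t" and sub: "\<forall>S\<in>\<S>. A \<subseteq> S" and big: "q + 1 < card \<S>"
    and T0: "T0 \<in> \<T>"
  shows "A \<subseteq> T0"
proof (rule ccontr)
  assume not: "\<not> A \<subseteq> T0"
  have sAT: "subspace (A \<inter> T0)" using A T(1)[OF T0] by (intro subspace_inter) auto
  have "dim (A \<inter> T0) < dim A" using not by (intro dim_less sAT A(1)) auto
  then have lt: "dim (A \<inter> T0) < t" using A by simp
  have each: "S' \<subseteq> A \<squnion> T0 \<and> t \<le> dim (A \<inter> T0) + 1" if S': "S' \<in> \<S>" for S'
  proof -
    have AS: "A \<subseteq> S'" using sub S' by blast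
    have sI: "subspace (S' \<inter> T0)" using S(1)[OF S'] T(1)[OF T0] by (rule subspace_inter)
    have "A \<noteq> S' \<inter> T0" using not by blast
    from ssum_eq_of_hyperplanes[OF A(1) sI this _ cross[OF S' T0] S(1)[OF S'] AS _ S(2)[OF S']]
    have eq: "A \<squnion> (S' \<inter> T0) = S'" using A(2) by simp
    have "A \<squnion> (S' \<inter> T0) \<subseteq> A \<squnion> T0" by (intro span_mono) auto
    moreover have "A \<inter> (S' \<inter> T0) = A \<inter> T0" using AS by auto
    ultimately show ?thesis
      using dim_ssum[OF A(1) sI] cross[OF S' T0] unfolding eq using A(2) S(2)[OF S'] by simp
  qed
  obtain S0 where "S0 \<in> \<S>" using nonempty by auto
  have dW: "dim (A \<squnion> T0) = t + 2"
    using dim_ssum[OF A(1) T(1)[OF T0]] each[OF \<open>S0 \<in> \<S>\<close>] lt A(2) T(2)[OF T0] by linarith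
  have "\<S> \<subseteq> intv A (A \<squnion> T0) (Suc t)"
  proof
    fix S' assume "S' \<in> \<S>"
    with each[of S'] sub S[of S'] show "S' \<in> intv A (A \<squnion> T0) (Suc t)" by (simp add: intv_def)
  qed
  then have "card \<S> \<le> card (intv A (A \<squnion> T0) (Suc t))" by (intro card_mono) auto
  also have "\<dots> = q + 1"
    using card_extensions[OF A(1) subspace_span ssum_upper(1)[of A T0]] A(2) dW
    by (simp add: eval_nat_numeral qnum_Suc)
  finally show False using big by simp
qed

text \<open>Far pairs and one-element families are too small. What is left is a common (t + 2)-space
  or a pencil on each side; then both sizes have the same bound c or b, and
  \<open>full_product\<close> shows that both families are full.\<close>

lemma maximal_structure:
  assumes big: "M * M \<le> card \<S> * card \<T>"
  shows "(\<exists>Z. subspace Z \<and> dim Z = t + 2 \<and> \<S> = intv {0} Z (Suc t) \<and> \<T> = intv {0} Z (Suc t) \<and> b \<le> c) \<or>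
    (\<exists>A L L'. subspace A \<and> dim A = t \<and> subspace L \<and> dim L = Suc k \<and> A \<subseteq> L \<and>
      subspace L' \<and> dim L' = Suc k \<and> A \<subseteq> L' \<and>
      \<S> = intv A L (Suc t) \<and> \<T> = intv A L' (Suc t) \<and> c \<le> b)"
proof -
  interpret sw: cross_covers scale Basis q n k t \<T> \<S> by (rule swap)
  have M0: "0 < M" using M_gt by linarith
  have nearS: "t \<le> dim (S1 \<inter> S2)" if "S1 \<in> \<S>" "S2 \<in> \<S>" for S1 S2
    using card_prod_lt_if_far[OF that] big by linarith
  have nearT: "t \<le> dim (S1 \<inter> S2)" if "S1 \<in> \<T>" "S2 \<in> \<T>" for S1 S2
    using sw.card_prod_lt_if_far[OF that] big unfolding mult.commute[of "card \<T>"] by linarith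
  have S1: "card \<S> \<noteq> 1" using sw.card_S_lt_if_single big unfolding mult.commute[of "card \<T>"] by linarith
  have T1: "card \<T> \<noteq> 1" using card_S_lt_if_single big by linarith
  have in_Z: ?thesis if Z: "subspace Z" "dim Z = t + 2" "\<S> \<subseteq> intv {0} Z (Suc t)" "\<T> \<subseteq> intv {0} Z (Suc t)" for Z
  proof -
    have cZ: "card (intv {0} Z (Suc t)) = c" using card_hyperplanes[of Z "Suc t"] Z by simp
    have "card \<S> \<le> c" "card \<T> \<le> c"
      using card_mono[OF finite_VV Z(3)] card_mono[OF finite_VV Z(4)] cZ by simp_all
    then have "card \<S> = c \<and> card \<T> = c \<and> c = M"
      by (rule full_product) (use big M0 in auto)
    then have "\<S> = intv {0} Z (Suc t)" "\<T> = intv {0} Z (Suc t)" "b \<le> c"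
      using card_subset_eq[OF finite_VV Z(3)] card_subset_eq[OF finite_VV Z(4)] cZ by auto
    with Z show ?thesis by (intro disjI1 exI[of _ Z]) simp
  qed
  show ?thesis
  proof (cases "(\<exists>A. subspace A \<and> dim A = t \<and> (\<forall>S\<in>\<S>. A \<subseteq> S)) \<and>
      (\<exists>A. subspace A \<and> dim A = t \<and> (\<forall>T\<in>\<T>. A \<subseteq> T))")
    case False
    then consider "\<And>A. subspace A \<Longrightarrow> dim A = t \<Longrightarrow> \<exists>S\<in>\<S>. \<not> A \<subseteq> S"
      | "\<And>A. subspace A \<Longrightarrow> dim A = t \<Longrightarrow> \<exists>T\<in>\<T>. \<not> A \<subseteq> T" by blast
    then show ?thesis
    proof cases
      case 1
      show ?thesis by (rule near_no_pencil[OF nearS S1 1 in_Z])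
    next
      case 2
      show ?thesis by (rule sw.near_no_pencil[OF nearT T1 2 in_Z])
    qed
  next
    case True
    then obtain A A' where A: "subspace A" "dim A = t" "\<forall>S\<in>\<S>. A \<subseteq> S"
      and A': "subspace A'" "dim A' = t" "\<forall>T\<in>\<T>. A' \<subseteq> T" by (elim conjE exE)
    obtain L where L: "subspace L" "dim L = Suc k" "A \<subseteq> L" "\<S> \<subseteq> intv A L (Suc t)"
      "card (intv A L (Suc t)) = b" by (rule pencil_subset[OF A])
    obtain L' where L': "subspace L'" "dim L' = Suc k" "A' \<subseteq> L'" "\<T> \<subseteq> intv A' L' (Suc t)"
      "card (intv A' L' (Suc t)) = b" by (rule sw.pencil_subset[OF A'])
    have "card \<S> \<le> b" "card \<T> \<le> b"
      using card_mono[OF finite_VV L(4)] card_mono[OF finite_VV L'(4)] L(5) L'(5) by simp_all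
    then have full: "card \<S> = b \<and> card \<T> = b \<and> b = M"
      by (rule full_product) (use big M0 in auto)
    then have eqs: "\<S> = intv A L (Suc t)" "\<T> = intv A' L' (Suc t)" "c \<le> b"
      using card_subset_eq[OF finite_VV L(4)] card_subset_eq[OF finite_VV L'(4)] L(5) L'(5) by auto
    have cS: "q + 1 < card \<S>" using full M_gt by linarith
    \<comment> \<open>The full pencil forces its centre A into every member of \<open>\<T>\<close>.
      Two distinct members of \<open>\<T>\<close> meet in dimension at most t, so both centres are
      equal to T1 \<inter> T2.\<close>
    have AT: "A \<subseteq> T0" if "T0 \<in> \<T>" for T0
      by (rule full_pencil_contained[OF A cS that])
    obtain T1 where T1: "T1 \<in> \<T>" using nonempty by auto
    have "\<T> \<noteq> {T1}" using \<open>card \<T> \<noteq> 1\<close> by auto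
    then obtain T2 where T2: "T2 \<in> \<T>" "T1 \<noteq> T2" using T1 by auto
    have dI: "dim (T1 \<inter> T2) \<le> t"
      by (rule dim_Int_le_of_neq[OF T(1)[OF T1] T(1)[OF T2(1)] T2(2) T(2)[OF T1] T(2)[OF T2(1)]])
    have sI: "subspace (T1 \<inter> T2)" using T(1)[OF T1] T(1)[OF T2(1)] by (rule subspace_inter)
    have "A = T1 \<inter> T2" using AT[OF T1] AT[OF T2(1)] dI A(2)
      by (intro subspace_dim_equal[OF A(1) sI]) auto
    moreover have "A' = T1 \<inter> T2" using A'(3) T1 T2(1) dI A'(2)
      by (intro subspace_dim_equal[OF A'(1) sI]) auto
    ultimately have "A' = A" by simp
    show ?thesis
      by (rule disjI2, rule exI[of _ A], rule exI[of _ L], rule exI[of _ L'])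
        (use A L L' eqs \<open>A' = A\<close> in simp)
  qed
qed

end

section \<open>Extremal pairs\<close>

context finite_vector_space
begin

lemma subspaces_of_dim_eq: "subspaces_of_dim scale W j = intv {0} W j"
  by (auto simp: subspaces_of_dim_def intv_def subspace_0)

lemma dim_Int_ge:
  assumes "subspace X" "subspace Y" "subspace W" "X \<subseteq> W" "Y \<subseteq> W"
  shows "dim X + dim Y \<le> dim W + dim (X \<inter> Y)"
  using dim_ssum[OF assms(1,2)] dim_subset[OF ssum_least[OF assms(4,5,3)]] by linarith

lemma hyperplane_avoiding:
  assumes W: "subspace W" "dim W = Suc k" and x: "x \<noteq> 0"
  obtains H where "H \<in> intv {0} W k" "x \<notin> H"
proof (cases "x \<in> W")
  case True
  have "{0} \<squnion> span {x} = span {x}"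
    by (metis insert_is_Un span_insert_0 span_span)
  then have "k + dim ({0} \<squnion> span {x}) \<le> dim W" using W(2) by simp
  moreover have "span {x} \<subseteq> W" using True W(1) by (intro span_minimal) auto
  ultimately obtain H where H: "H \<in> intv {0} W k" "H \<inter> span {x} = {0} \<inter> span {x}"
    using avoiding_exists[of "{0}" W "span {x}" k k] W(1) subspace_0 by auto
  have "x \<notin> H"
  proof
    assume "x \<in> H"
    then have "x \<in> {0}" using H(2) span_base[of x "{x}"] by auto
    with x show False by simp
  qed
  with H(1) show ?thesis by (rule that)
next
  case False
  obtain H where H: "H \<in> intv {0} W k"
    using intv_nonempty[of "{0}" W k] W subspace_0 by auto
  with False have "x \<notin> H" by (auto simp: intv_def)
  with H show ?thesis by (rule that)
qed

text \<open>Gives the nontriviality of competing families: no nonzero vector lies in all hyperplanes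
  of W, so it suffices that a family contains those of one (k + 1)-space.\<close>

lemma dim_Inter_eq_0:
  assumes W: "subspace W" "dim W = Suc k" and sub: "intv {0} W k \<subseteq> \<F>"
  shows "dim (\<Inter>\<F>) = 0"
proof -
  have "\<Inter>\<F> \<subseteq> {0}"
  proof
    fix x assume x: "x \<in> \<Inter>\<F>"
    show "x \<in> {0}"
    proof (rule ccontr)
      assume "x \<notin> {0}"
      then obtain H where "H \<in> intv {0} W k" "x \<notin> H"
        using hyperplane_avoiding[OF W, of x] by blast
      with sub x show False by blast
    qed
  qed
  then have "dim (\<Inter>\<F>) \<le> dim {0}" by (rule dim_subset)
  then show ?thesis by simp
qed

lemma H1_eq:
  "H1 scale k t L M A = {F \<in> intv {0} UNIV k. A \<subseteq> F \<and> t + 1 \<le> dim (F \<inter> L)} \<union>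
     {F \<in> intv {0} M k. \<not> A \<subseteq> F}"
  by (simp add: H1_def subspaces_of_dim_eq)

lemma H2_eq: "H2 scale k t Z = {F \<in> intv {0} UNIV k. t + 1 \<le> dim (F \<inter> Z)}"
  by (simp add: H2_def subspaces_of_dim_eq)

lemma H1_subset: "H1 scale k t L M A \<subseteq> intv {0} UNIV k"
  by (auto simp: H1_eq intv_def)

lemma H2_subset: "H2 scale k t Z \<subseteq> intv {0} UNIV k"
  by (auto simp: H2_eq)

lemma H2_cross:
  assumes Z: "subspace Z" "dim Z = t + 2" and F: "F \<in> H2 scale k t Z" and G: "G \<in> H2 scale k t Z"
  shows "t \<le> dim (F \<inter> G)"
proof -
  have s: "subspace (F \<inter> Z)" "subspace (G \<inter> Z)"
    using F G Z(1) by (auto simp: H2_eq intv_def subspace_inter)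
  have "dim (F \<inter> Z) + dim (G \<inter> Z) \<le> dim Z + dim ((F \<inter> Z) \<inter> (G \<inter> Z))"
    by (rule dim_Int_ge[OF s Z(1)]) auto
  moreover have "dim ((F \<inter> Z) \<inter> (G \<inter> Z)) \<le> dim (F \<inter> G)" by (intro dim_subset) auto
  moreover have "t + 1 \<le> dim (F \<inter> Z)" "t + 1 \<le> dim (G \<inter> Z)" using F G by (auto simp: H2_eq)
  ultimately show ?thesis using Z(2) by linarith
qed

lemma H1_cross_aux:
  assumes L: "subspace L" "dim L = Suc k" and F: "subspace F" "t + 1 \<le> dim (F \<inter> L)"
    and G: "subspace G" "dim G = k" "G \<subseteq> L"
  shows "t \<le> dim (F \<inter> G)"
proof -
  have "dim (F \<inter> L) + dim G \<le> dim L + dim ((F \<inter> L) \<inter> G)"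
    by (rule dim_Int_ge[OF subspace_inter[OF F(1) L(1)] G(1) L(1) _ G(3)]) auto
  moreover have "dim ((F \<inter> L) \<inter> G) \<le> dim (F \<inter> G)" by (intro dim_subset) auto
  ultimately show ?thesis using L F G by linarith
qed

lemma H1_cross:
  assumes L: "subspace L" "dim L = Suc k" and M: "subspace M" "dim M = Suc k"
    and A: "subspace A" "dim A = t" and LM: "t + 2 \<le> dim (M \<inter> L)"
    and F: "F \<in> H1 scale k t L M A" and G: "G \<in> H1 scale k t M L A"
  shows "t \<le> dim (F \<inter> G)"
proof -
  have sF: "subspace F" "dim F = k" and sG: "subspace G" "dim G = k"
    using intvD[OF subsetD[OF H1_subset F]] intvD[OF subsetD[OF H1_subset G]] by auto
  consider "A \<subseteq> F" "A \<subseteq> G" | "t + 1 \<le> dim (F \<inter> L)" "G \<subseteq> L"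
    | "F \<subseteq> M" "t + 1 \<le> dim (G \<inter> M)" | "F \<subseteq> M" "G \<subseteq> L"
    using F G unfolding H1_eq intv_def by blast
  then show ?thesis
  proof cases
    case 1
    then have "dim A \<le> dim (F \<inter> G)" by (intro dim_subset) auto
    then show ?thesis using A by simp
  next
    case 2
    then show ?thesis using H1_cross_aux[OF L sF(1) _ sG] by simp
  next
    case 3
    then show ?thesis using H1_cross_aux[OF M sG(1) _ sF] by (simp add: Int_commute)
  next
    case 4
    \<comment> \<open>F and G are hyperplanes of different spaces here, so they are compared inside
      M \<inter> L, where each has codimension at most one; t + 2 dimensions leave t.\<close>
    let ?I = "M \<inter> L"
    have sI: "subspace ?I" using M(1) L(1) by (rule subspace_inter)
    have "dim F + dim ?I \<le> dim M + dim (F \<inter> ?I)"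
      by (rule dim_Int_ge[OF sF(1) sI M(1) 4(1)]) auto
    moreover have "dim G + dim ?I \<le> dim L + dim (G \<inter> ?I)"
      by (rule dim_Int_ge[OF sG(1) sI L(1) 4(2)]) auto
    moreover have "dim (F \<inter> ?I) + dim (G \<inter> ?I) \<le> dim ?I + dim ((F \<inter> ?I) \<inter> (G \<inter> ?I))"
      by (rule dim_Int_ge[OF subspace_inter[OF sF(1) sI] subspace_inter[OF sG(1) sI] sI]) auto
    moreover have "dim ((F \<inter> ?I) \<inter> (G \<inter> ?I)) \<le> dim (F \<inter> G)" by (intro dim_subset) auto
    ultimately show ?thesis using LM M L sF sG by linarith
  qed
qed

end

section \<open>Maximal pairs, their covers and the lower bound\<close>

locale extremal_pair = finite_vector_space +
  fixes k t :: nat and \<F> \<G> :: "'b set set"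
  assumes F_sub: "\<F> \<subseteq> intv {0} UNIV k" and G_sub: "\<G> \<subseteq> intv {0} UNIV k"
    and cross: "\<And>F G. F \<in> \<F> \<Longrightarrow> G \<in> \<G> \<Longrightarrow> t \<le> dim (F \<inter> G)"
    and F_nt: "dim (\<Inter>\<F>) < t" and G_nt: "dim (\<Inter>\<G>) < t"
    and maximal: "\<And>\<F>' \<G>'. \<F>' \<subseteq> intv {0} UNIV k \<Longrightarrow> \<G>' \<subseteq> intv {0} UNIV k \<Longrightarrow>
      (\<And>F G. F \<in> \<F>' \<Longrightarrow> G \<in> \<G>' \<Longrightarrow> t \<le> dim (F \<inter> G)) \<Longrightarrow>
      dim (\<Inter>\<F>') < t \<Longrightarrow> dim (\<Inter>\<G>') < t \<Longrightarrow> card \<F>' * card \<G>' \<le> card \<F> * card \<G>"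
    and t_pos: "0 < t" and tk: "t < k" and nk: "4 * k + 6 \<le> n"
begin

lemma swap: "extremal_pair scale Basis q n k t \<G> \<F>"
proof
  fix F G assume "F \<in> \<G>" "G \<in> \<F>"
  then show "t \<le> dim (F \<inter> G)" using cross[of G F] by (simp add: Int_commute)
next
  fix \<F>' \<G>'
  assume "\<F>' \<subseteq> intv {0} UNIV k" "\<G>' \<subseteq> intv {0} UNIV k"
    "\<And>F G. F \<in> \<F>' \<Longrightarrow> G \<in> \<G>' \<Longrightarrow> t \<le> dim (F \<inter> G)"
    "dim (\<Inter>\<F>') < t" "dim (\<Inter>\<G>') < t"
  from maximal[OF this] show "card \<F>' * card \<G>' \<le> card \<G> * card \<F>"
    by (simp add: mult.commute)
qed (rule F_sub G_sub F_nt G_nt t_pos tk nk)+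

text \<open>X and Y are the first- and second-order units of all estimates. The number a counts the
  t-spaces in a (t + 1)-space, b is the size of a full pencil of covers, c that of the set of
  hyperplanes of a (t + 2)-space, and \<open>\<beta>\<close> is the cost of one dimension in an
  enlargement.\<close>

abbreviation X :: nat where "X \<equiv> over_count k (Suc t)"
abbreviation Y :: nat where "Y \<equiv> over_count k (Suc (Suc t))"
abbreviation a :: nat where "a \<equiv> qnum q (Suc t)"
abbreviation b :: nat where "b \<equiv> qnum q (Suc k - t)"
abbreviation c :: nat where "c \<equiv> qnum q (t + 2)"
abbreviation M :: nat where "M \<equiv> max b c"
abbreviation \<beta> :: nat where "\<beta> \<equiv> q ^ (k - t + 1)"

lemma F_members: "F \<in> \<F> \<Longrightarrow> subspace F" "F \<in> \<F> \<Longrightarrow> dim F = k"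
  using F_sub by (auto simp: intv_def)

lemma G_members: "G \<in> \<G> \<Longrightarrow> subspace G" "G \<in> \<G> \<Longrightarrow> dim G = k"
  using G_sub by (auto simp: intv_def)

text \<open>The intersection of the empty family is the whole space, whose dimension n is not below
  t.\<close>

lemma G_nonempty: "\<G> \<noteq> {}"
proof
  assume "\<G> = {}"
  with G_nt tk nk show False by simp
qed

text \<open>Covers of \<open>\<F>\<close> only; those of \<open>\<G>\<close> are the covers of the
  exchanged pair, reached through \<open>swap\<close>.\<close>

definition covers :: "nat \<Rightarrow> 'b set set" where
  "covers d = {S. subspace S \<and> dim S = d \<and> (\<forall>F\<in>\<F>. t \<le> dim (S \<inter> F))}"

lemma covers_gt: "S \<in> covers d \<Longrightarrow> t < d"
proof (rule ccontr)
  assume S: "S \<in> covers d" and "\<not> t < d"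
  then have s: "subspace S" "dim S \<le> t" by (auto simp: covers_def)
  have "S \<subseteq> F" if F: "F \<in> \<F>" for F
  proof -
    have "S \<inter> F = S"
      using S F s(2) by (intro subspace_dim_equal[OF subspace_inter[OF s(1) F_members(1)[OF F]] s(1)])
        (auto simp: covers_def)
    then show ?thesis by auto
  qed
  then have sub: "S \<subseteq> \<Inter>\<F>" by auto
  have "\<F> \<noteq> {}"
    by (rule extremal_pair.G_nonempty[OF swap])
  then obtain F where "F \<in> \<F>" by auto
  with S have "t \<le> dim (S \<inter> F)" by (simp add: covers_def)
  also have "\<dots> \<le> dim (\<Inter>\<F>)" using sub by (intro dim_subset) auto
  finally show False using F_nt by simp
qed

lemma G_covers: "G \<in> \<G> \<Longrightarrow> G \<in> covers k"
  using cross G_members by (auto simp: covers_def Int_commute)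

text \<open>A cover T of \<open>\<G>\<close> provides the starting t-spaces, and the absence of
  small covers of \<open>\<F>\<close> inside members drives the enlargement up to dimension t + i.
  The subfamily allows a restriction to those members that contain no small cover.\<close>

lemma card_G_le:
  assumes T: "subspace T" "\<And>G. G \<in> \<G> \<Longrightarrow> t \<le> dim (T \<inter> G)"
    and U: "\<U> \<subseteq> \<G>"
    and nc: "\<And>S G. G \<in> \<U> \<Longrightarrow> subspace S \<Longrightarrow> S \<subseteq> G \<Longrightarrow> dim S < t + i \<Longrightarrow> S \<notin> covers (dim S)"
  shows "card \<U> \<le> card (intv {0} T t) * (\<beta> ^ i * over_count k (t + i))"
proof (rule card_by_meeting[OF T(1)])
  fix G assume "G \<in> \<U>"
  then show "subspace G \<and> t \<le> dim (T \<inter> G)" using T(2) G_members U by auto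
next
  fix A assume "A \<in> intv {0} T t"
  then have A: "subspace A" "dim A + i = t + i" by (auto simp: intv_def)
  show "card {G \<in> \<U>. A \<subseteq> G} \<le> \<beta> ^ i * over_count k (t + i)"
  proof (rule card_members_over_le[OF F_sub _ _ _ _ _ A])
    show "\<U> \<subseteq> intv {0} UNIV k" using U G_sub by auto
    show "\<And>F G. F \<in> \<F> \<Longrightarrow> G \<in> \<U> \<Longrightarrow> t \<le> dim (F \<inter> G)" using cross U by auto
    show "t \<le> k" "k + k + 1 \<le> n + t" using tk nk by auto
    fix S G assume S: "G \<in> \<U>" "subspace S" "S \<subseteq> G" "dim S < t + i"
    from nc[OF this] S(2) show "\<exists>F\<in>\<F>. dim (S \<inter> F) < t" by (auto simp: covers_def not_le)
  qed
qed

lemma lower_bound_aux: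
  assumes W: "subspace W" "dim W = Suc k" "intv {0} W k \<subseteq> \<H>" and H: "\<H> \<subseteq> intv {0} UNIV k"
    and self: "\<And>F G. F \<in> \<H> \<Longrightarrow> G \<in> \<H> \<Longrightarrow> t \<le> dim (F \<inter> G)"
  shows "card \<H> * card \<H> \<le> card \<F> * card \<G>"
proof -
  have d: "dim (\<Inter>\<H>) < t" using dim_Inter_eq_0[OF W] t_pos tk by linarith
  show ?thesis by (rule maximal[OF H H self d d])
qed

lemma H2_lower:
  assumes Z: "subspace Z" "dim Z = t + 2"
  shows "card (H2 scale k t Z) * card (H2 scale k t Z) \<le> card \<F> * card \<G>"
proof -
  obtain W where W: "W \<in> intv Z UNIV (Suc k)"
    using intv_nonempty[of Z UNIV "Suc k"] Z tk nk by auto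
  have "intv {0} W k \<subseteq> H2 scale k t Z"
  proof
    fix F assume F: "F \<in> intv {0} W k"
    have "dim F + dim Z \<le> dim W + dim (F \<inter> Z)"
      using F W by (intro dim_Int_ge Z(1)) (auto simp: intv_def)
    then show "F \<in> H2 scale k t Z" using F W Z by (simp add: H2_eq intv_def)
  qed
  with W show ?thesis
    by (intro lower_bound_aux[of W] H2_subset H2_cross[OF Z]) (auto simp: intv_def)
qed

lemma H1_lower:
  assumes L: "subspace L" "dim L = Suc k" and A: "subspace A" "dim A = t" "A \<subseteq> L"
  shows "card (H1 scale k t L L A) * card (H1 scale k t L L A) \<le> card \<F> * card \<G>"
proof -
  have "intv {0} L k \<subseteq> H1 scale k t L L A"
  proof
    fix F assume F: "F \<in> intv {0} L k"
    then have "F \<inter> L = F" by (auto simp: intv_def)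
    with F tk show "F \<in> H1 scale k t L L A" by (auto simp: H1_eq intv_def)
  qed
  then show ?thesis
    using L A tk by (intro lower_bound_aux[OF L] H1_subset H1_cross[OF L L A(1,2)]) simp_all
qed

text \<open>h is the size of H1 with M = L or of H2, according to whether b or c is larger. Either
  contains all k-spaces over M spaces of dimension t + 1; Bonferroni bounds the overlaps.\<close>

lemma lower_bound:
  obtains h where "h * h \<le> card \<F> * card \<G>" "2 * M * X \<le> 2 * h + M * M * Y"
proof -
  have kn: "k \<le> n" using nk by simp
  obtain L where L: "L \<in> intv {0} UNIV (Suc k)"
    using intv_nonempty[of "{0}" UNIV "Suc k"] tk nk by (auto simp: subspace_0)
  then have L': "subspace L" "dim L = Suc k" by (auto simp: intv_def)
  obtain A where "A \<in> intv {0} L t"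
    using intv_nonempty[of "{0}" L t] tk L' by (auto simp: subspace_0)
  then have A: "subspace A" "dim A = t" "A \<subseteq> L" by (auto simp: intv_def)
  obtain Z where "Z \<in> intv {0} UNIV (t + 2)"
    using intv_nonempty[of "{0}" UNIV "t + 2"] tk nk by (auto simp: subspace_0)
  then have Z: "subspace Z" "dim Z = t + 2" by (auto simp: intv_def)
  show ?thesis
  proof (cases "c \<le> b")
    case True
    have cb: "card (intv A L (Suc t)) = b" using card_extensions[OF A(1) L'(1) A(3)] A L' by simp
    have "(\<Union>S\<in>intv A L (Suc t). intv S UNIV k) \<subseteq> H1 scale k t L L A"
    proof (rule UN_least, rule subsetI)
      fix S F assume S: "S \<in> intv A L (Suc t)" and F: "F \<in> intv S UNIV k"
      have "dim S \<le> dim (F \<inter> L)" using S F by (intro dim_subset) (auto simp: intv_def)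
      with S F show "F \<in> H1 scale k t L L A" by (auto simp: H1_eq intv_def subspace_0)
    qed
    then have "card (\<Union>S\<in>intv A L (Suc t). intv S UNIV k) \<le> card (H1 scale k t L L A)"
      by (intro card_mono) auto
    moreover have "2 * card (intv A L (Suc t)) * X \<le> 2 * card (\<Union>S\<in>intv A L (Suc t). intv S UNIV k) +
        card (intv A L (Suc t)) * card (intv A L (Suc t)) * Y"
      by (rule card_Union_over_ge[OF kn]) (auto simp: intv_def)
    ultimately show ?thesis
      using that[OF H1_lower[OF L' A]] True unfolding cb by (simp add: max_absorb1)
  next
    case False
    have cb: "card (intv {0} Z (Suc t)) = c" using card_hyperplanes[of Z "Suc t"] Z by simp
    have "(\<Union>S\<in>intv {0} Z (Suc t). intv S UNIV k) \<subseteq> H2 scale k t Z"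
    proof (rule UN_least, rule subsetI)
      fix S F assume S: "S \<in> intv {0} Z (Suc t)" and F: "F \<in> intv S UNIV k"
      have "dim S \<le> dim (F \<inter> Z)" using S F by (intro dim_subset) (auto simp: intv_def)
      with S F show "F \<in> H2 scale k t Z" by (auto simp: H2_eq intv_def subspace_0)
    qed
    then have "card (\<Union>S\<in>intv {0} Z (Suc t). intv S UNIV k) \<le> card (H2 scale k t Z)"
      by (intro card_mono) auto
    moreover have "2 * card (intv {0} Z (Suc t)) * X \<le> 2 * card (\<Union>S\<in>intv {0} Z (Suc t). intv S UNIV k) +
        card (intv {0} Z (Suc t)) * card (intv {0} Z (Suc t)) * Y"
      by (rule card_Union_over_ge[OF kn]) (auto simp: intv_def)
    ultimately show ?thesis
      using that[OF H2_lower[OF Z]] False unfolding cb by (simp add: max_absorb2)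
  qed
qed

end

text \<open>Here x, y, m stand for X, Y, M, s and r for the numbers of covers, p for their bound a
  b, and e for the error in the sizes f, g. The upper bound gives h^2 \<le> m^2 x^2 - (1 - 1/2 -
  1/64) x^2, the lower bound h^2 \<ge> m^2 x^2 - x^2 / 8.\<close>

lemma numeric_contradiction:
  fixes x y e m p r s f g h :: real
  assumes "0 < x" "0 \<le> y" "0 \<le> e" "0 \<le> m" "0 \<le> r" "0 \<le> s" "0 \<le> f" "0 \<le> g" "0 \<le> h"
    and y: "8 * (m * m * m * y) \<le> x" "m * y \<le> x" and e: "4 * (p * e) \<le> x" "8 * e \<le> x"
    and rs: "s * r + 1 \<le> m * m" "s \<le> p" "r \<le> p"
    and fg: "g \<le> s * x + e" "f \<le> r * x + e" and h: "h * h \<le> f * g" "2 * m * x \<le> 2 * h + m * m * y"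
  shows False
proof -
  have "f * g \<le> (r * x + e) * (s * x + e)"
    using assms by (intro mult_mono) auto
  also have "\<dots> = (s * r) * (x * x) + ((r + s) * e) * x + e * e" by (simp add: algebra_simps)
  also have "\<dots> \<le> (m * m - 1) * (x * x) + (x / 2) * x + x / 8 * (x / 8)"
  proof (intro add_mono mult_right_mono mult_mono)
    have "(r + s) * e \<le> (2 * p) * e" using rs assms(3) by (intro mult_right_mono) auto
    then show "(r + s) * e \<le> x / 2" using e by simp
  qed (use assms in auto)
  finally have 1: "h * h \<le> (m * m) * (x * x) - 31 / 64 * (x * x)" using h(1) by (simp add: algebra_simps)
  have "m * (m * y) \<le> m * x" using assms by (intro mult_left_mono) auto
  moreover have "0 \<le> m * x" using assms(1,4) by simp
  ultimately have "0 \<le> 2 * m * x - m * m * y" by (simp add: mult.assoc)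
  then have "(2 * m * x - m * m * y) * (2 * m * x - m * m * y) \<le> (2 * h) * (2 * h)"
    using h(2) by (intro mult_mono) auto
  then have "4 * ((m * m) * (x * x)) - 4 * (m * m * m * y) * x + (m * m * y) * (m * m * y) \<le> 4 * (h * h)"
    by (simp add: algebra_simps)
  moreover have "4 * (m * m * m * y) * x \<le> x / 2 * x" using y assms(1) by (intro mult_right_mono) auto
  moreover have "0 \<le> (m * m * y) * (m * m * y)" by simp
  moreover have "0 < x * x" using assms(1) by simp
  ultimately show False using 1 by (simp add: field_simps)
qed

context finite_vector_space
begin

lemma over_count_pos: "j \<le> k \<Longrightarrow> k \<le> n \<Longrightarrow> 0 < over_count k j"
  using over_count_antimono[of k j k] by simp

end

section \<open>Existence and number of covers of dimension t + 1\<close>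

context extremal_pair
begin

lemma X_pos: "0 < X"
  using tk nk by (intro over_count_pos) auto

lemma M_le: "M \<le> q ^ (k + 1)"
proof -
  have "b \<le> q ^ (k + 1)"
    using qnum_mono[of "Suc k - t" "k + 1" q] qnum_less_power[OF q_ge_2, of "k + 1"] by simp
  moreover have "c \<le> q ^ (k + 1)"
    using qnum_mono[of "t + 2" "k + 1" q] qnum_less_power[OF q_ge_2, of "k + 1"] tk by simp
  ultimately show ?thesis by simp
qed

lemma M_ge: "q ^ (t + 1) \<le> M"
  using power_le_qnum[of q "t + 1"] by simp

lemma over_count_X_le: "over_count k (Suc t + j) * q ^ ((3 * k + 6) * j) \<le> X"
proof -
  have "over_count k (Suc t + j) * q ^ ((3 * k + 6) * j)
      \<le> over_count k (Suc t + j) * (q ^ (n - k)) ^ j"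
    unfolding power_mult using nk q_pos by (intro mult_le_mono2 power_mono power_increasing) auto
  also have "\<dots> \<le> X" using nk by (intro over_count_add_le) simp
  finally show ?thesis .
qed

text \<open>Since n - k \<ge> 3 k + 6, this exponent is the budget for every second-order
  error.\<close>

lemma Y_X_le: "i \<le> 3 * k + 6 \<Longrightarrow> q ^ i * Y \<le> X"
proof -
  assume i: "i \<le> 3 * k + 6"
  have "q ^ i * Y \<le> q ^ (3 * k + 6) * Y" using i q_pos by (intro mult_le_mono1 power_increasing) auto
  also have "\<dots> \<le> X" using over_count_X_le[of 1] by (simp add: mult.commute)
  finally show ?thesis .
qed

text \<open>Overlaps cost at most half of M X, and M is at least q^(t + 1); this is enough to
  exclude larger least covers.\<close>

lemma lower_bound_coarse: "q ^ (2 * t + 2) * (X * X) \<le> 4 * (card \<F> * card \<G>)"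
proof -
  obtain h where h: "h * h \<le> card \<F> * card \<G>" "2 * M * X \<le> 2 * h + M * M * Y"
    by (rule lower_bound)
  have "M * Y \<le> q ^ (k + 1) * Y" using M_le by (rule mult_le_mono1)
  also have "\<dots> \<le> X" by (rule Y_X_le) simp
  finally have "M * (M * Y) \<le> M * X" by (rule mult_le_mono2)
  then have "M * X \<le> 2 * h" using h(2) unfolding mult.assoc by linarith
  moreover have "q ^ (t + 1) * X \<le> M * X" using M_ge by (rule mult_le_mono1)
  ultimately have *: "q ^ (t + 1) * X \<le> 2 * h" by linarith
  have "2 * t + 2 = (t + 1) + (t + 1)" by simp
  then have "q ^ (2 * t + 2) * (X * X) = (q ^ (t + 1) * X) * (q ^ (t + 1) * X)"
    by (simp only: power_add mult_ac)
  also have "\<dots> \<le> (2 * h) * (2 * h)" by (rule mult_le_mono[OF * *])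
  finally show ?thesis using h(1) by simp
qed

lemma least_cover:
  obtains j S where "S \<in> covers (Suc t + j)" "\<forall>d < Suc t + j. covers d = {}"
proof -
  obtain G where "G \<in> \<G>" using G_nonempty by auto
  then have ex: "\<exists>S. S \<in> covers k" using G_covers by auto
  define d where "d = (LEAST d. \<exists>S. S \<in> covers d)"
  from ex have "\<exists>S. S \<in> covers d" unfolding d_def by (rule LeastI)
  then obtain S where S: "S \<in> covers d" by (rule exE)
  have eq: "Suc t + (d - Suc t) = d" using covers_gt[OF S] by simp
  have least: "\<forall>d' < d. covers d' = {}"
    using not_less_Least[where P = "\<lambda>d. \<exists>S. S \<in> covers d"] unfolding d_def by blast
  show ?thesis by (rule that[where j = "d - Suc t", unfolded eq, OF S least])
qed

text \<open>The term t (i + 2) comes from the t-subspaces of T, (k - t + 1) (j + 1) from the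
  enlargements from dimension t to t + 1 + j, and (3 k + 6) j is what the k-spaces through the
  larger space lose against X.\<close>

lemma card_G_le_by_covers:
  assumes T: "subspace T" "dim T = Suc t + i" "\<And>G. G \<in> \<G> \<Longrightarrow> t \<le> dim (T \<inter> G)"
    and min: "\<forall>d < Suc t + j. covers d = {}"
  shows "card \<G> * q ^ ((3 * k + 6) * j) \<le> q ^ (t * (i + 2) + (k - t + 1) * (j + 1)) * X"
proof -
  have "card \<G> \<le> card (intv {0} T t) * (\<beta> ^ (j + 1) * over_count k (t + (j + 1)))"
  proof (rule card_G_le[OF T(1,3) order_refl])
    fix S assume "dim S < t + (j + 1)"
    with min have "covers (dim S) = {}" by simp
    then show "S \<notin> covers (dim S)" by simp
  qed
  also have "card (intv {0} T t) \<le> (q ^ (dim T - t + 1)) ^ t"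
    using T subspace_0 by (intro card_intv_le) auto
  also have "dim T - t + 1 = i + 2" using T(2) by simp
  also have "(q ^ (i + 2)) ^ t = q ^ (t * (i + 2))"
    unfolding power_mult[symmetric] by (simp only: mult.commute)
  finally have "card \<G> \<le> q ^ (t * (i + 2)) * (\<beta> ^ (j + 1) * over_count k (t + (j + 1)))"
    by simp
  then have "card \<G> * q ^ ((3 * k + 6) * j) \<le>
      q ^ (t * (i + 2)) * (\<beta> ^ (j + 1) * over_count k (t + (j + 1))) * q ^ ((3 * k + 6) * j)"
    by (rule mult_le_mono1)
  also have "\<dots> = q ^ (t * (i + 2) + (k - t + 1) * (j + 1)) * (over_count k (Suc t + j) * q ^ ((3 * k + 6) * j))"
  proof -
    have "t + (j + 1) = Suc t + j" by simp
    then show ?thesis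
      unfolding power_add[of q "t * (i + 2)" "(k - t + 1) * (j + 1)"] power_mult[of q "k - t + 1" "j + 1"]
      by (simp only: mult_ac)
  qed
  also have "\<dots> \<le> q ^ (t * (i + 2) + (k - t + 1) * (j + 1)) * X"
    by (rule mult_le_mono2[OF over_count_X_le])
  finally show ?thesis .
qed

text \<open>Only the product is known to be large, so the bounds for both families are multiplied.
  With s = i + j, the choices contribute 2 k + 2 + 2 t + (k + 1) s to the exponent of q and the
  losses (3 k + 6) s; compared with 2 t + 2 from the lower bound, and 2 for its factor 4, only s = 0
  is possible.\<close>

lemma small_covers_exist: "covers (Suc t) \<noteq> {}" "extremal_pair.covers scale t \<G> (Suc t) \<noteq> {}"
proof -
  interpret sw: extremal_pair scale Basis q n k t \<G> \<F> by (rule swap)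
  obtain i S where S: "S \<in> covers (Suc t + i)" "\<forall>d < Suc t + i. covers d = {}"
    by (rule least_cover)
  obtain j T where T: "T \<in> sw.covers (Suc t + j)" "\<forall>d < Suc t + j. sw.covers d = {}"
    by (rule sw.least_cover)
  have S': "subspace S" "dim S = Suc t + i" "\<And>F. F \<in> \<F> \<Longrightarrow> t \<le> dim (S \<inter> F)"
    using S(1) by (auto simp: covers_def)
  have T': "subspace T" "dim T = Suc t + j" "\<And>F. F \<in> \<G> \<Longrightarrow> t \<le> dim (T \<inter> F)"
    using T(1) by (auto simp: sw.covers_def)
  have G: "card \<G> * q ^ ((3 * k + 6) * i) \<le> q ^ (t * (j + 2) + (k - t + 1) * (i + 1)) * X"
    by (rule card_G_le_by_covers[OF T' S(2)])
  have F: "card \<F> * q ^ ((3 * k + 6) * j) \<le> q ^ (t * (i + 2) + (k - t + 1) * (j + 1)) * X"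
    by (rule sw.card_G_le_by_covers[OF S' T(2)])
  define s where "s = i + j"
  have "s = 0"
  proof (rule ccontr)
    assume "s \<noteq> 0"
    then obtain s' where s': "s = Suc s'" by (cases s) auto
    obtain r where r: "k = t + r" using tk less_imp_add_positive by blast
    let ?e = "2 * k + 2 + 2 * t + (k + 1) * s"
    have exps: "(t * (j + 2) + (k - t + 1) * (i + 1)) + (t * (i + 2) + (k - t + 1) * (j + 1)) = ?e"
      unfolding s_def r by (simp add: algebra_simps)
    have "(card \<F> * card \<G>) * q ^ ((3 * k + 6) * s) =
        (card \<G> * q ^ ((3 * k + 6) * i)) * (card \<F> * q ^ ((3 * k + 6) * j))"
      by (simp add: s_def add_mult_distrib2 power_add mult_ac)
    also have "\<dots> \<le> (q ^ (t * (j + 2) + (k - t + 1) * (i + 1)) * X) * (q ^ (t * (i + 2) + (k - t + 1) * (j + 1)) * X)"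
      by (rule mult_le_mono[OF G F])
    also have "\<dots> = q ^ ?e * (X * X)"
      unfolding exps[symmetric] power_add by (simp only: mult_ac)
    finally have up: "(card \<F> * card \<G>) * q ^ ((3 * k + 6) * s) \<le> q ^ ?e * (X * X)" .
    have "q ^ ((3 * k + 6) * s) * (q ^ (2 * t + 2) * (X * X)) \<le>
        q ^ ((3 * k + 6) * s) * (4 * (card \<F> * card \<G>))"
      by (rule mult_le_mono2[OF lower_bound_coarse])
    also have "\<dots> \<le> 4 * (q ^ ?e * (X * X))" using up by (simp add: mult_ac)
    finally have "q ^ ((3 * k + 6) * s + (2 * t + 2)) * (X * X) \<le> (4 * q ^ ?e) * (X * X)"
      by (simp only: power_add mult.assoc)
    then have le: "q ^ ((3 * k + 6) * s + (2 * t + 2)) \<le> 4 * q ^ ?e" using X_pos by simp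
    have "4 \<le> q ^ 2" using power_mono[OF q_ge_2, of 2] by simp
    then have "4 * q ^ ?e \<le> q ^ 2 * q ^ ?e" by (rule mult_le_mono1)
    also have "\<dots> = q ^ (2 + ?e)" by (simp only: power_add)
    also have "\<dots> < q ^ ((3 * k + 6) * s + (2 * t + 2))"
      using q_ge_2 by (intro power_strict_increasing) (simp_all add: s' algebra_simps)
    finally show False using le by linarith
  qed
  then have "i = 0" "j = 0" by (auto simp: s_def)
  with S T show "covers (Suc t) \<noteq> {}" "sw.covers (Suc t) \<noteq> {}" by auto
qed

text \<open>Adding H keeps the cross condition and can only shrink the intersection, so the pair
  stays admissible; as \<open>\<F>\<close> is nonempty, its product would grow.\<close>

lemma G_closed:
  assumes "H \<in> intv {0} UNIV k" "\<And>F. F \<in> \<F> \<Longrightarrow> t \<le> dim (F \<inter> H)"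
  shows "H \<in> \<G>"
proof (rule ccontr)
  assume "H \<notin> \<G>"
  have "dim (\<Inter>(insert H \<G>)) \<le> dim (\<Inter>\<G>)" by (intro dim_subset) auto
  then have "card \<F> * card (insert H \<G>) \<le> card \<F> * card \<G>"
    using assms F_sub G_sub cross F_nt G_nt by (intro maximal) auto
  moreover have "0 < card \<F>"
    using extremal_pair.G_nonempty[OF swap] by (simp add: card_gt_0_iff)
  ultimately show False using \<open>H \<notin> \<G>\<close> by simp
qed

lemma over_cover_subset: "S \<in> covers d \<Longrightarrow> intv S UNIV k \<subseteq> \<G>"
proof
  fix H assume S: "S \<in> covers d" and H: "H \<in> intv S UNIV k"
  show "H \<in> \<G>"
  proof (rule G_closed)
    show "H \<in> intv {0} UNIV k" using H by (auto simp: intv_def subspace_0)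
    fix F assume "F \<in> \<F>"
    then have "t \<le> dim (S \<inter> F)" using S by (simp add: covers_def)
    also have "\<dots> \<le> dim (F \<inter> H)" using H by (intro dim_subset) (auto simp: intv_def)
    finally show "t \<le> dim (F \<inter> H)" .
  qed
qed

text \<open>All k-spaces through T belong to \<open>\<F>\<close> by closure, so S covers them. As n
  is large, one of them meets S in T \<inter> S only.\<close>

lemma covers_cross:
  assumes S: "S \<in> covers (Suc t)" and T: "T \<in> extremal_pair.covers scale t \<G> (Suc t)"
  shows "t \<le> dim (S \<inter> T)"
proof -
  interpret sw: extremal_pair scale Basis q n k t \<G> \<F> by (rule swap)
  have sS: "subspace S" "dim S = Suc t" using S by (auto simp: covers_def)
  have sT: "subspace T" "dim T = Suc t" using T by (auto simp: sw.covers_def)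
  have "dim (T \<squnion> S) \<le> 2 * t + 2" using dim_ssum[OF sT(1) sS(1)] sS sT by linarith
  then have "(k - Suc t) + dim (T \<squnion> S) \<le> dim UNIV" unfolding n_eq using nk tk by linarith
  then obtain F where F: "F \<in> intv T UNIV k" "F \<inter> S = T \<inter> S"
    using avoiding_exists[OF sT(1) subspace_UNIV sS(1), of "k - Suc t" k] sT(2) tk by auto
  have "F \<in> \<F>" using sw.over_cover_subset[OF T] F(1) by blast
  then have "t \<le> dim (S \<inter> F)" using S by (simp add: covers_def)
  then show ?thesis using F(2) by (simp add: Int_commute)
qed

text \<open>Take a member F with dim (A \<inter> F) < t. A cover S through A of dimension t + 1 is A
  + (S \<inter> F), hence lies in A + F. The existence of one such cover forces dim (A \<inter> F) =
  t - 1, which gives A + F the dimension k + 1.\<close>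

lemma covers_pencil:
  assumes A: "subspace A" "dim A = t" and S: "S \<in> covers (Suc t)" and AS: "A \<subseteq> S"
  shows "\<exists>L. subspace L \<and> A \<subseteq> L \<and> dim L = Suc k \<and> (\<forall>S\<in>covers (Suc t). A \<subseteq> S \<longrightarrow> S \<subseteq> L)"
proof -
  have "A \<notin> covers t" using covers_gt by blast
  then obtain F where F: "F \<in> \<F>" "dim (A \<inter> F) < t" using A by (auto simp: covers_def not_le)
  note sF = F_members[OF F(1)]
  have eq: "A \<squnion> (S' \<inter> F) = S'" "A \<inter> (S' \<inter> F) = A \<inter> F" "t \<le> dim (S' \<inter> F)"
    if S': "S' \<in> covers (Suc t)" "A \<subseteq> S'" for S'
  proof -
    have s: "subspace S'" "dim S' = Suc t" using S' by (auto simp: covers_def)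
    show m: "t \<le> dim (S' \<inter> F)" using S' F by (simp add: covers_def)
    have "A \<noteq> S' \<inter> F" using F(2) A(2) by (metis Int_absorb2 inf_le2 less_irrefl)
    then show "A \<squnion> (S' \<inter> F) = S'"
      using A m s S'(2) by (intro ssum_eq_of_hyperplanes[OF A(1) subspace_inter[OF s(1) sF(1)], of t]) auto
    show "A \<inter> (S' \<inter> F) = A \<inter> F" using S'(2) by auto
  qed
  have s: "subspace S" "dim S = Suc t" using S by (auto simp: covers_def)
  have "dim S + dim (A \<inter> F) = dim A + dim (S \<inter> F)"
    using dim_ssum[OF A(1) subspace_inter[OF s(1) sF(1)]] unfolding eq(1,2)[OF S AS] .
  then have "dim (A \<squnion> F) = Suc k"
    using dim_ssum[OF A(1) sF(1)] eq(3)[OF S AS] s(2) A(2) sF(2) F(2) by linarith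
  moreover have "S' \<subseteq> A \<squnion> F" if "S' \<in> covers (Suc t)" "A \<subseteq> S'" for S'
  proof -
    have "A \<squnion> (S' \<inter> F) \<subseteq> A \<squnion> F" by (intro span_mono) auto
    then show ?thesis unfolding eq(1)[OF that] .
  qed
  ultimately show ?thesis
    by (intro exI[of _ "A \<squnion> F"] conjI ballI impI subspace_span ssum_upper(1))
qed

lemma cross_covers: "cross_covers scale Basis q n k t (covers (Suc t)) (extremal_pair.covers scale t \<G> (Suc t))"
proof -
  interpret sw: extremal_pair scale Basis q n k t \<G> \<F> by (rule swap)
  show ?thesis
  proof
    show "\<And>S. S \<in> covers (Suc t) \<Longrightarrow> subspace S" "\<And>S. S \<in> covers (Suc t) \<Longrightarrow> dim S = Suc t"
      by (simp_all add: covers_def)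
    show "\<And>S. S \<in> sw.covers (Suc t) \<Longrightarrow> subspace S" "\<And>S. S \<in> sw.covers (Suc t) \<Longrightarrow> dim S = Suc t"
      by (simp_all add: sw.covers_def)
  qed (rule covers_cross covers_pencil sw.covers_pencil small_covers_exist t_pos tk; assumption)+
qed

text \<open>Members containing a cover of dimension t + 1 give the main term. The others contain no
  cover of dimension below t + 2, so from each of the a hyperplanes of T the enlargement gains two
  dimensions, at the cost \<open>\<beta> * \<beta>\<close>.\<close>

lemma card_G_le_covers:
  "card \<G> \<le> card (covers (Suc t)) * X + a * (\<beta> * \<beta> * Y)"
proof -
  interpret sw: extremal_pair scale Basis q n k t \<G> \<F> by (rule swap)
  obtain T where T: "T \<in> sw.covers (Suc t)" using small_covers_exist by auto
  then have T': "subspace T" "dim T = Suc t" "\<And>G. G \<in> \<G> \<Longrightarrow> t \<le> dim (T \<inter> G)"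
    by (auto simp: sw.covers_def)
  let ?U = "{G \<in> \<G>. \<not> (\<exists>S\<in>covers (Suc t). S \<subseteq> G)}"
  have "card ?U \<le> card (intv {0} T t) * (\<beta> ^ 2 * over_count k (t + 2))"
  proof (rule card_G_le[OF T'(1,3)])
    fix S G assume a: "G \<in> ?U" "S \<subseteq> G" "dim S < t + 2"
    show "S \<notin> covers (dim S)"
    proof
      assume c: "S \<in> covers (dim S)"
      from covers_gt[OF c] a(3) have "dim S = Suc t" by simp
      with c a show False by auto
    qed
  qed auto
  also have "card (intv {0} T t) = a" using card_hyperplanes[of T t] T' by simp
  finally have U: "card ?U \<le> a * (\<beta> * \<beta> * Y)" by (simp add: power2_eq_square)
  have "\<G> \<subseteq> (\<Union>S\<in>covers (Suc t). intv S UNIV k) \<union> ?U"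
    using G_members by (auto simp: intv_def)
  then have "card \<G> \<le> card ((\<Union>S\<in>covers (Suc t). intv S UNIV k) \<union> ?U)" by (intro card_mono) auto
  also have "\<dots> \<le> card (\<Union>S\<in>covers (Suc t). intv S UNIV k) + card ?U" by (rule card_Un_le)
  also have "card (\<Union>S\<in>covers (Suc t). intv S UNIV k) \<le> (\<Sum>S\<in>covers (Suc t). card (intv S UNIV k))"
    by (rule card_UN_le) simp
  also have "\<dots> = (\<Sum>S\<in>covers (Suc t). X)"
    by (intro sum.cong) (auto simp: card_over covers_def)
  finally show ?thesis using U by simp
qed

text \<open>By integrality a smaller product is at most M^2 - 1, and the missing X^2 outweighs all
  errors.\<close>

lemma covers_product: "M * M \<le> card (covers (Suc t)) * card (extremal_pair.covers scale t \<G> (Suc t))"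
proof (rule ccontr)
  interpret sw: extremal_pair scale Basis q n k t \<G> \<F> by (rule swap)
  interpret cc: cross_covers scale Basis q n k t "covers (Suc t)" "sw.covers (Suc t)"
    by (rule cross_covers)
  interpret cs: cross_covers scale Basis q n k t "sw.covers (Suc t)" "covers (Suc t)"
    by (rule sw.cross_covers)
  let ?s = "card (covers (Suc t))" and ?r = "card (sw.covers (Suc t))"
  assume "\<not> M * M \<le> ?s * ?r"
  then have rs: "?s * ?r + 1 \<le> M * M" by simp
  obtain h where h: "h * h \<le> card \<F> * card \<G>" "2 * M * X \<le> 2 * h + M * M * Y"
    by (rule lower_bound)
  let ?e = "a * (\<beta> * \<beta> * Y)"
  have q8: "8 \<le> q ^ 3" using power_mono[OF q_ge_2, of 3] by simp
  have a_le: "a \<le> q ^ (t + 1)" using qnum_less_power[OF q_ge_2, of "t + 1"] by simp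
  have "b \<le> q ^ (Suc k - t)" using qnum_less_power[OF q_ge_2, of "Suc k - t"] by simp
  then have b_le: "b \<le> \<beta>" using tk by (simp add: Suc_diff_le)
  have e1: "?e \<le> q ^ (t + 1) * (\<beta> * \<beta> * Y)" using a_le by (rule mult_le_mono1)
  have e8: "8 * ?e \<le> X"
  proof -
    have "8 * ?e \<le> q ^ 3 * (q ^ (t + 1) * (\<beta> * \<beta> * Y))" by (rule mult_le_mono[OF q8 e1])
    also have "\<dots> = q ^ (3 + (t + 1) + (k - t + 1) + (k - t + 1)) * Y" by (simp only: power_add mult_ac)
    also have "\<dots> \<le> X" using tk by (intro Y_X_le) simp
    finally show ?thesis .
  qed
  \<comment> \<open>The mixed error terms carry the number of covers, at most a b by
    \<open>card_S_le\<close>. Bounding 4 by q^(t + 1) makes the exponent 3 (t + 1) + 3 (k - t + 1) =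
    3 k + 6.\<close>
  have e4: "4 * (a * b * ?e) \<le> X"
  proof -
    have "4 \<le> q ^ (t + 1)"
      using power_mono[OF q_ge_2, of 2] power_increasing[of 2 "t + 1" q] q_pos t_pos by simp
    then have "4 * (a * b * ?e) \<le> q ^ (t + 1) * ((q ^ (t + 1) * \<beta>) * (q ^ (t + 1) * (\<beta> * \<beta> * Y)))"
      by (intro mult_le_mono a_le b_le order_refl)
    also have "\<dots> = q ^ ((t + 1) + (t + 1) + (k - t + 1) + (t + 1) + (k - t + 1) + (k - t + 1)) * Y"
      by (simp only: power_add mult_ac)
    also have "\<dots> \<le> X" using tk by (intro Y_X_le) simp
    finally show ?thesis .
  qed
  \<comment> \<open>Three factors M and 8 \<le> q^3 add up to the exponent 3 (k + 1) + 3 = 3 k + 6,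
    all that n \<ge> 4 k + 6 provides.\<close>
  have y8: "8 * (M * M * M * Y) \<le> X"
  proof -
    have "8 * (M * M * M * Y) \<le> q ^ 3 * (q ^ (k + 1) * q ^ (k + 1) * q ^ (k + 1) * Y)"
      by (intro mult_le_mono q8 M_le order_refl)
    also have "\<dots> = q ^ (3 + (k + 1) + (k + 1) + (k + 1)) * Y" by (simp only: power_add mult_ac)
    also have "\<dots> \<le> X" by (intro Y_X_le) simp
    finally show ?thesis .
  qed
  have y1: "M * Y \<le> X"
  proof -
    have "M * Y \<le> q ^ (k + 1) * Y" using M_le by (rule mult_le_mono1)
    also have "\<dots> \<le> X" by (rule Y_X_le) simp
    finally show ?thesis .
  qed
  have "?s \<le> a * b" "?r \<le> a * b" using cc.card_S_le cs.card_S_le by simp_all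
  define m x y e where "m = real M" and "x = real X" and "y = real Y" and "e = real ?e"
  show False
  proof (rule numeric_contradiction[of x y e m "real ?r" "real ?s" "real (card \<F>)" "real (card \<G>)" "real h" "real (a * b)"])
    show "0 < x" using X_pos by (simp add: x_def)
    show "8 * (m * m * m * y) \<le> x"
      using of_nat_mono[where ?'a = real, OF y8] unfolding m_def x_def y_def e_def
      by (simp only: of_nat_mult of_nat_add of_nat_numeral of_nat_1)
    show "m * y \<le> x"
      using of_nat_mono[where ?'a = real, OF y1] unfolding m_def x_def y_def e_def
      by (simp only: of_nat_mult of_nat_add of_nat_numeral of_nat_1)
    show "4 * (real (a * b) * e) \<le> x"
      using of_nat_mono[where ?'a = real, OF e4] unfolding m_def x_def y_def e_def
      by (simp only: of_nat_mult of_nat_add of_nat_numeral of_nat_1)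
    show "8 * e \<le> x"
      using of_nat_mono[where ?'a = real, OF e8] unfolding m_def x_def y_def e_def
      by (simp only: of_nat_mult of_nat_add of_nat_numeral of_nat_1)
    show "real ?s * real ?r + 1 \<le> m * m"
      using of_nat_mono[where ?'a = real, OF rs] unfolding m_def x_def y_def e_def
      by (simp only: of_nat_mult of_nat_add of_nat_numeral of_nat_1)
    show "real ?s \<le> real (a * b)"
      using of_nat_mono[where ?'a = real, OF \<open>?s \<le> a * b\<close>] unfolding m_def x_def y_def e_def
      by (simp only: of_nat_mult of_nat_add of_nat_numeral of_nat_1)
    show "real ?r \<le> real (a * b)"
      using of_nat_mono[where ?'a = real, OF \<open>?r \<le> a * b\<close>] unfolding m_def x_def y_def e_def
      by (simp only: of_nat_mult of_nat_add of_nat_numeral of_nat_1)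
    show "real (card \<G>) \<le> real ?s * x + e"
      using of_nat_mono[where ?'a = real, OF card_G_le_covers] unfolding m_def x_def y_def e_def
      by (simp only: of_nat_mult of_nat_add of_nat_numeral of_nat_1)
    show "real (card \<F>) \<le> real ?r * x + e"
      using of_nat_mono[where ?'a = real, OF sw.card_G_le_covers] unfolding m_def x_def y_def e_def
      by (simp only: of_nat_mult of_nat_add of_nat_numeral of_nat_1)
    show "real h * real h \<le> real (card \<F>) * real (card \<G>)"
      using of_nat_mono[where ?'a = real, OF h(1)] unfolding m_def x_def y_def e_def
      by (simp only: of_nat_mult of_nat_add of_nat_numeral of_nat_1)
    show "2 * m * x \<le> 2 * real h + m * m * y"
      using of_nat_mono[where ?'a = real, OF h(2)] unfolding m_def x_def y_def e_def
      by (simp only: of_nat_mult of_nat_add of_nat_numeral of_nat_1)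
  qed (simp_all add: y_def e_def m_def)
qed

end

section \<open>Identifying the extremal pairs\<close>

lemma subset_eq_of_card_product:
  assumes "A \<subseteq> A'" "B \<subseteq> B'" "finite A'" "finite B'" "A \<noteq> {}" "B \<noteq> {}"
    and le: "card A' * card B' \<le> card A * card B"
  shows "A = A' \<and> B = B'"
proof -
  have c: "card A \<le> card A'" "card B \<le> card B'" using assms by (auto intro: card_mono)
  have pos: "0 < card A" "0 < card B" using assms by (auto simp: card_gt_0_iff intro: finite_subset)
  have "card A = card A'"
  proof (rule ccontr)
    assume "card A \<noteq> card A'"
    with c have "card A < card A'" by simp
    then have "card A * card B < card A' * card B" using pos by simp
    also have "\<dots> \<le> card A' * card B'" using c by simp
    finally show False using le by simp
  qed
  moreover have "card B = card B'"
  proof (rule ccontr)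
    assume "card B \<noteq> card B'"
    with c have "card B < card B'" by simp
    then have "card A * card B < card A * card B'" using pos by simp
    also have "\<dots> \<le> card A' * card B'" using c by simp
    finally show False using le by simp
  qed
  ultimately show ?thesis
    using card_subset_eq[OF assms(3,1)] card_subset_eq[OF assms(4,2)] by simp
qed

section \<open>Sizes of the families H1 and H2\<close>

context finite_vector_space
begin

text \<open>The first part is the complement, among the k-spaces through A, of those meeting L in A
  only. The point of the formula is that L and M enter only through their dimension, so the size
  does not depend on how they meet.\<close>

lemma card_H1:
  assumes A: "subspace A" "dim A = t" "A \<subseteq> L" "A \<subseteq> M" and L: "subspace L" "dim L = Suc k"
    and M: "subspace M" "dim M = Suc k" and tk: "t < k"
  shows "card (H1 scale k t L M A) =
    (over_count k t - avoid_count q (n - t) (Suc k - t) (k - t)) + (qnum q (Suc k) - qnum q (Suc k - t))"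
proof -
  let ?B1 = "{F \<in> intv {0} UNIV k. A \<subseteq> F \<and> t + 1 \<le> dim (F \<inter> L)}"
  let ?B2 = "{F \<in> intv {0} M k. \<not> A \<subseteq> F}"
  let ?N = "{F \<in> intv A UNIV k. F \<inter> L = A \<inter> L}"
  have AL: "A \<inter> L = A" using A by auto
  have "?B1 = intv A UNIV k - ?N"
  proof (intro set_eqI)
    fix F
    have "t + 1 \<le> dim (F \<inter> L) \<longleftrightarrow> F \<inter> L \<noteq> A" if F: "subspace F" "A \<subseteq> F"
    proof
      assume "t + 1 \<le> dim (F \<inter> L)" then show "F \<inter> L \<noteq> A" using A(2) by auto
    next
      assume ne: "F \<inter> L \<noteq> A"
      have "dim A < dim (F \<inter> L)"
        using F A ne by (intro dim_less[OF A(1) subspace_inter[OF F(1) L(1)]]) auto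
      then show "t + 1 \<le> dim (F \<inter> L)" using A by simp
    qed
    then show "F \<in> ?B1 \<longleftrightarrow> F \<in> intv A UNIV k - ?N"
      unfolding AL by (auto simp: intv_def subspace_0)
  qed
  then have "card ?B1 = card (intv A UNIV k) - card ?N" by (simp add: card_Diff_subset)
  also have "card (intv A UNIV k) = over_count k t" using card_over[OF A(1)] A(2) by simp
  also have "card ?N = avoid_count q (n - t) (Suc k - t) (k - t)"
    using card_avoiding[OF A(1) subspace_UNIV L(1), of "k - t" k] A L tk AL by simp
  finally have B1: "card ?B1 = over_count k t - avoid_count q (n - t) (Suc k - t) (k - t)" .
  have "?B2 = intv {0} M k - intv A M k" by (auto simp: intv_def)
  moreover have "intv A M k \<subseteq> intv {0} M k" by (auto simp: intv_def subspace_0)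
  ultimately have "card ?B2 = card (intv {0} M k) - card (intv A M k)" by (simp add: card_Diff_subset)
  also have "card (intv {0} M k) = qnum q (Suc k)" by (rule card_hyperplanes[OF M])
  also have "card (intv A M k) = qnum q (Suc k - t)"
    using card_hyperplanes_over[OF A(1) M(1) A(4), of "k - t"] A M tk by (simp add: Suc_diff_le)
  finally have B2: "card ?B2 = qnum q (Suc k) - qnum q (Suc k - t)" .
  have "card (H1 scale k t L M A) = card ?B1 + card ?B2"
    unfolding H1_eq by (intro card_Un_disjoint) auto
  then show ?thesis unfolding B1 B2 .
qed

text \<open>Counts pairs (S, F) with S a hyperplane of Z inside F. An F meeting Z in dimension t + 1
  contains one such S, an F over Z contains all \<open>qnum q (t + 2)\<close> of them; this is the
  only overcounting.\<close>

lemma card_H2_ge: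
  assumes Z: "subspace Z" "dim Z = t + 2"
  shows "qnum q (t + 2) * over_count k (Suc t) \<le>
    card (H2 scale k t Z) + (qnum q (t + 2) - 1) * over_count k (t + 2)"
proof -
  let ?I = "intv {0} Z (Suc t)" and ?c = "qnum q (t + 2)"
  have c: "card ?I = ?c" using card_hyperplanes[of Z "Suc t"] Z by simp
  have "?c * over_count k (Suc t) = (\<Sum>S\<in>?I. over_count k (Suc t))" using c by simp
  also have "\<dots> = (\<Sum>S\<in>?I. card {F \<in> H2 scale k t Z. S \<subseteq> F})"
  proof (rule sum.cong[OF refl])
    fix S assume S: "S \<in> ?I"
    have "{F \<in> H2 scale k t Z. S \<subseteq> F} = intv S UNIV k"
    proof (intro equalityI subsetI)
      fix F assume F: "F \<in> intv S UNIV k"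
      have "dim S \<le> dim (F \<inter> Z)" using S F by (intro dim_subset) (auto simp: intv_def)
      with S F show "F \<in> {F \<in> H2 scale k t Z. S \<subseteq> F}" by (auto simp: H2_eq intv_def subspace_0)
    qed (auto simp: H2_eq intv_def)
    then show "over_count k (Suc t) = card {F \<in> H2 scale k t Z. S \<subseteq> F}"
      using card_over[of S k] S by (simp add: intv_def)
  qed
  also have "\<dots> = (\<Sum>F\<in>H2 scale k t Z. card {S \<in> ?I. S \<subseteq> F})"
    by (rule sum_multicount_gen) simp_all
  also have "\<dots> \<le> (\<Sum>F\<in>H2 scale k t Z. 1 + (if Z \<subseteq> F then ?c - 1 else 0))"
  proof (rule sum_mono)
    fix F assume F: "F \<in> H2 scale k t Z"
    show "card {S \<in> ?I. S \<subseteq> F} \<le> 1 + (if Z \<subseteq> F then ?c - 1 else 0)"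
    proof (cases "Z \<subseteq> F")
      case True
      have "card {S \<in> ?I. S \<subseteq> F} \<le> ?c" unfolding c[symmetric] by (intro card_mono) auto
      then show ?thesis using True by simp
    next
      case False
      have sF: "subspace (F \<inter> Z)" using F Z by (auto simp: H2_eq intv_def subspace_inter)
      have "dim (F \<inter> Z) < dim Z" using False by (intro dim_less[OF sF Z(1)]) auto
      then have d: "dim (F \<inter> Z) \<le> Suc t" using Z by simp
      have "{S \<in> ?I. S \<subseteq> F} \<subseteq> {F \<inter> Z}"
      proof
        fix S assume "S \<in> {S \<in> ?I. S \<subseteq> F}"
        then have "S = F \<inter> Z" using d by (intro subspace_dim_equal[OF _ sF]) (auto simp: intv_def)
        then show "S \<in> {F \<inter> Z}" by simp
      qed
      then have "card {S \<in> ?I. S \<subseteq> F} \<le> card {F \<inter> Z}" by (intro card_mono) auto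
      then show ?thesis by simp
    qed
  qed
  also have "\<dots> = card (H2 scale k t Z) + (\<Sum>F\<in>H2 scale k t Z. if Z \<subseteq> F then ?c - 1 else 0)"
    by (simp only: sum.distrib card_eq_sum)
  also have "(\<Sum>F\<in>H2 scale k t Z. if Z \<subseteq> F then ?c - 1 else 0) = (\<Sum>F\<in>{F \<in> H2 scale k t Z. Z \<subseteq> F}. ?c - 1)"
    by (rule sum.inter_filter[symmetric]) simp
  also have "\<dots> \<le> (?c - 1) * over_count k (t + 2)"
  proof -
    have "card {F \<in> H2 scale k t Z. Z \<subseteq> F} \<le> card (intv Z UNIV k)"
      by (intro card_mono) (auto simp: H2_eq intv_def)
    then show ?thesis using card_over[OF Z(1), of k] Z(2) by (simp add: mult.commute)
  qed
  finally show ?thesis by simp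
qed

text \<open>An F meeting L in dimension at least t + 2 contains at least q + 1 spaces S with A < S <
  L and dim S = t + 1. Hence the count of pairs (S, F) exceeds that of the F through A by at least q
  for each F over some (t + 2)-space R.\<close>

lemma card_H1_le:
  assumes A: "subspace A" "dim A = t" "A \<subseteq> L" and L: "subspace L" "dim L = Suc k"
    and M: "subspace M" "dim M = Suc k"
  shows "card (H1 scale k t L M A) + q * card (\<Union>R\<in>intv A L (t + 2). intv R UNIV k) \<le>
    qnum q (Suc k - t) * over_count k (Suc t) + qnum q (Suc k)"
proof -
  let ?B1 = "{F \<in> intv {0} UNIV k. A \<subseteq> F \<and> t + 1 \<le> dim (F \<inter> L)}"
  let ?B2 = "{F \<in> intv {0} M k. \<not> A \<subseteq> F}"
  let ?I = "intv A L (Suc t)" and ?b = "qnum q (Suc k - t)"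
  let ?R = "\<Union>R\<in>intv A L (t + 2). intv R UNIV k"
  have c: "card ?I = ?b" using card_extensions[OF A(1) L(1) A(3)] A L by simp
  have R_sub: "F \<in> ?B1" "t + 2 \<le> dim (F \<inter> L)" if "F \<in> ?R" for F
  proof -
    from that obtain R where R: "R \<in> intv A L (t + 2)" "F \<in> intv R UNIV k" by blast
    have "dim R \<le> dim (F \<inter> L)" using R by (intro dim_subset) (auto simp: intv_def)
    then show d: "t + 2 \<le> dim (F \<inter> L)" using R by (simp add: intv_def)
    show "F \<in> ?B1" using d R by (auto simp: intv_def subspace_0)
  qed
  have "card ?B1 + q * card ?R = (\<Sum>F\<in>?B1. 1 + (if F \<in> ?R then q else 0))"
  proof -
    have "(\<Sum>F\<in>?B1. if F \<in> ?R then q else 0) = (\<Sum>F\<in>{F \<in> ?B1. F \<in> ?R}. q)"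
      by (rule sum.inter_filter[symmetric]) simp
    also have "{F \<in> ?B1. F \<in> ?R} = ?R" using R_sub(1) by blast
    finally have "(\<Sum>F\<in>?B1. if F \<in> ?R then q else 0) = q * card ?R" by (simp add: mult.commute)
    moreover have "(\<Sum>F\<in>?B1. 1) = card ?B1" by (rule card_eq_sum[symmetric])
    ultimately show ?thesis by (simp only: sum.distrib)
  qed
  also have "\<dots> \<le> (\<Sum>F\<in>?B1. card {S \<in> ?I. S \<subseteq> F})"
  proof (rule sum_mono)
    fix F assume F: "F \<in> ?B1"
    then have sF: "subspace (F \<inter> L)" and AF: "A \<subseteq> F \<inter> L"
      using L A by (auto simp: intv_def subspace_inter)
    have "{S \<in> ?I. S \<subseteq> F} = intv A (F \<inter> L) (Suc (dim A))" using A by (auto simp: intv_def)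
    then have cc: "card {S \<in> ?I. S \<subseteq> F} = qnum q (dim (F \<inter> L) - t)"
      using card_extensions[OF A(1) sF AF] A by simp
    show "1 + (if F \<in> ?R then q else 0) \<le> card {S \<in> ?I. S \<subseteq> F}"
    proof (cases "F \<in> ?R")
      case True
      have "Suc (Suc 0) \<le> dim (F \<inter> L) - t" using R_sub(2)[OF True] by linarith
      from qnum_mono[OF this, of q] show ?thesis unfolding cc using True by (simp add: qnum_Suc)
    next
      case False
      have "t + 1 \<le> dim (F \<inter> L)" using F by blast
      then have "Suc 0 \<le> dim (F \<inter> L) - t" by linarith
      from qnum_mono[OF this, of q] show ?thesis unfolding cc using False by simp
    qed
  qed
  also have "\<dots> = (\<Sum>S\<in>?I. card {F \<in> ?B1. S \<subseteq> F})"
    by (rule sum_multicount_gen[symmetric]) simp_all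
  also have "\<dots> \<le> (\<Sum>S\<in>?I. over_count k (Suc t))"
  proof (rule sum_mono)
    fix S assume S: "S \<in> ?I"
    have "card {F \<in> ?B1. S \<subseteq> F} \<le> card (intv S UNIV k)" by (intro card_mono) (auto simp: intv_def)
    then show "card {F \<in> ?B1. S \<subseteq> F} \<le> over_count k (Suc t)"
      using card_over[of S k] S by (simp add: intv_def)
  qed
  also have "\<dots> = ?b * over_count k (Suc t)" using c by simp
  finally have 1: "card ?B1 + q * card ?R \<le> ?b * over_count k (Suc t)" .
  have "card ?B2 \<le> card (intv {0} M k)" by (intro card_mono) auto
  then have 2: "card ?B2 \<le> qnum q (Suc k)" using card_hyperplanes[OF M] by simp
  have "card (H1 scale k t L M A) \<le> card ?B1 + card ?B2" unfolding H1_eq by (rule card_Un_le)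
  with 1 2 show ?thesis by linarith
qed

text \<open>Both leading terms are c X, with c = \<open>qnum q (t + 2)\<close>. With a =
  \<open>qnum q (t + 1)\<close>, H2 falls short by at most q a Y, but H1 by about q |I| Y, where |I|
  = c a / (q + 1) \<ge> 5 a. As t \<ge> 2 gives t + 3 \<le> k, the hyperplanes of M are at most Y in
  number; for t = 1 they are more.\<close>

lemma card_H1_less_card_H2:
  assumes k: "k = 2 * t + 1" and t: "2 \<le> t" and nk: "4 * k + 6 \<le> n"
    and A: "subspace A" "dim A = t" "A \<subseteq> L" and L: "subspace L" "dim L = Suc k"
    and M: "subspace M" "dim M = Suc k" and Z: "subspace Z" "dim Z = t + 2"
  shows "card (H1 scale k t L M A) < card (H2 scale k t Z)"
proof -
  let ?X = "over_count k (Suc t)" and ?Y = "over_count k (t + 2)" and ?W = "over_count k (t + 3)"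
  let ?a = "qnum q (t + 1)" and ?c = "qnum q (t + 2)"
  let ?I = "intv A L (t + 2)"
  define N2 where "N2 = card (\<Union>R\<in>?I. intv R UNIV k)"
  have kn: "k \<le> n" using nk by simp
  have kt: "Suc k - t = t + 2" using k by simp
  obtain S' where S': "S' \<in> intv A L (Suc (dim A))"
    using extension_exists[OF A(1) L(1) A(3)] A L k by auto
  have "card ?I * qnum q 2 = ?c * card (intv S' L (t + 2))"
    using card_intv_rec[OF A(1) L(1) _ S', of "t + 2"] A(2) L(2) kt by simp
  also have "card (intv S' L (t + 2)) = ?a"
    using card_extensions[of S' L] S' L A k by (simp add: intv_def)
  finally have rho: "card ?I * qnum q 2 = ?c * ?a" .
  have q2: "qnum q 2 = q + 1" by (simp add: eval_nat_numeral qnum_Suc)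
  have q4: "qnum q 4 = (q + 1) * (q * q + 1)" by (simp add: eval_nat_numeral qnum_Suc algebra_simps)
  \<comment> \<open>Here t \<ge> 2 enters; the 5 is the value of q^2 + 1 at q = 2.\<close>
  have "qnum q 4 \<le> ?c" using t by (intro qnum_mono) simp
  moreover have "5 \<le> q * q + 1" using mult_le_mono[OF q_ge_2 q_ge_2] by simp
  ultimately have "(q + 1) * 5 \<le> ?c" unfolding q4 by (metis le_trans mult_le_mono2)
  then have "(q + 1) * 5 * ?a \<le> card ?I * (q + 1)" using rho unfolding q2 by (metis mult_le_mono1)
  then have "(5 * ?a) * (q + 1) \<le> card ?I * (q + 1)" by (simp only: mult_ac)
  then have rho5: "5 * ?a \<le> card ?I" unfolding mult_le_cancel2 by simp
  have "card ?I \<le> (q ^ (dim L - (t + 2) + 1)) ^ 2" using A L by (intro card_intv_le) auto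
  also have "dim L - (t + 2) + 1 = t + 1" using L k by simp
  also have "(q ^ (t + 1)) ^ 2 = q ^ (2 * t + 2)" by (simp only: power_mult[symmetric] add_mult_distrib) (simp add: mult.commute)
  finally have rho_le: "card ?I \<le> q ^ (2 * t + 2)" .
  have Wle: "?W * q ^ (n - k) \<le> ?Y" using over_count_Suc_le[OF kn, of "t + 2"] by (simp add: numeral_3_eq_3)
  have "card ?I * card ?I * ?W \<le> q ^ (2 * t + 2) * q ^ (2 * t + 2) * ?W"
    by (intro mult_le_mono rho_le order_refl)
  also have "\<dots> = ?W * q ^ (4 * t + 4)"
  proof -
    have "4 * t + 4 = (2 * t + 2) + (2 * t + 2)" by simp
    then show ?thesis by (simp only: power_add mult_ac)
  qed
  also have "\<dots> \<le> ?W * q ^ (n - k)" using nk k q_pos by (intro mult_le_mono2 power_increasing) auto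
  also note Wle
  finally have err: "card ?I * card ?I * ?W \<le> ?Y" .
  have bonf: "2 * card ?I * ?Y \<le> 2 * N2 + card ?I * card ?I * over_count k (Suc (t + 2))"
    unfolding N2_def by (rule card_Union_over_ge[OF kn]) (auto simp: intv_def)
  have "Suc (t + 2) = t + 3" by simp
  from bonf[unfolded this] err have "2 * card ?I * ?Y \<le> 2 * N2 + ?Y" by linarith
  moreover have "10 * ?a * ?Y \<le> 2 * card ?I * ?Y" using rho5 by simp
  ultimately have N2: "10 * ?a * ?Y \<le> 2 * N2 + ?Y" by linarith
  have a1: "1 \<le> ?a" by (simp add: qnum_Suc)
  have "1 * ?Y \<le> ?a * ?Y" using a1 by (rule mult_le_mono1)
  with N2 have N2': "9 * (?a * ?Y) \<le> 2 * N2" unfolding mult.assoc by linarith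
  have Ypos: "0 < ?Y" using k t by (intro over_count_pos kn) simp
  have "qnum q (Suc k) \<le> q ^ (Suc k)" using qnum_less_power[OF q_ge_2] less_imp_le by blast
  also have "\<dots> \<le> 1 * q ^ (n - k)" using nk q_pos by (simp add: power_increasing del: power_Suc)
  also have "\<dots> \<le> ?W * q ^ (n - k)"
    using over_count_pos[of "t + 3" k] k t kn by (intro mult_le_mono1) simp
  also note Wle
  finally have small: "qnum q (Suc k) \<le> ?Y" .
  have c: "?c = q * ?a + 1" by (simp add: qnum_Suc)
  have H1: "card (H1 scale k t L M A) + q * N2 \<le> ?c * ?X + ?Y"
    using card_H1_le[OF A L M] small unfolding N2_def kt by linarith
  have H2: "?c * ?X \<le> card (H2 scale k t Z) + q * ?a * ?Y" using card_H2_ge[OF Z, of k] unfolding c by simp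
  have "q * (9 * (?a * ?Y)) \<le> q * (2 * N2)" using N2' by (rule mult_le_mono2)
  then have "9 * (q * ?a * ?Y) \<le> 2 * (q * N2)" by (simp only: mult_ac)
  moreover have "1 * ?Y \<le> (q * ?a) * ?Y" using a1 q_pos by (intro mult_le_mono1) simp
  ultimately have "q * ?a * ?Y + ?Y < q * N2" using Ypos by linarith
  with H1 H2 show ?thesis by linarith
qed

end

section \<open>From the covers back to the families\<close>

context extremal_pair
begin

lemma F_nonempty: "\<F> \<noteq> {}"
  by (rule extremal_pair.G_nonempty[OF swap])

text \<open>If F met Z in dimension at most t, a hyperplane of Z avoiding a nonzero vector of F
  \<inter> Z would meet F in dimension below t although it is a cover. Such a vector exists because
  t > 0.\<close>

lemma subset_H2:
  assumes Z: "subspace Z" "dim Z = t + 2" and cov: "intv {0} Z (Suc t) \<subseteq> covers (Suc t)"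
  shows "\<F> \<subseteq> H2 scale k t Z"
proof
  fix F assume F: "F \<in> \<F>"
  have meet: "t \<le> dim (S \<inter> F)" if "S \<in> intv {0} Z (Suc t)" for S
    using subsetD[OF cov that] F by (simp add: covers_def)
  have sI: "subspace (F \<inter> Z)" using F_members(1)[OF F] Z(1) by (rule subspace_inter)
  have "Suc t \<le> dim (F \<inter> Z)"
  proof (rule ccontr)
    assume "\<not> ?thesis"
    then have small: "dim (F \<inter> Z) \<le> t" by simp
    obtain S where S: "S \<in> intv {0} Z (Suc t)"
      using intv_nonempty[of "{0}" Z "Suc t"] Z subspace_0 by auto
    have "dim (S \<inter> F) \<le> dim (F \<inter> Z)" using S by (intro dim_subset) (auto simp: intv_def)
    with meet[OF S] t_pos have "dim (F \<inter> Z) \<noteq> 0" by linarith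
    then have "\<not> F \<inter> Z \<subseteq> {0}" by (simp only: dim_eq_0 not_False_eq_True)
    then obtain x where x: "x \<in> F \<inter> Z" "x \<noteq> 0" by blast
    obtain H where H: "H \<in> intv {0} Z (Suc t)" "x \<notin> H"
      using hyperplane_avoiding[of Z "Suc t" x] Z x(2) by auto
    have sHF: "subspace (H \<inter> F)"
      using intvD(1)[OF H(1)] F_members(1)[OF F] by (rule subspace_inter)
    have "dim (H \<inter> F) < dim (F \<inter> Z)"
      using x H by (intro dim_less[OF sHF sI]) (auto simp: intv_def)
    with meet[OF H(1)] small show False by simp
  qed
  then show "F \<in> H2 scale k t Z" using F F_sub by (auto simp: H2_eq)
qed

text \<open>If F does not contain A, each cover S of the pencil is A + (S \<inter> F). These covers
  exhaust L, so L lies in A + F, and a comparison of dimensions gives L = A + F.\<close>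

lemma in_pencil_space:
  assumes A: "subspace A" "dim A = t" and L: "subspace L" "dim L = Suc k" "A \<subseteq> L"
    and cov: "intv A L (Suc t) \<subseteq> covers (Suc t)" and F: "F \<in> \<F>" and nA: "\<not> A \<subseteq> F"
  shows "F \<subseteq> L"
proof -
  note sF = F_members[OF F]
  have eq: "A \<squnion> (S \<inter> F) = S" "A \<inter> (S \<inter> F) = A \<inter> F" "t \<le> dim (S \<inter> F)" "dim S = Suc t" "subspace S"
    if S: "S \<in> intv A L (Suc t)" for S
  proof -
    note s = intvD[OF S]
    show m: "t \<le> dim (S \<inter> F)" using subsetD[OF cov S] F by (simp add: covers_def)
    have "A \<noteq> S \<inter> F" using nA by blast
    then show "A \<squnion> (S \<inter> F) = S"
      using A m s(2,4) by (intro ssum_eq_of_hyperplanes[OF A(1) subspace_inter[OF s(1) sF(1)], of t] s(1)) auto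
    show "A \<inter> (S \<inter> F) = A \<inter> F" using s(2) by auto
    show "dim S = Suc t" "subspace S" by (rule s)+
  qed
  have L_sub: "L \<subseteq> A \<squnion> F"
  proof
    fix x assume x: "x \<in> L"
    show "x \<in> A \<squnion> F"
    proof (cases "x \<in> A")
      case True
      then show ?thesis using ssum_upper by auto
    next
      case False
      then have "span (insert x A) \<in> intv A L (Suc t)"
        using intv_extensions_eq[OF A(1) L(1,3)] A(2) x by auto
      from eq(1)[OF this] have "span (insert x A) \<subseteq> A \<squnion> F"
        by (metis inf_le2 span_mono sup.mono order_refl)
      then show ?thesis using span_base[of x "insert x A"] by auto
    qed
  qed
  obtain S where S: "S \<in> intv A L (Suc t)"
    using extension_exists[OF A(1) L(1,3)] A(2) L(2) tk by auto
  have "dim S + dim (A \<inter> F) = dim A + dim (S \<inter> F)"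
    using dim_ssum[OF A(1) subspace_inter[OF eq(5)[OF S] sF(1)]] unfolding eq(1,2)[OF S] .
  then have "dim (A \<squnion> F) \<le> dim L"
    using dim_ssum[OF A(1) sF(1)] eq(3,4)[OF S] A(2) sF(2) L(2) tk by linarith
  then have "L = A \<squnion> F" using L_sub by (intro subspace_dim_equal L(1) subspace_span)
  then show ?thesis using ssum_upper(2)[of F A] by simp
qed

lemma non_pencil_member:
  assumes A: "dim A = t" obtains F where "F \<in> \<F>" "\<not> A \<subseteq> F"
proof -
  have "\<not> (\<forall>F\<in>\<F>. A \<subseteq> F)"
  proof
    assume "\<forall>F\<in>\<F>. A \<subseteq> F"
    then have "dim A \<le> dim (\<Inter>\<F>)" by (intro dim_subset) blast
    with F_nt A show False by simp
  qed
  with that show ?thesis by blast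
qed

text \<open>A member G through A is tested against an F not through A, which exists by nontriviality
  and lies in L: A + (F \<inter> G) lies in G \<inter> L and is larger than A. Members not through A
  are handled by \<open>in_pencil_space\<close> for the exchanged pair.\<close>

lemma subset_H1:
  assumes A: "subspace A" "dim A = t" and L: "subspace L" "dim L = Suc k" "A \<subseteq> L"
    and L': "subspace L'" "dim L' = Suc k" "A \<subseteq> L'"
    and cov: "intv A L (Suc t) \<subseteq> covers (Suc t)"
    and cov': "intv A L' (Suc t) \<subseteq> extremal_pair.covers scale t \<G> (Suc t)"
  shows "\<G> \<subseteq> H1 scale k t L L' A"
proof
  interpret sw: extremal_pair scale Basis q n k t \<G> \<F> by (rule swap)
  fix G assume G: "G \<in> \<G>"
  show "G \<in> H1 scale k t L L' A"
  proof (cases "A \<subseteq> G")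
    case False
    have "G \<subseteq> L'" by (rule sw.in_pencil_space[OF A L' cov' G False])
    then show ?thesis using False G G_sub by (auto simp: H1_eq intv_def)
  next
    case True
    obtain F where F: "F \<in> \<F>" "\<not> A \<subseteq> F" by (rule non_pencil_member[OF A(2)])
    have FL: "F \<subseteq> L" by (rule in_pencil_space[OF A L cov F])
    have s: "subspace (F \<inter> G)" "subspace (G \<inter> L)"
      using F_members(1)[OF F(1)] G_members(1)[OF G] L(1) by (simp_all add: subspace_inter)
    have "A \<noteq> F \<inter> G" using F(2) by blast
    then have "Suc t \<le> dim (A \<squnion> (F \<inter> G))"
      using A(2) cross[OF F(1) G] by (intro dim_ssum_gt_of_neq A(1) s) simp_all
    also have "\<dots> \<le> dim (G \<inter> L)"
      using True L(3) FL by (intro dim_subset ssum_least s) auto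
    finally show ?thesis using True G G_sub by (auto simp: H1_eq)
  qed
qed

text \<open>If dim (L \<inter> L') \<le> t + 1, all members of \<open>\<F>\<close> not through A
  contain one fixed t-space P, so \<open>\<F>\<close> misses some hyperplane of L and is a proper
  part of its H1 family. By \<open>card_H1\<close> the product is then below that of the competitor
  with L' = L.\<close>

lemma pencil_spaces_meet:
  assumes A: "subspace A" "dim A = t" and L: "subspace L" "dim L = Suc k" "A \<subseteq> L"
    and L': "subspace L'" "dim L' = Suc k" "A \<subseteq> L'"
    and cov: "intv A L (Suc t) \<subseteq> covers (Suc t)"
    and cov': "intv A L' (Suc t) \<subseteq> extremal_pair.covers scale t \<G> (Suc t)"
  shows "t + 2 \<le> dim (L \<inter> L')"
proof (rule ccontr)
  interpret sw: extremal_pair scale Basis q n k t \<G> \<F> by (rule swap)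
  let ?I = "L \<inter> L'"
  assume "\<not> ?thesis"
  then have dI: "dim ?I \<le> Suc t" by simp
  have sI: "subspace ?I" using L(1) L'(1) by (rule subspace_inter)
  obtain G0 where G0: "G0 \<in> \<G>" "\<not> A \<subseteq> G0" by (rule sw.non_pencil_member[OF A(2)])
  have G0L: "G0 \<subseteq> L'" by (rule sw.in_pencil_space[OF A L' cov' G0])
  let ?P = "G0 \<inter> ?I"
  have sP: "subspace ?P" using G_members(1)[OF G0(1)] sI by (rule subspace_inter)
  have "dim ?P < dim ?I" using G0(2) L(3) L'(3) by (intro dim_less[OF sP sI]) blast
  then have dP: "dim ?P \<le> t" using dI by simp
  have P: "F \<inter> G0 = ?P" if F: "F \<in> \<F>" "\<not> A \<subseteq> F" for F
  proof -
    have FL: "F \<subseteq> L" by (rule in_pencil_space[OF A L cov F])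
    show ?thesis
      using FL G0L dP cross[OF F(1) G0(1)]
      by (intro subspace_dim_equal[OF subspace_inter[OF F_members(1)[OF F(1)] G_members(1)[OF G0(1)]] sP]) auto
  qed
  obtain F0 where F0: "F0 \<in> \<F>" "\<not> A \<subseteq> F0" by (rule non_pencil_member[OF A(2)])
  have dP': "dim ?P = t" using cross[OF F0(1) G0(1)] dP unfolding P[OF F0] by simp
  have hyp: "card (intv B L k) = qnum q (Suc k - t)" if "subspace B" "dim B = t" "B \<subseteq> L" for B
    using card_hyperplanes_over[OF that(1) L(1) that(3), of "k - t"] that(2) L(2) tk by (simp add: Suc_diff_le)
  \<comment> \<open>At most 2 qnum q (k + 1 - t) \<le> q qnum q k hyperplanes of L contain A or P,
    and L has one more than q qnum q k, so one of them contains neither.\<close>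
  have "card (intv A L k \<union> intv ?P L k) \<le> card (intv A L k) + card (intv ?P L k)" by (rule card_Un_le)
  also have "\<dots> = 2 * qnum q (Suc k - t)" using hyp[OF A L(3)] hyp[OF sP dP'] by auto
  also have "\<dots> \<le> 2 * qnum q k" using t_pos by (intro mult_le_mono2 qnum_mono) simp
  also have "\<dots> \<le> q * qnum q k" using q_ge_2 by (rule mult_le_mono1)
  also have "\<dots> < card (intv {0} L k)" using card_hyperplanes[OF L(1,2)] by (simp add: qnum_Suc)
  finally have "\<not> intv {0} L k \<subseteq> intv A L k \<union> intv ?P L k"
    using card_mono[OF finite_VV, of "intv {0} L k" "intv A L k \<union> intv ?P L k"] by auto
  then obtain H where H: "H \<in> intv {0} L k" "\<not> A \<subseteq> H" "\<not> ?P \<subseteq> H" by (auto simp: intv_def)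
  have "H \<notin> \<F>"
  proof
    assume "H \<in> \<F>"
    from P[OF this H(2)] H(3) show False by blast
  qed
  moreover have "H \<in> H1 scale k t L' L A" using H by (simp add: H1_eq)
  ultimately have "\<F> \<subset> H1 scale k t L' L A"
    using sw.subset_H1[OF A L' L cov' cov] by auto
  then have lt: "card \<F> < card (H1 scale k t L' L A)" by (intro psubset_card_mono) auto
  have le: "card \<G> \<le> card (H1 scale k t L L' A)"
    using subset_H1[OF A L L' cov cov'] by (intro card_mono) auto
  have c1: "card (H1 scale k t L' L A) = card (H1 scale k t L L A)"
    using card_H1[OF A L'(3) L(3) L'(1,2) L(1,2) tk]
      card_H1[OF A L(3) L(3) L(1,2) L(1,2) tk] by simp
  have c2: "card (H1 scale k t L L' A) = card (H1 scale k t L L A)"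
    using card_H1[OF A L(3) L'(3) L(1,2) L'(1,2) tk]
      card_H1[OF A L(3) L(3) L(1,2) L(1,2) tk] by simp
  have "card \<F> * card \<G> < card (H1 scale k t L L A) * card (H1 scale k t L L A)"
    using lt le unfolding c1 c2
    by (intro order_le_less_trans[OF mult_le_mono2[OF le[unfolded c2]]]) simp
  with H1_lower[OF L(1,2) A L(3)] show False by simp
qed

text \<open>The H1 pair contains the given one, so its intersections have dimension below t too and
  maximality applies to it; a product that is not larger forces equality.\<close>

lemma equal_H1:
  assumes A: "subspace A" "dim A = t" and L: "subspace L" "dim L = Suc k" "A \<subseteq> L"
    and L': "subspace L'" "dim L' = Suc k" "A \<subseteq> L'"
    and cov: "intv A L (Suc t) \<subseteq> covers (Suc t)"
    and cov': "intv A L' (Suc t) \<subseteq> extremal_pair.covers scale t \<G> (Suc t)"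
  shows "\<F> = H1 scale k t L' L A \<and> \<G> = H1 scale k t L L' A"
proof -
  interpret sw: extremal_pair scale Basis q n k t \<G> \<F> by (rule swap)
  have FH: "\<F> \<subseteq> H1 scale k t L' L A" by (rule sw.subset_H1[OF A L' L cov' cov])
  have GH: "\<G> \<subseteq> H1 scale k t L L' A" by (rule subset_H1[OF A L L' cov cov'])
  have m: "t + 2 \<le> dim (L \<inter> L')" by (rule pencil_spaces_meet[OF assms])
  have "dim (\<Inter>(H1 scale k t L' L A)) \<le> dim (\<Inter>\<F>)" "dim (\<Inter>(H1 scale k t L L' A)) \<le> dim (\<Inter>\<G>)"
    using FH GH by (intro dim_subset; blast)+
  then have "card (H1 scale k t L' L A) * card (H1 scale k t L L' A) \<le> card \<F> * card \<G>"
    using F_nt G_nt m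
    by (intro maximal H1_subset H1_cross[OF L'(1,2) L(1,2) A]) auto
  then show ?thesis
    by (intro subset_eq_of_card_product FH GH F_nonempty G_nonempty) auto
qed

text \<open>The two cover structures need b \<le> c and c \<le> b, that is k \<le> 2 t + 1 and k
  \<ge> 2 t + 1. At equality the pencil loses to a pair of equal H2 families if t \<ge> 2, which
  leaves t = 1 and k = 3.\<close>

lemma classification:
  "(\<exists>Z. subspace Z \<and> dim Z = t + 2 \<and> \<F> = H2 scale k t Z \<and> \<G> = H2 scale k t Z \<and> k \<le> 2 * t + 1) \<or>
   (\<exists>A L M. subspace A \<and> dim A = t \<and> subspace L \<and> dim L = Suc k \<and> subspace M \<and> dim M = Suc k \<and>
      A \<subseteq> M \<inter> L \<and> t + 2 \<le> dim (M \<inter> L) \<and> \<F> = H1 scale k t L M A \<and> \<G> = H1 scale k t M L A \<and>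
      (2 * t + 1 < k \<or> k = 3 \<and> t = 1))"
proof -
  interpret sw: extremal_pair scale Basis q n k t \<G> \<F> by (rule swap)
  interpret cc: cross_covers scale Basis q n k t "covers (Suc t)" "sw.covers (Suc t)"
    by (rule cross_covers)
  from cc.maximal_structure[OF covers_product]
  consider Z where "subspace Z" "dim Z = t + 2" "covers (Suc t) = intv {0} Z (Suc t)"
      "sw.covers (Suc t) = intv {0} Z (Suc t)" "b \<le> c"
    | A L L' where "subspace A" "dim A = t" "subspace L" "dim L = Suc k" "A \<subseteq> L"
      "subspace L'" "dim L' = Suc k" "A \<subseteq> L'"
      "covers (Suc t) = intv A L (Suc t)" "sw.covers (Suc t) = intv A L' (Suc t)" "c \<le> b"
    by (elim disjE exE conjE) blast+
  then show ?thesis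
  proof cases
    case (1 Z)
    have FZ: "\<F> \<subseteq> H2 scale k t Z" using subset_H2[OF 1(1,2)] 1(3) by simp
    have GZ: "\<G> \<subseteq> H2 scale k t Z" using sw.subset_H2[OF 1(1,2)] 1(4) by simp
    have "\<F> = H2 scale k t Z \<and> \<G> = H2 scale k t Z"
      by (rule subset_eq_of_card_product[OF FZ GZ finite_VV finite_VV F_nonempty G_nonempty H2_lower[OF 1(1,2)]])
    moreover have "k \<le> 2 * t + 1"
      using 1(5) qnum_less_iff[OF q_pos, of "t + 2" "Suc k - t"] by linarith
    ultimately show ?thesis using 1(1,2) by (intro disjI1 exI[of _ Z] conjI) auto
  next
    case (2 A L L')
    note A = 2(1,2) and L = 2(3-5) and L' = 2(6-8)
    have cov: "intv A L (Suc t) \<subseteq> covers (Suc t)" "intv A L' (Suc t) \<subseteq> sw.covers (Suc t)"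
      using 2(9,10) by simp_all
    have eq: "\<F> = H1 scale k t L' L A \<and> \<G> = H1 scale k t L L' A" by (rule equal_H1[OF A L L' cov])
    have m: "t + 2 \<le> dim (L \<inter> L')" by (rule pencil_spaces_meet[OF A L L' cov])
    have "2 * t + 1 \<le> k"
      using 2(11) qnum_less_iff[OF q_pos, of "Suc k - t" "t + 2"] by linarith
    moreover have "t = 1" if k: "k = 2 * t + 1"
    proof (rule ccontr)
      assume "t \<noteq> 1"
      then have t2: "2 \<le> t" using t_pos by simp
      obtain Z where Z: "subspace Z" "dim Z = t + 2"
        using intv_nonempty[of "{0}" UNIV "t + 2"] tk nk subspace_0 by (auto simp: intv_def)
      have "card \<F> < card (H2 scale k t Z)" "card \<G> < card (H2 scale k t Z)"
        using card_H1_less_card_H2[OF k t2 nk A L'(3,1,2) L(1,2) Z] card_H1_less_card_H2[OF k t2 nk A L(3,1,2) L'(1,2) Z] eq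
        by simp_all
      then have "card \<F> * card \<G> < card (H2 scale k t Z) * card (H2 scale k t Z)"
        by (intro mult_strict_mono) auto
      with H2_lower[OF Z] show False by simp
    qed
    ultimately have alt: "2 * t + 1 < k \<or> k = 3 \<and> t = 1" by linarith
    have AI: "A \<subseteq> L \<inter> L'" using L(3) L'(3) by simp
    \<comment> \<open>The covers of \<open>\<F>\<close> fill the pencil in L and restrict how
      members of \<open>\<G>\<close> meet L; so L takes the place of M in the statement, and L' that
      of L.\<close>
    show ?thesis
      by (rule disjI2, rule exI[of _ A], rule exI[of _ L'], rule exI[of _ L])
        (intro conjI A L(1,2) L'(1,2) m AI alt eq[THEN conjunct1] eq[THEN conjunct2])
  qed
qed

end

theorem theorem1p3:
  fixes scale :: "'a::{field,finite} \<Rightarrow> 'v::ab_group_add \<Rightarrow> 'v"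
    and n k t :: nat
    and \<F> \<G> :: "'v set set"
  assumes V: "vector_space scale"
    and dim_V: "vector_space.dim scale UNIV = n"
    and pos: "n > 0" "k > 0" "t > 0"
    and kt: "k \<ge> t + 1"
    and nk: "n \<ge> 4 * k + 6"
    and pair: "nontrivial_cross_pair scale k t \<F> \<G>"
    and maximal: "\<And>\<F>' \<G>'. nontrivial_cross_pair scale k t \<F>' \<G>' \<Longrightarrow>
        card \<F>' * card \<G>' \<le> card \<F> * card \<G>"
  shows "(k > 2 * t + 1 \<longrightarrow>
      (\<exists>M \<in> subspaces_of_dim scale UNIV (k + 1).
       \<exists>L \<in> subspaces_of_dim scale UNIV (k + 1).
       \<exists>T \<in> subspaces_of_dim scale (M \<inter> L) t.
         vector_space.dim scale (M \<inter> L) \<ge> t + 2 \<and>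
         \<F> = H1 scale k t L M T \<and>
         \<G> = H1 scale k t M L T))
    \<and> (k \<le> 2 * t + 1 \<longrightarrow>
      (\<exists>Z \<in> subspaces_of_dim scale UNIV (t + 2).
         \<F> = H2 scale k t Z \<and> \<G> = H2 scale k t Z) \<or>
      (k = 3 \<and> t = 1 \<and>
       (\<exists>M \<in> subspaces_of_dim scale UNIV 4.
        \<exists>L \<in> subspaces_of_dim scale UNIV 4.
        \<exists>T \<in> subspaces_of_dim scale (M \<inter> L) 1.
          vector_space.dim scale (M \<inter> L) \<ge> 3 \<and>
          \<F> = H1 scale k t L M T \<and>
          \<G> = H1 scale k t M L T)))"
proof -
  interpret vector_space scale by (rule V)
  obtain B where B: "independent B" "UNIV \<subseteq> span B" "card B = n"
    using basis_exists[of UNIV] dim_V by auto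
  interpret fv: finite_vector_space scale B "card (UNIV :: 'a set)" n
  proof
    show "finite B" using B(3) pos(1) by (simp add: card_ge_0_finite)
  qed (use B dim_V in auto)
  have pair_iff: "nontrivial_cross_pair scale k t \<F>' \<G>' \<longleftrightarrow>
      \<F>' \<subseteq> fv.intv {0} UNIV k \<and> \<G>' \<subseteq> fv.intv {0} UNIV k \<and>
      (\<forall>F\<in>\<F>'. \<forall>G\<in>\<G>'. t \<le> dim (F \<inter> G)) \<and> dim (\<Inter>\<F>') < t \<and> dim (\<Inter>\<G>') < t" for \<F>' \<G>'
    by (simp add: nontrivial_cross_pair_def cross_intersecting_def fv.subspaces_of_dim_eq)
  interpret ep: extremal_pair scale B "card (UNIV :: 'a set)" n k t \<F> \<G>
  proof
    fix \<F>' \<G>'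
    assume "\<F>' \<subseteq> fv.intv {0} UNIV k" "\<G>' \<subseteq> fv.intv {0} UNIV k"
      "\<And>F G. F \<in> \<F>' \<Longrightarrow> G \<in> \<G>' \<Longrightarrow> t \<le> dim (F \<inter> G)" "dim (\<Inter>\<F>') < t" "dim (\<Inter>\<G>') < t"
    then show "card \<F>' * card \<G>' \<le> card \<F> * card \<G>"
      using pair_iff[of \<F>' \<G>'] by (intro maximal) simp
  qed (use pair[unfolded pair_iff] pos kt nk in auto)
  have mem: "W \<in> subspaces_of_dim scale U j \<longleftrightarrow> subspace W \<and> W \<subseteq> U \<and> dim W = j" for W U j
    by (simp add: subspaces_of_dim_def)
  from ep.classification show ?thesis
  proof (elim disjE exE conjE)
    fix Z assume Z: "subspace Z" "dim Z = t + 2" "\<F> = H2 scale k t Z" "\<G> = H2 scale k t Z" "k \<le> 2 * t + 1"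
    then have "\<exists>Z \<in> subspaces_of_dim scale UNIV (t + 2). \<F> = H2 scale k t Z \<and> \<G> = H2 scale k t Z"
      by (intro bexI[of _ Z] conjI Z(3,4)) (simp add: mem)
    with Z(5) show ?thesis by linarith
  next
    fix A L M
    assume h: "subspace A" "dim A = t" "subspace L" "dim L = Suc k" "subspace M" "dim M = Suc k"
      "A \<subseteq> M \<inter> L" "t + 2 \<le> dim (M \<inter> L)" "\<F> = H1 scale k t L M A" "\<G> = H1 scale k t M L A"
      and k: "2 * t + 1 < k"
    have "\<exists>M \<in> subspaces_of_dim scale UNIV (k + 1). \<exists>L \<in> subspaces_of_dim scale UNIV (k + 1).
       \<exists>T \<in> subspaces_of_dim scale (M \<inter> L) t. dim (M \<inter> L) \<ge> t + 2 \<and>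
         \<F> = H1 scale k t L M T \<and> \<G> = H1 scale k t M L T"
    proof (rule bexI[of _ M], rule bexI[of _ L], rule bexI[of _ A], intro conjI)
      show "A \<in> subspaces_of_dim scale (M \<inter> L) t" using h by (simp add: mem)
    qed (fact h | simp add: mem h)+
    with k show ?thesis by linarith
  next
    fix A L M
    assume h: "subspace A" "dim A = t" "subspace L" "dim L = Suc k" "subspace M" "dim M = Suc k"
      "A \<subseteq> M \<inter> L" "t + 2 \<le> dim (M \<inter> L)" "\<F> = H1 scale k t L M A" "\<G> = H1 scale k t M L A"
      and k: "k = 3" "t = 1"
    have "\<exists>M \<in> subspaces_of_dim scale UNIV 4. \<exists>L \<in> subspaces_of_dim scale UNIV 4.
       \<exists>T \<in> subspaces_of_dim scale (M \<inter> L) 1. dim (M \<inter> L) \<ge> 3 \<and>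
         \<F> = H1 scale k t L M T \<and> \<G> = H1 scale k t M L T"
    proof (rule bexI[of _ M], rule bexI[of _ L], rule bexI[of _ A], intro conjI)
      show "A \<in> subspaces_of_dim scale (M \<inter> L) 1" using h k by (simp add: mem)
      show "3 \<le> dim (M \<inter> L)" using h(8) k by simp
      show "L \<in> subspaces_of_dim scale UNIV 4" "M \<in> subspaces_of_dim scale UNIV 4"
        using h(3-6) k by (simp_all add: mem)
    qed (fact h)+
    with k show ?thesis by linarith
  qed
qed

end
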